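(* (i) For any attainable $D$, every periodic ground state (PGS) is obtained as a tessellation by M-triangles and their $\mathbb{Z}^2$-shifts. (ii) Furthermore, if $D$ is non-sliding then every PGS is obtained from a max-dense sub-lattice by means of $\mathbb{Z}^2$-congruences. Consequently, for any non-sliding $D$ the set $\mathcal{P}(D)$ of PGSs is finite.
   Context: A number $D>0$ is attainable if $D^2=m^2+n^2$ for some integers $m,n$; all values $D$ considered are attainable. A $D$-admissible configuration is a map $\phi:\mathbb{Z}^2\to\{0,1\}$ such that any two distinct sites $x,y$ with $\phi(x)=\phi(y)=1$ (occupied sites) are at Euclidean distance $\ge D$; $\phi$ is identified with its set of occupied sites. A $D$-admissible configuration $\varphi$ is a ground state if one cannot remove finitely many occupied sites from $\varphi$ and replace them by a larger number of occupied sites without breaking $D$-admissibility. It is periodic if there are two linearly independent vectors $e_1,e_2$ with $\varphi(x)=\varphi(x+e_1)=\varphi(x+e_2)$ for all $x$. PGS means periodic ground state; $\mathcal{P}(D)$ is the set of PGSs for a given $D$. A $\mathbb{Z}^2$-triangle is a triangle with vertices in $\mathbb{Z}^2$. Consider the problem: minimize the area of a $\mathbb{Z}^2$-triangle with one vertex at the origin, all side-lengths $\ge D$ and all angles $\le\pi/2$. $S(D)$ denotes the doubled minimal area; any minimizing triangle is called an M-triangle for $D$. That a PGS is obtained as a tessellation by M-triangles and their shifts means that the plane is tessellated by such triangles, the set of their vertices being the set of occupied sites. A max-dense sub-lattice is a $D$-admissible sub-lattice of $\mathbb{Z}^2$ whose fundamental parallelogram has the minimal area $S(D)$, i.e. is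 composed of two M-triangles. $\mathbb{Z}^2$-congruences are the $\mathbb{Z}^2$-shifts, the rotation by $\pi/2$, the reflection about the $x$-axis, and their compositions. A value $D$ is sliding if there exist two or more M-triangles with a common side and with distinct third vertices lying in the same half-plane relative to the common side; otherwise $D$ is non-sliding. *)

theory Defs
  imports "HOL-Analysis.Analysis"
begin

text \<open>
  The lattice is kept inside the Euclidean plane, and a configuration
  (a 0/1-valued map on the lattice) is represented by its set of occupied sites.
\<close>

definition int_lattice :: "(real^2) set" where
  "int_lattice = {x. \<forall>i. x $ i \<in> \<int>}"

definition attainable :: "real \<Rightarrow> bool" where
  "attainable D \<longleftrightarrow> D > 0 \<and> (\<exists>m n :: int. D\<^sup>2 = of_int (m\<^sup>2 + n\<^sup>2))"

definition admissible :: "real \<Rightarrow> (real^2) set \<Rightarrow> bool" where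
  "admissible D \<phi> \<longleftrightarrow> \<phi> \<subseteq> int_lattice \<and> (\<forall>x\<in>\<phi>. \<forall>y\<in>\<phi>. x \<noteq> y \<longrightarrow> dist x y \<ge> D)"

text \<open>
  Restricting the inserted set \<open>G\<close> to finite sets loses nothing, since every subset of an
  admissible configuration is admissible.
\<close>

definition ground_state :: "real \<Rightarrow> (real^2) set \<Rightarrow> bool" where
  "ground_state D \<phi> \<longleftrightarrow> admissible D \<phi> \<and>
     \<not> (\<exists>F G. F \<subseteq> \<phi> \<and> finite F \<and> finite G \<and> G \<inter> (\<phi> - F) = {} \<and>
             card G > card F \<and> admissible D ((\<phi> - F) \<union> G))"

definition periodic :: "(real^2) set \<Rightarrow> bool" where
  "periodic \<phi> \<longleftrightarrow>
     (\<exists>e\<^sub>1\<in>int_lattice. \<exists>e\<^sub>2\<in>int_lattice. e\<^sub>1 \<noteq> e\<^sub>2 \<and> independent {e\<^sub>1, e\<^sub>2} \<and>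
        (\<forall>x\<in>int_lattice. (x \<in> \<phi> \<longleftrightarrow> x + e\<^sub>1 \<in> \<phi>) \<and> (x \<in> \<phi> \<longleftrightarrow> x + e\<^sub>2 \<in> \<phi>)))"

definition PGS :: "real \<Rightarrow> (real^2) set set" where
  "PGS D = {\<phi>. ground_state D \<phi> \<and> periodic \<phi>}"

text \<open>Triangles are given by their vertex sets; the solid triangle is the convex hull.\<close>

definition lattice_triangle :: "(real^2) set \<Rightarrow> bool" where
  "lattice_triangle T \<longleftrightarrow> T \<subseteq> int_lattice \<and> card T = 3 \<and> \<not> collinear T"

definition area :: "(real^2) set \<Rightarrow> real" where
  "area T = measure lebesgue (convex hull T)"

text \<open>The angle at \<open>a\<close> between the rays towards \<open>b\<close> and \<open>c\<close>.\<close>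

definition vertex_angle :: "real^2 \<Rightarrow> real^2 \<Rightarrow> real^2 \<Rightarrow> real" where
  "vertex_angle a b c = arccos (((b - a) \<bullet> (c - a)) / (norm (b - a) * norm (c - a)))"

definition feasible_triangle :: "real \<Rightarrow> (real^2) set \<Rightarrow> bool" where
  "feasible_triangle D T \<longleftrightarrow> lattice_triangle T \<and> 0 \<in> T \<and>
     (\<forall>a\<in>T. \<forall>b\<in>T - {a}. dist a b \<ge> D) \<and>
     (\<forall>a\<in>T. \<forall>b\<in>T - {a}. \<forall>c\<in>T - {a, b}. vertex_angle a b c \<le> pi / 2)"

definition M_triangle :: "real \<Rightarrow> (real^2) set \<Rightarrow> bool" where
  "M_triangle D T \<longleftrightarrow> is_arg_min area (feasible_triangle D) T"

definition S :: "real \<Rightarrow> real" where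
  "S D = 2 * (LEAST s. \<exists>T. feasible_triangle D T \<and> area T = s)"

definition M_tessellation :: "real \<Rightarrow> (real^2) set set \<Rightarrow> bool" where
  "M_tessellation D \<T> \<longleftrightarrow>
     (\<forall>T\<in>\<T>. \<exists>T\<^sub>0. \<exists>z\<in>int_lattice. M_triangle D T\<^sub>0 \<and> T = (\<lambda>x. x + z) ` T\<^sub>0) \<and>
     (\<Union>T\<in>\<T>. convex hull T) = UNIV \<and>
     pairwise (\<lambda>T T'. interior (convex hull T) \<inter> interior (convex hull T') = {}) \<T>"

definition sublattice_gen :: "real^2 \<Rightarrow> real^2 \<Rightarrow> (real^2) set" where
  "sublattice_gen u v = {of_int i *\<^sub>R u + of_int j *\<^sub>R v | i j :: int. True}"

definition fundamental_parallelogram :: "real^2 \<Rightarrow> real^2 \<Rightarrow> (real^2) set" where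
  "fundamental_parallelogram u v = {s *\<^sub>R u + t *\<^sub>R v | s t. s \<in> {0..1} \<and> t \<in> {0..1}}"

definition max_dense_sublattice :: "real \<Rightarrow> (real^2) set \<Rightarrow> bool" where
  "max_dense_sublattice D L \<longleftrightarrow>
     (\<exists>u\<in>int_lattice. \<exists>v\<in>int_lattice. u \<noteq> v \<and> independent {u, v} \<and>
        L = sublattice_gen u v \<and> admissible D L \<and>
        measure lebesgue (fundamental_parallelogram u v) = S D)"

inductive_set lattice_congruences :: "(real^2 \<Rightarrow> real^2) set" where
  shift: "z \<in> int_lattice \<Longrightarrow> (\<lambda>x. x + z) \<in> lattice_congruences"
| rotation: "(\<lambda>x. vector [- (x $ 2), x $ 1]) \<in> lattice_congruences"
| reflection: "(\<lambda>x. vector [x $ 1, - (x $ 2)]) \<in> lattice_congruences"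
| composition: "f \<in> lattice_congruences \<Longrightarrow> g \<in> lattice_congruences \<Longrightarrow> f \<circ> g \<in> lattice_congruences"

text \<open>\<open>c\<close> and \<open>c'\<close> lie in the same open half-plane bounded by the line through \<open>a\<close> and \<open>b\<close>.\<close>

definition same_half_plane :: "real^2 \<Rightarrow> real^2 \<Rightarrow> real^2 \<Rightarrow> real^2 \<Rightarrow> bool" where
  "same_half_plane a b c c' \<longleftrightarrow>
     (\<exists>n d. n \<bullet> a = d \<and> n \<bullet> b = d \<and> n \<bullet> c > d \<and> n \<bullet> c' > d)"

definition sliding :: "real \<Rightarrow> bool" where
  "sliding D \<longleftrightarrow>
     (\<exists>a b c c'. a \<noteq> b \<and> c \<noteq> c' \<and> M_triangle D {a, b, c} \<and> M_triangle D {a, b, c'} \<and>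
        same_half_plane a b c c')"

end

theory Submission
  imports Defs
begin

text \<open>
  The density of a periodic ground state \<open>\<phi>\<close> is bounded from both sides by that of a lattice
  spanned by an M-triangle, and the equality case of the upper bound yields the tessellation.

  The lower bound is a replacement argument: if \<open>\<phi>\<close> were sparser than a max-dense
  sub-lattice, then the sites in a large square could be exchanged for more sites of that sub-lattice
  (\<open>ground_state_density\<close>).

  For the upper bound, suppose that \<open>\<phi>\<close> has \<open>N\<close> sites modulo a period lattice.
  There is a periodic triangulation with vertex set \<open>\<phi>\<close>, and it has \<open>2 * N\<close>
  triangles modulo periods; so the claim is that their doubled areas are at least \<open>S D\<close> on
  average. For a triangle without obtuse angle this is the definition of \<open>S D\<close>. An obtuse
  triangle may be smaller, but in a Delaunay triangulation its neighbour makes up for it. Indeed, the doubled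
  area of a triangle is the sum, over its edges, of \<open>l\<^sup>2 / 2\<close> times the cotangent of the
  opposite angle, where \<open>l\<close> is the length of the edge. Let each obtuse triangle pass the part
  \<open>l\<^sup>2 / 2 - D\<^sup>2\<close> of the factor at its longest edge, where the cotangent is negative,
  to the neighbour across that edge. The Delaunay property says that the cotangents on the two sides of an
  edge have a nonnegative sum, so on either side the edge still contributes at least \<open>D\<^sup>2\<close>
  times its cotangent. Every other edge has a nonnegative cotangent and length at least \<open>D\<close>, so
  it contributes at least half of that. If \<open>x\<close>, \<open>y\<close>, \<open>z\<close> are the
  cotangents of a triangle that takes part in the exchange, with \<open>x\<close> at an edge where it does,
  the triangle is left with \<open>D\<^sup>2 * (x + (y + z) / 2)\<close> or more, and the relation \<open>x *
  y + y * z + z * x = 1\<close> makes this at least \<open>D\<^sup>2\<close>, with strict inequality if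
  \<open>x < 0\<close> (\<open>cot_ineq\<close>, \<open>share\<close>). Attainability enters here: half of a
  square of side \<open>D\<close> is a competitor, so \<open>S D \<le> D\<^sup>2\<close>
  (\<open>S_le\<close>). Hence the average is at least \<open>S D\<close> (\<open>packing_bound\<close>), and
  for a ground state it is equal to \<open>S D\<close>. Then no triangle is obtuse, nothing is exchanged, and
  each triangle is a translate of an M-triangle; this is the first part.

  Triangulations of the torus are represented by multisets of triangles subject to conditions that are linear
  in the multiset: boundary sums of antisymmetric edge functions vanish, points in general position are
  covered once, areas have a fixed sum. Such conditions are stable under subdivision and flips by purely local
  identities. Successive insertion of vertices gives existence (\<open>triangulation_exists\<close>), and
  flips that decrease an integral potential lead to the Delaunay property (\<open>delaunay_exists\<close>).

  Without sliding, the triangle across an edge can only be the reflection of the given one in the midpoint of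
  the edge (\<open>reflected_mate\<close>). So one triangle determines the whole tessellation, and
  \<open>\<phi>\<close> is a coset of a max-dense sub-lattice. Such cosets are invariant under the square
  lattice of side \<open>S D\<close>, which leaves finitely many.
\<close>

type_synonym tri = "(real^2) \<times> (real^2) \<times> (real^2)"

section \<open>Oriented triangles\<close>

text \<open>Twice the signed area, positive if \<open>a\<close>, \<open>b\<close>, \<open>c\<close> are in counterclockwise order.\<close>
definition area2 :: "real^2 \<Rightarrow> real^2 \<Rightarrow> real^2 \<Rightarrow> real" where
  "area2 a b c = (b$1 - a$1) * (c$2 - a$2) - (b$2 - a$2) * (c$1 - a$1)"

text \<open>\<open>apex_dot a b c / area2 a b c\<close> is the cotangent of the angle at \<open>c\<close>; its sign tells
  whether that angle is acute or obtuse.\<close>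
definition apex_dot :: "real^2 \<Rightarrow> real^2 \<Rightarrow> real^2 \<Rightarrow> real" where
  "apex_dot a b c = (a - c) \<bullet> (b - c)"

lemma apex_dot_coord: "apex_dot a b c = (a$1 - c$1) * (b$1 - c$1) + (a$2 - c$2) * (b$2 - c$2)"
  by (simp add: apex_dot_def inner_vec_def sum_2)

lemma dist_coord: "(dist a b)\<^sup>2 = (a$1 - b$1)\<^sup>2 + (a$2 - b$2)\<^sup>2" for a b :: "real^2"
  unfolding dist_norm power2_norm_eq_inner by (simp add: inner_vec_def sum_2 power2_eq_square)

lemma area2_rot: "area2 b c a = area2 a b c"
  by (simp add: area2_def algebra_simps)

lemma area2_swap: "area2 b a c = - area2 a b c"
  by (simp add: area2_def algebra_simps)

lemma area2_shift: "area2 (a + l) (b + l) (c + l) = area2 a b c"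
  by (simp add: area2_def)

lemma area2_shift_minus: "area2 (a - l) (b - l) (c - l) = area2 a b c"
  by (simp add: area2_def)

lemma area2_shift_point: "area2 a b (x - l) = area2 (a + l) (b + l) x"
  by (simp add: area2_def algebra_simps)

lemma apex_dot_swap: "apex_dot b a c = apex_dot a b c"
  by (simp add: apex_dot_def inner_commute)

lemma apex_dot_shift: "apex_dot (a - l) (b - l) (c - l) = apex_dot a b c"
  by (simp add: apex_dot_def)

lemma area2_degenerate [simp]: "area2 a a c = 0" "area2 a b a = 0" "area2 a b b = 0"
  by (simp_all add: area2_def)

lemma vec2_eq_iff: "x = y \<longleftrightarrow> x$1 = y$1 \<and> x$2 = y$2" for x y :: "real^2"
  by (simp add: vec_eq_iff forall_2)

text \<open>Affine functions of one point are determined by their values at the corners of a triangle. For the signed area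
  over a fixed edge this yields containments between triangles.\<close>
lemma area2_interpolate:
  "area2 u v y * area2 p q r = area2 u v p * area2 q r y + area2 u v q * area2 r p y + area2 u v r * area2 p q y"
  unfolding area2_def by algebra

lemma barycentric:
  assumes "area2 a b c \<noteq> 0"
  shows "x = (area2 b c x / area2 a b c) *\<^sub>R a + (area2 c a x / area2 a b c) *\<^sub>R b + (area2 a b x / area2 a b c) *\<^sub>R c"
    and "area2 b c x / area2 a b c + area2 c a x / area2 a b c + area2 a b x / area2 a b c = 1"
proof -
  have 1: "area2 b c x + area2 c a x + area2 a b x = area2 a b c"
    by (simp add: area2_def algebra_simps)
  then show "area2 b c x / area2 a b c + area2 c a x / area2 a b c + area2 a b x / area2 a b c = 1"
    using assms by (simp add: field_simps)
  have "area2 a b c * x$i = area2 b c x * a$i + area2 c a x * b$i + area2 a b x * c$i" for i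
  proof -
    have "i = 1 \<or> i = 2" by (rule exhaust_2)
    moreover have "area2 a b c * x$1 = area2 b c x * a$1 + area2 c a x * b$1 + area2 a b x * c$1"
      unfolding area2_def by algebra
    moreover have "area2 a b c * x$2 = area2 b c x * a$2 + area2 c a x * b$2 + area2 a b x * c$2"
      unfolding area2_def by algebra
    ultimately show ?thesis by auto
  qed
  then show "x = (area2 b c x / area2 a b c) *\<^sub>R a + (area2 c a x / area2 a b c) *\<^sub>R b + (area2 a b x / area2 a b c) *\<^sub>R c"
    using assms by (simp add: vec_eq_iff field_simps)
qed

lemma triangle_hull_iff:
  assumes "area2 a b c > 0"
  shows "x \<in> convex hull {a, b, c} \<longleftrightarrow> area2 a b x \<ge> 0 \<and> area2 b c x \<ge> 0 \<and> area2 c a x \<ge> 0"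
proof
  assume "x \<in> convex hull {a, b, c}"
  then obtain r s t where r: "0 \<le> r" "0 \<le> s" "0 \<le> t" "r + s + t = 1"
    and x: "x = r *\<^sub>R a + s *\<^sub>R b + t *\<^sub>R c"
    by (auto simp: convex_hull_3)
  have r1: "r = 1 - s - t" using r by simp
  have "area2 a b x = t * area2 a b c" "area2 b c x = r * area2 a b c" "area2 c a x = s * area2 a b c"
    unfolding x r1 area2_def by (simp_all add: algebra_simps)
  then show "area2 a b x \<ge> 0 \<and> area2 b c x \<ge> 0 \<and> area2 c a x \<ge> 0"
    using r assms by simp
next
  assume *: "area2 a b x \<ge> 0 \<and> area2 b c x \<ge> 0 \<and> area2 c a x \<ge> 0"
  have "area2 a b c \<noteq> 0" using assms by simp
  note b = barycentric[OF this, of x]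
  have "0 \<le> area2 b c x / area2 a b c" "0 \<le> area2 c a x / area2 a b c" "0 \<le> area2 a b x / area2 a b c"
    using * assms by simp_all
  with b show "x \<in> convex hull {a, b, c}"
    unfolding convex_hull_3 by blast
qed

fun inside :: "tri \<Rightarrow> real^2 \<Rightarrow> bool" where
  "inside (a, b, c) x \<longleftrightarrow> area2 a b x > 0 \<and> area2 b c x > 0 \<and> area2 c a x > 0"

fun tri_area2 :: "tri \<Rightarrow> real" where "tri_area2 (a, b, c) = area2 a b c"

fun boundary_sum :: "(real^2 \<Rightarrow> real^2 \<Rightarrow> real) \<Rightarrow> tri \<Rightarrow> real" where
  "boundary_sum w (a, b, c) = w a b + w b c + w c a"

text \<open>Up to a constant factor this is the volume between the paraboloid over a triangle and the plane through the
  three lifted corners, so a flip changes the sum by the volume of the lifted tetrahedron. For lattice triangles it is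
  an integer.\<close>
fun potential :: "tri \<Rightarrow> real" where
  "potential (a, b, c) = area2 a b c * ((dist a b)\<^sup>2 + (dist b c)\<^sup>2 + (dist c a)\<^sup>2)"

fun verts :: "tri \<Rightarrow> (real^2) set" where "verts (a, b, c) = {a, b, c}"

fun shift :: "real^2 \<Rightarrow> tri \<Rightarrow> tri" where
  "shift l (a, b, c) = (a + l, b + l, c + l)"

fun rot :: "tri \<Rightarrow> tri" where "rot (a, b, c) = (b, c, a)"

lemma inside_shift: "inside (shift l t) x \<longleftrightarrow> inside t (x - l)"
  by (cases t) (simp add: area2_shift_point)

lemma inside_rot: "inside (rot t) x \<longleftrightarrow> inside t x"
  by (cases t) auto

lemma inside_hull: "tri_area2 t > 0 \<Longrightarrow> inside t x \<Longrightarrow> x \<in> convex hull (verts t)"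
  by (cases t) (simp add: triangle_hull_iff)

lemma inside_norm_bound:
  assumes "tri_area2 t > 0" "inside t x"
  shows "norm x \<le> (\<Sum>v\<in>verts t. norm v)"
proof -
  have fin: "finite (verts t)" by (cases t) simp
  have "convex hull (verts t) \<subseteq> cball 0 (\<Sum>v\<in>verts t. norm v)"
    by (rule hull_minimal) (auto intro!: member_le_sum fin)
  with inside_hull[OF assms] show ?thesis by auto
qed

lemma open_inside: "open {x. inside t x}"
proof -
  obtain a b c where t: "t = (a, b, c)" by (cases t)
  have "{x. inside t x} = {x. 0 < area2 a b x} \<inter> {x. 0 < area2 b c x} \<inter> {x. 0 < area2 c a x}"
    by (auto simp: t)
  moreover have "open {x. 0 < area2 u v x}" for u v
    unfolding area2_def by (intro open_Collect_less continuous_intros)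
  ultimately show ?thesis by (simp add: open_Int)
qed

section \<open>Generic points\<close>

text \<open>Points on no line through two lattice points. They never lie on an edge of a lattice triangle, so that covering
  and disjointness of open triangles can be expressed by counting, with no boundary cases.\<close>
definition generic :: "real^2 \<Rightarrow> bool" where
  "generic x \<longleftrightarrow> (\<forall>a\<in>int_lattice. \<forall>b\<in>int_lattice. a \<noteq> b \<longrightarrow> area2 a b x \<noteq> 0)"

lemma int_lattice_coord: "x \<in> int_lattice \<longleftrightarrow> x$1 \<in> \<int> \<and> x$2 \<in> \<int>"
  by (simp add: int_lattice_def forall_2)

lemma int_lattice_add: "x \<in> int_lattice \<Longrightarrow> y \<in> int_lattice \<Longrightarrow> x + y \<in> int_lattice"
  and int_lattice_diff: "x \<in> int_lattice \<Longrightarrow> y \<in> int_lattice \<Longrightarrow> x - y \<in> int_lattice"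
  and int_lattice_scale: "x \<in> int_lattice \<Longrightarrow> of_int i *\<^sub>R x \<in> int_lattice"
  by (auto simp: int_lattice_def)

lemma int_lattice_range: "int_lattice = range (\<lambda>(i, j). vector [of_int i, of_int j] :: real^2)"
proof -
  have "x \<in> range (\<lambda>(i, j). vector [of_int i, of_int j] :: real^2)" if x: "x \<in> int_lattice" for x
  proof -
    obtain i j where "x$1 = of_int i" "x$2 = of_int j"
      using x by (auto simp: int_lattice_coord Ints_def)
    then have "x = vector [of_int i, of_int j]"
      by (simp add: vec2_eq_iff)
    then show ?thesis by force
  qed
  then show ?thesis by (auto simp: int_lattice_coord)
qed

lemma countable_int_lattice: "countable int_lattice"
  unfolding int_lattice_range by simp

lemma finite_int_lattice_bounded:
  assumes "bounded A" "A \<subseteq> int_lattice"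
  shows "finite A"
proof -
  obtain B where B: "\<And>x. x \<in> A \<Longrightarrow> norm x \<le> B" using assms(1) by (auto simp: bounded_iff)
  have "A \<subseteq> (\<lambda>(i, j). vector [of_int i, of_int j] :: real^2) ` ({-\<lceil>B\<rceil>..\<lceil>B\<rceil>} \<times> {-\<lceil>B\<rceil>..\<lceil>B\<rceil>})"
  proof
    fix x assume x: "x \<in> A"
    then obtain i j where ij: "x = vector [of_int i, of_int j]"
      using assms(2) by (auto simp: int_lattice_range)
    have "\<bar>x$1\<bar> \<le> B" "\<bar>x$2\<bar> \<le> B"
      using B[OF x] component_le_norm_cart[of x 1] component_le_norm_cart[of x 2] by linarith+
    then have "\<bar>i\<bar> \<le> \<lceil>B\<rceil>" "\<bar>j\<bar> \<le> \<lceil>B\<rceil>" by (simp_all add: ij) linarith+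
    then show "x \<in> (\<lambda>(i, j). vector [of_int i, of_int j] :: real^2) ` ({-\<lceil>B\<rceil>..\<lceil>B\<rceil>} \<times> {-\<lceil>B\<rceil>..\<lceil>B\<rceil>})"
      unfolding ij by (intro image_eqI[of _ _ "(i, j)"]) auto
  qed
  then show ?thesis by (rule finite_subset) simp
qed

lemma generic_shift: "l \<in> int_lattice \<Longrightarrow> generic x \<Longrightarrow> generic (x - l)"
  by (auto simp: generic_def area2_shift_point int_lattice_add)

text \<open>Countably many lines form a null set.\<close>
lemma generic_dense:
  assumes "open U" "U \<noteq> {}"
  shows "\<exists>x\<in>U. generic x"
proof (rule ccontr)
  assume none: "\<not> ?thesis"
  define P where "P = {(a, b). a \<in> int_lattice \<and> b \<in> int_lattice \<and> a \<noteq> b}"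
  have cP: "countable P"
    by (rule countable_subset[of _ "int_lattice \<times> int_lattice"])
      (auto simp: P_def intro: countable_int_lattice)
  have "negligible (\<Union>p\<in>P. {x. area2 (fst p) (snd p) x = 0})"
  proof (rule negligible_countable_Union)
    show "countable ((\<lambda>p. {x. area2 (fst p) (snd p) x = 0}) ` P)" using cP by simp
    fix L assume "L \<in> (\<lambda>p. {x. area2 (fst p) (snd p) x = 0}) ` P"
    then obtain a b where "a \<noteq> b" and L: "L = {x. area2 a b x = 0}" by (auto simp: P_def)
    let ?n = "vector [-(b$2 - a$2), b$1 - a$1] :: real^2"
    have "L = {x. ?n \<bullet> x = ?n \<bullet> a}"
      unfolding L area2_def by (auto simp: inner_vec_def sum_2 algebra_simps)
    moreover have "?n \<noteq> 0" using \<open>a \<noteq> b\<close> by (auto simp: vec2_eq_iff)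
    ultimately show "negligible L" using negligible_hyperplane by blast
  qed
  moreover have "U \<subseteq> (\<Union>p\<in>P. {x. area2 (fst p) (snd p) x = 0})"
    using none by (force simp: generic_def P_def)
  ultimately have "negligible U" using negligible_subset by blast
  with open_not_negligible[OF assms] show False by simp
qed

section \<open>Periodic triangulations\<close>

lemma sum_mset_swap:
  "(\<Sum>t\<in>#F. \<Sum>l\<in>A. f t l) = (\<Sum>l\<in>A. \<Sum>t\<in>#F. f t l)" for f :: "'a \<Rightarrow> 'b \<Rightarrow> nat"
  by (induction F) (simp_all add: sum.distrib)

text \<open>The period lattice \<open>\<Lambda>\<close> with a positively oriented basis. A
  \<open>\<Lambda>\<close>-periodic triangulation of the plane is a triangulation of the torus obtained as the
  quotient.\<close>
locale torus =
  fixes e f :: "real^2"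
  assumes e: "e \<in> int_lattice" and f: "f \<in> int_lattice" and pos: "area2 0 e f > 0"
begin

abbreviation \<Lambda> :: "(real^2) set" where "\<Lambda> \<equiv> sublattice_gen e f"

lemma mem_\<Lambda>: "of_int i *\<^sub>R e + of_int j *\<^sub>R f \<in> \<Lambda>"
  by (auto simp: sublattice_gen_def)

lemma \<Lambda>_int_lattice: "l \<in> \<Lambda> \<Longrightarrow> l \<in> int_lattice"
  using e f by (auto simp: sublattice_gen_def intro!: int_lattice_add int_lattice_scale)

lemma \<Lambda>_0: "0 \<in> \<Lambda>"
  using mem_\<Lambda>[of 0 0] by simp

lemma \<Lambda>_gens: "e \<in> \<Lambda>" "f \<in> \<Lambda>"
  using mem_\<Lambda>[of 1 0] mem_\<Lambda>[of 0 1] by simp_all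

lemma \<Lambda>_add: "l \<in> \<Lambda> \<Longrightarrow> m \<in> \<Lambda> \<Longrightarrow> l + m \<in> \<Lambda>"
proof -
  assume "l \<in> \<Lambda>" "m \<in> \<Lambda>"
  then obtain i j i' j' where "l = of_int i *\<^sub>R e + of_int j *\<^sub>R f" "m = of_int i' *\<^sub>R e + of_int j' *\<^sub>R f"
    by (auto simp: sublattice_gen_def)
  then have "l + m = of_int (i + i') *\<^sub>R e + of_int (j + j') *\<^sub>R f"
    by (simp add: algebra_simps)
  then show ?thesis using mem_\<Lambda> by metis
qed

lemma \<Lambda>_uminus: "l \<in> \<Lambda> \<Longrightarrow> - l \<in> \<Lambda>"
proof -
  assume "l \<in> \<Lambda>"
  then obtain i j where "l = of_int i *\<^sub>R e + of_int j *\<^sub>R f"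
    by (auto simp: sublattice_gen_def)
  then have "- l = of_int (- i) *\<^sub>R e + of_int (- j) *\<^sub>R f"
    by (simp add: algebra_simps)
  then show ?thesis using mem_\<Lambda> by metis
qed

lemma \<Lambda>_diff: "l \<in> \<Lambda> \<Longrightarrow> m \<in> \<Lambda> \<Longrightarrow> l - m \<in> \<Lambda>"
  using \<Lambda>_add[OF _ \<Lambda>_uminus] by force

lemma finite_\<Lambda>_near: "finite {l\<in>\<Lambda>. norm (x - l) \<le> R}"
proof (rule finite_int_lattice_bounded)
  show "bounded {l\<in>\<Lambda>. norm (x - l) \<le> R}"
    by (rule bounded_subset[of "cball x R"]) (auto simp: dist_norm)
qed (auto simp: \<Lambda>_int_lattice)

definition coverage :: "tri \<Rightarrow> real^2 \<Rightarrow> nat" where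
  "coverage t x = card {l\<in>\<Lambda>. inside t (x - l)}"

lemma finite_coverage:
  assumes "tri_area2 t > 0" shows "finite {l\<in>\<Lambda>. inside t (x - l)}"
  by (rule finite_subset[OF _ finite_\<Lambda>_near[of x "\<Sum>v\<in>verts t. norm v"]])
    (use inside_norm_bound[OF assms] in auto)

text \<open>Antisymmetric periodic functions on directed edges. That all of them sum to zero over the boundaries of the
  triangles says that each directed edge occurs as often as its reversal, that is, the triangles fit together edge to
  edge.\<close>
definition cochain :: "(real^2 \<Rightarrow> real^2 \<Rightarrow> real) \<Rightarrow> bool" where
  "cochain w \<longleftrightarrow> (\<forall>a b. w b a = - w a b) \<and> (\<forall>l\<in>\<Lambda>. \<forall>a b. w (a + l) (b + l) = w a b)"

definition proper :: "tri \<Rightarrow> bool" where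
  "proper t \<longleftrightarrow> verts t \<subseteq> int_lattice \<and> tri_area2 t > 0"

text \<open>A multiset holds one representative of each \<open>\<Lambda>\<close>-orbit of triangles. The conditions are:
  the triangles match along edges, a generic point is covered exactly once, and the areas add up to that of the torus.
  Each of them is a linear equation in the multiset, so subdividing and flipping only require local identities.\<close>
definition triangulation :: "tri multiset \<Rightarrow> bool" where
  "triangulation F \<longleftrightarrow> (\<forall>t\<in>#F. proper t) \<and> (\<forall>w. cochain w \<longrightarrow> (\<Sum>t\<in>#F. boundary_sum w t) = 0) \<and>
     (\<forall>x. generic x \<longrightarrow> (\<Sum>t\<in>#F. coverage t x) = 1) \<and> (\<Sum>t\<in>#F. tri_area2 t) = 2 * area2 0 e f"

definition vertices :: "tri multiset \<Rightarrow> (real^2) set" where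
  "vertices F = {v + l | v l t. t \<in># F \<and> v \<in> verts t \<and> l \<in> \<Lambda>}"

lemma verticesI: "t \<in># F \<Longrightarrow> v \<in> verts t \<Longrightarrow> l \<in> \<Lambda> \<Longrightarrow> v + l \<in> vertices F"
  unfolding vertices_def by blast

lemma coverage_eq_sum:
  assumes "finite A" "A \<subseteq> \<Lambda>" "{l\<in>\<Lambda>. inside t (x - l)} \<subseteq> A"
  shows "coverage t x = (\<Sum>l\<in>A. of_bool (inside t (x - l)))"
proof -
  have "{l\<in>\<Lambda>. inside t (x - l)} = {l\<in>A. inside t (x - l)}" using assms by auto
  then show ?thesis
    unfolding coverage_def using assms(1) by (simp add: sum.If_cases of_bool_def Int_def)
qed

text \<open>Only finitely many periods matter for a given point, so the two sums, over triangles and over periods, can be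
  interchanged.\<close>
lemma coverage_sum_cong:
  assumes pG: "\<forall>t\<in>#G. proper t" and pH: "\<forall>t\<in>#H. proper t"
    and eq: "\<And>y. generic y \<Longrightarrow>
      (\<Sum>t\<in>#G. of_bool (inside t y) :: nat) = (\<Sum>t\<in>#H. of_bool (inside t y))"
    and x: "generic x"
  shows "(\<Sum>t\<in>#G. coverage t x) = (\<Sum>t\<in>#H. coverage t x)"
proof -
  define A where "A = (\<Union>t\<in>set_mset (G + H). {l\<in>\<Lambda>. inside t (x - l)})"
  have fA: "finite A" unfolding A_def
    using pG pH by (intro finite_UN_I finite_coverage) (auto simp: proper_def)
  have AL: "A \<subseteq> \<Lambda>" by (auto simp: A_def)
  have c: "coverage t x = (\<Sum>l\<in>A. of_bool (inside t (x - l)))" if "t \<in># G + H" for t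
    by (rule coverage_eq_sum[OF fA AL]) (use that in \<open>auto simp: A_def\<close>)
  have "(\<Sum>t\<in>#G. coverage t x) = (\<Sum>t\<in>#G. \<Sum>l\<in>A. of_bool (inside t (x - l)))"
    by (rule arg_cong[where f = sum_mset], rule image_mset_cong) (simp add: c)
  also have "\<dots> = (\<Sum>l\<in>A. \<Sum>t\<in>#G. of_bool (inside t (x - l)))" by (rule sum_mset_swap)
  also have "\<dots> = (\<Sum>l\<in>A. \<Sum>t\<in>#H. of_bool (inside t (x - l)))"
    by (intro sum.cong refl eq generic_shift x) (use AL \<Lambda>_int_lattice in auto)
  also have "\<dots> = (\<Sum>t\<in>#H. \<Sum>l\<in>A. of_bool (inside t (x - l)))" by (rule sum_mset_swap[symmetric])
  also have "\<dots> = (\<Sum>t\<in>#H. coverage t x)"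
    by (rule arg_cong[where f = sum_mset], rule image_mset_cong) (simp add: c)
  finally show ?thesis .
qed

text \<open>All defining conditions are additive, so a local exchange is legitimate as soon as both local pieces agree on
  each of them.\<close>
lemma exchange_cov:
  assumes F: "triangulation (R + G)" and pH: "\<forall>t\<in>#H. proper t"
    and w: "\<And>w. cochain w \<Longrightarrow> (\<Sum>t\<in>#G. boundary_sum w t) = (\<Sum>t\<in>#H. boundary_sum w t)"
    and c: "\<And>x. generic x \<Longrightarrow> (\<Sum>t\<in>#G. coverage t x) = (\<Sum>t\<in>#H. coverage t x)"
    and a: "(\<Sum>t\<in>#G. tri_area2 t) = (\<Sum>t\<in>#H. tri_area2 t)"
  shows "triangulation (R + H)"
  using F w c a pH unfolding triangulation_def by auto

lemma exchange:
  assumes F: "triangulation (R + G)" and pH: "\<forall>t\<in>#H. proper t"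
    and w: "\<And>w. cochain w \<Longrightarrow> (\<Sum>t\<in>#G. boundary_sum w t) = (\<Sum>t\<in>#H. boundary_sum w t)"
    and c: "\<And>y. generic y \<Longrightarrow>
      (\<Sum>t\<in>#G. of_bool (inside t y) :: nat) = (\<Sum>t\<in>#H. of_bool (inside t y))"
    and a: "(\<Sum>t\<in>#G. tri_area2 t) = (\<Sum>t\<in>#H. tri_area2 t)"
  shows "triangulation (R + H)"
proof (rule exchange_cov[OF F pH w _ a])
  fix x assume "generic x"
  then show "(\<Sum>t\<in>#G. coverage t x) = (\<Sum>t\<in>#H. coverage t x)"
    using coverage_sum_cong[OF _ pH c] F by (auto simp: triangulation_def)
qed

section \<open>Triangles as flags of the torus\<close>

text \<open>Triples name the same triangle of the torus if they agree up to a period and a cyclic rotation.\<close>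
definition orbit_equiv :: "tri \<Rightarrow> tri \<Rightarrow> bool" where
  "orbit_equiv s t \<longleftrightarrow> (\<exists>l\<in>\<Lambda>. s = shift l t \<or> s = rot (shift l t) \<or> s = rot (rot (shift l t)))"

text \<open>The periodic triangulation itself: its positively oriented triangles, each with a distinguished directed edge
  \<open>a b\<close> and opposite vertex \<open>c\<close>.\<close>
definition flag :: "tri multiset \<Rightarrow> real^2 \<Rightarrow> real^2 \<Rightarrow> real^2 \<Rightarrow> bool" where
  "flag F a b c \<longleftrightarrow> (\<exists>t\<in>#F. orbit_equiv (a, b, c) t)"

lemma orbit_equiv_refl: "orbit_equiv t t"
  unfolding orbit_equiv_def by (rule bexI[OF _ \<Lambda>_0]) (cases t, simp)

lemma orbit_equiv_invariant:
  assumes "orbit_equiv s t"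
    and "\<And>l u. l \<in> \<Lambda> \<Longrightarrow> g (shift l u) = g u" "\<And>u. g (rot u) = g u"
  shows "g s = g t"
  using assms unfolding orbit_equiv_def by metis

lemma tri_area2_inv: "tri_area2 (shift l t) = tri_area2 t" "tri_area2 (rot t) = tri_area2 t"
  by (cases t; simp add: area2_shift area2_rot)+

lemma potential_inv: "potential (shift l t) = potential t" "potential (rot t) = potential t"
proof -
  obtain a b c where t: "t = (a, b, c)" by (cases t)
  show "potential (shift l t) = potential t" by (simp add: t area2_shift dist_norm)
  show "potential (rot t) = potential t" using area2_rot[of b c a] by (simp add: t add_ac)
qed

lemma boundary_sum_inv:
  assumes "cochain w"
  shows "l \<in> \<Lambda> \<Longrightarrow> boundary_sum w (shift l t) = boundary_sum w t" and "boundary_sum w (rot t) = boundary_sum w t"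
proof -
  have inv: "\<And>l a b. l \<in> \<Lambda> \<Longrightarrow> w (a + l) (b + l) = w a b" using assms unfolding cochain_def by blast
  show "boundary_sum w (rot t) = boundary_sum w t" by (cases t) simp
  show "l \<in> \<Lambda> \<Longrightarrow> boundary_sum w (shift l t) = boundary_sum w t" by (cases t) (simp add: inv)
qed

lemma coverage_rot: "coverage (rot t) x = coverage t x"
  by (simp add: coverage_def inside_rot)

lemma coverage_shift:
  assumes m: "m \<in> \<Lambda>" shows "coverage (shift m t) x = coverage t x"
proof -
  have "bij_betw (\<lambda>l. l + m) {l\<in>\<Lambda>. inside (shift m t) (x - l)} {l\<in>\<Lambda>. inside t (x - l)}"
    by (rule bij_betwI[where g = "\<lambda>l. l - m"])
      (use m in \<open>auto simp: inside_shift \<Lambda>_add \<Lambda>_diff algebra_simps\<close>)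
  then show ?thesis unfolding coverage_def by (rule bij_betw_same_card)
qed

lemma proper_inv: "l \<in> \<Lambda> \<Longrightarrow> proper (shift l t) = proper t" "proper (rot t) = proper t"
proof -
  obtain a b c where t: "t = (a, b, c)" by (cases t)
  show "proper (rot t) = proper t" by (auto simp: t proper_def area2_rot)
  assume l: "l \<in> \<Lambda>"
  have "x + l \<in> int_lattice \<longleftrightarrow> x \<in> int_lattice" for x
    using int_lattice_add[of x l] int_lattice_diff[of "x + l" l] \<Lambda>_int_lattice[OF l] by auto
  then show "proper (shift l t) = proper t" by (auto simp: t proper_def area2_shift)
qed

lemma orbit_equiv_ar: "orbit_equiv s t \<Longrightarrow> tri_area2 s = tri_area2 t" by (erule orbit_equiv_invariant) (simp_all add: tri_area2_inv)
lemma orbit_equiv_pot: "orbit_equiv s t \<Longrightarrow> potential s = potential t" by (erule orbit_equiv_invariant) (simp_all add: potential_inv)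
lemma orbit_equiv_bd: "orbit_equiv s t \<Longrightarrow> cochain w \<Longrightarrow> boundary_sum w s = boundary_sum w t"
  by (erule orbit_equiv_invariant) (simp_all add: boundary_sum_inv)
lemma orbit_equiv_cov: "orbit_equiv s t \<Longrightarrow> coverage s x = coverage t x"
  by (rule orbit_equiv_invariant[where g = "\<lambda>t. coverage t x"]) (simp_all add: coverage_shift coverage_rot)
lemma orbit_equiv_proper: "orbit_equiv s t \<Longrightarrow> proper s = proper t"
  by (erule orbit_equiv_invariant) (simp_all add: proper_inv)

lemma rot3: "rot (rot (rot t)) = t" by (cases t) simp
lemma rot_shift: "rot (shift l t) = shift l (rot t)" by (cases t) simp
lemma shift_shift: "shift l (shift m t) = shift (m + l) t" by (cases t) (simp add: add.assoc)
lemma shift_0: "shift 0 t = t" by (cases t) simp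

lemma orbit_equiv_sym: "orbit_equiv s t \<Longrightarrow> orbit_equiv t s"
proof -
  assume "orbit_equiv s t"
  then obtain l where l: "l \<in> \<Lambda>" "s = shift l t \<or> s = rot (shift l t) \<or> s = rot (rot (shift l t))"
    by (auto simp: orbit_equiv_def)
  then have "t = shift (- l) s \<or> t = rot (shift (- l) s) \<or> t = rot (rot (shift (- l) s))"
    by (auto simp: rot_shift shift_shift shift_0 rot3)
  then show "orbit_equiv t s" using \<Lambda>_uminus[OF l(1)] by (auto simp: orbit_equiv_def)
qed

lemma orbit_equiv_trans: "orbit_equiv r s \<Longrightarrow> orbit_equiv s t \<Longrightarrow> orbit_equiv r t"
proof -
  assume "orbit_equiv r s" "orbit_equiv s t"
  then obtain l m where l: "l \<in> \<Lambda>" "r = shift l s \<or> r = rot (shift l s) \<or> r = rot (rot (shift l s))"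
    and m: "m \<in> \<Lambda>" "s = shift m t \<or> s = rot (shift m t) \<or> s = rot (rot (shift m t))"
    unfolding orbit_equiv_def by blast
  from l(2) m(2) have "r = shift (m + l) t \<or> r = rot (shift (m + l) t) \<or> r = rot (rot (shift (m + l) t))"
    by (auto simp: rot_shift shift_shift rot3)
  then show "orbit_equiv r t" using \<Lambda>_add[OF m(1) l(1)] by (auto simp: orbit_equiv_def)
qed

lemma orbit_equiv_verts:
  assumes "orbit_equiv s t"
  shows "\<exists>l\<in>\<Lambda>. verts s = (\<lambda>v. v + l) ` verts t"
proof -
  obtain l where l: "l \<in> \<Lambda>" "s = shift l t \<or> s = rot (shift l t) \<or> s = rot (rot (shift l t))"
    using assms by (auto simp: orbit_equiv_def)
  then have "verts s = (\<lambda>v. v + l) ` verts t" by (cases t) auto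
  with l(1) show ?thesis by blast
qed

lemma flag_rot: "flag F a b c \<Longrightarrow> flag F b c a"
proof -
  have "orbit_equiv (b, c, a) (a, b, c)" unfolding orbit_equiv_def
    by (rule bexI[OF _ \<Lambda>_0]) simp
  then show "flag F a b c \<Longrightarrow> flag F b c a" unfolding flag_def using orbit_equiv_trans by blast
qed

lemma flag_shift: "l \<in> \<Lambda> \<Longrightarrow> flag F (a + l) (b + l) (c + l) = flag F a b c"
proof -
  assume l: "l \<in> \<Lambda>"
  have "orbit_equiv (a + l, b + l, c + l) (a, b, c)" unfolding orbit_equiv_def
    by (rule bexI[OF _ l]) simp
  then show ?thesis unfolding flag_def using orbit_equiv_trans orbit_equiv_sym by blast
qed

lemma flag_member: "(a, b, c) \<in># F \<Longrightarrow> flag F a b c"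
  unfolding flag_def using orbit_equiv_refl by blast

lemma flag_proper: "triangulation F \<Longrightarrow> flag F a b c \<Longrightarrow> proper (a, b, c)"
  unfolding flag_def triangulation_def using orbit_equiv_proper by blast

lemma flag_vertices: "flag F a b c \<Longrightarrow> a \<in> vertices F"
proof -
  assume "flag F a b c"
  then obtain t where t: "t \<in># F" "orbit_equiv (a, b, c) t" by (auto simp: flag_def)
  then obtain l where l: "l \<in> \<Lambda>" "{a, b, c} = (\<lambda>v. v + l) ` verts t"
    using orbit_equiv_verts[OF t(2)] by auto
  then obtain v where "v \<in> verts t" "a = v + l" by blast
  then show ?thesis using verticesI[OF t(1)] l(1) by simp
qed

definition same_triangulation :: "tri multiset \<Rightarrow> tri multiset \<Rightarrow> bool" where
  "same_triangulation F F' \<longleftrightarrow> triangulation F' \<and> size F' = size F \<and> vertices F' = vertices F \<and>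
     (\<forall>a b c. flag F' a b c = flag F a b c) \<and> (\<Sum>t\<in>#F'. potential t) = (\<Sum>t\<in>#F. potential t)"

lemma orbit_equiv_vertices_le:
  assumes "orbit_equiv s t" shows "vertices (add_mset s R) \<subseteq> vertices (add_mset t R)"
proof -
  obtain l where l: "l \<in> \<Lambda>" "verts s = (\<lambda>v. v + l) ` verts t" using orbit_equiv_verts[OF assms] by blast
  have "v + m \<in> vertices (add_mset t R)" if v: "v \<in> verts s" "m \<in> \<Lambda>" for v m
  proof -
    obtain u where "u \<in> verts t" "v = u + l" using v l by auto
    then show ?thesis using verticesI[of t "add_mset t R" u "l + m"] v l \<Lambda>_add by (simp add: add.assoc)
  qed
  moreover have "v + m \<in> vertices (add_mset t R)" if "u \<in># R" "v \<in> verts u" "m \<in> \<Lambda>" for u v m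
    using verticesI[of u _ v m] that by simp
  ultimately show ?thesis unfolding vertices_def[of "add_mset s R"] by auto
qed

lemma normalize:
  assumes F: "triangulation F" and t: "t \<in># F" and r: "orbit_equiv s t"
  shows "same_triangulation F (add_mset s (F - {#t#}))"
proof -
  define R where "R = F - {#t#}"
  have F': "F = add_mset t R" using t by (simp add: R_def)
  have "triangulation (R + {#s#})"
  proof (rule exchange_cov[where G = "{#t#}"])
    show "triangulation (R + {#t#})" using F F' by simp
  qed (use F t r in \<open>auto simp: orbit_equiv_ar orbit_equiv_bd orbit_equiv_cov triangulation_def orbit_equiv_proper\<close>)
  moreover have "flag (add_mset s R) a b c = flag F a b c" for a b c
  proof -
    have "orbit_equiv (a, b, c) s \<longleftrightarrow> orbit_equiv (a, b, c) t"
      using orbit_equiv_trans[OF _ r] orbit_equiv_trans[OF _ orbit_equiv_sym[OF r]] by blast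
    then show ?thesis unfolding F' flag_def by simp
  qed
  moreover have "vertices (add_mset s R) = vertices F"
    unfolding F' by (intro equalityI orbit_equiv_vertices_le r orbit_equiv_sym[OF r])
  ultimately show ?thesis
    unfolding same_triangulation_def R_def[symmetric] using orbit_equiv_pot[OF r] by (simp add: F')
qed

lemma same_triangulation_trans: "same_triangulation F G \<Longrightarrow> same_triangulation G H \<Longrightarrow> same_triangulation F H"
  unfolding same_triangulation_def by auto

lemma normalize1:
  assumes F: "triangulation F" and "flag F a b c"
  obtains R where "same_triangulation F (add_mset (a, b, c) R)"
  using normalize[OF F] assms(2) unfolding flag_def by blast

text \<open>To alter two adjacent triangles they must be present in the multiset as they lie in the plane, as two different
  members.\<close>
lemma normalize2:
  assumes F: "triangulation F" and 1: "flag F a b c" and 2: "flag F b a d"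
  obtains R where "same_triangulation F (R + {#(a, b, c), (b, a, d)#})"
proof -
  obtain R1 where s1: "same_triangulation F (add_mset (a, b, c) R1)" using normalize1[OF F 1] .
  let ?G = "add_mset (a, b, c) R1"
  have G: "triangulation ?G" using s1 by (simp add: same_triangulation_def)
  have "flag ?G b a d" using s1 2 by (simp add: same_triangulation_def)
  then obtain t where t: "t \<in># ?G" and r: "orbit_equiv (b, a, d) t" by (auto simp: flag_def)
  have "proper (a, b, c)" using flag_proper[OF F 1] .
  then have ne: "a \<noteq> b" "b \<noteq> c" "c \<noteq> a" by (auto simp: proper_def)
  have "t \<noteq> (a, b, c)"
  proof
    assume "t = (a, b, c)"
    \<comment> \<open>an edge of a triangle is never parallel to a second one, nor a translate of its own reversal\<close>
    with r obtain l where "b = a + l \<and> a = b + l \<or> b = b + l \<and> a = c + l \<or> b = c + l \<and> a = a + l"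
      by (auto simp: orbit_equiv_def)
    then show False
    proof (elim disjE conjE)
      assume "b = a + l" "a = b + l"
      then have "b = b + l + l" by metis
      then have "l + l = 0" by (simp add: add.assoc)
      then have "2 *\<^sub>R l = 0" by (simp add: scaleR_2)
      then show False using \<open>a = b + l\<close> ne by simp
    qed (use ne in auto)
  qed
  then have "t \<in># R1" using t by auto
  then have "?G - {#t#} = add_mset (a, b, c) (R1 - {#t#})" by auto
  with normalize[OF G t r] have "same_triangulation ?G (add_mset (b, a, d) (add_mset (a, b, c) (R1 - {#t#})))"
    by simp
  with s1 have "same_triangulation F ((R1 - {#t#}) + {#(a, b, c), (b, a, d)#})"
    using same_triangulation_trans by (simp add: add_mset_commute)
  then show thesis using that by blast
qed

end

section \<open>Subdivision and flips of triangles\<close>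

lemma sum_mset_nonneg_real:
  "(\<And>t. t \<in># F \<Longrightarrow> 0 \<le> g t) \<Longrightarrow> 0 \<le> (\<Sum>t\<in>#F. g t :: real)"
  by (induction F) auto

text \<open>Seen from \<open>p\<close>, the corners appear on either side of the line through \<open>p\<close> and
  \<open>y\<close>. They are never all on the same side, so running cyclically through them the side changes from left
  to right exactly once, which singles out one of the three parts.\<close>
lemma inside_subdivide:
  assumes pos: "area2 a b c > 0" and p: "area2 a b p > 0" "area2 b c p > 0" "area2 c a p > 0"
    and y: "area2 p a y \<noteq> 0" "area2 p b y \<noteq> 0" "area2 p c y \<noteq> 0"
  shows "(of_bool (inside (a, b, c) y) :: nat) =
    of_bool (inside (p, a, b) y) + of_bool (inside (p, b, c) y) + of_bool (inside (p, c, a) y)"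
proof -
  have r: "area2 b c p * area2 p a y + area2 c a p * area2 p b y + area2 a b p * area2 p c y = 0"
    unfolding area2_def by algebra
  have nps: "\<not> (area2 p a y > 0 \<and> area2 p b y > 0 \<and> area2 p c y > 0)"
    using r p by (smt (verit) mult_pos_pos)
  have nng: "\<not> (area2 p a y < 0 \<and> area2 p b y < 0 \<and> area2 p c y < 0)"
    using r p by (smt (verit) mult_pos_neg)
  have i1: "area2 b c y * area2 p a b = area2 b c p * area2 a b y + area2 b c a * area2 b p y"
    using area2_interpolate[of b c y p a b] by simp
  have i2: "area2 c a y * area2 p a b = area2 c a p * area2 a b y + area2 c a b * area2 p a y"
    using area2_interpolate[of c a y p a b] by simp
  have j1: "area2 c a y * area2 p b c = area2 c a p * area2 b c y + area2 c a b * area2 c p y"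
    using area2_interpolate[of c a y p b c] by simp
  have j2: "area2 a b y * area2 p b c = area2 a b p * area2 b c y + area2 a b c * area2 p b y"
    using area2_interpolate[of a b y p b c] by simp
  have k1: "area2 a b y * area2 p c a = area2 a b p * area2 c a y + area2 a b c * area2 a p y"
    using area2_interpolate[of a b y p c a] by simp
  have k2: "area2 b c y * area2 p c a = area2 b c p * area2 c a y + area2 b c a * area2 p c y"
    using area2_interpolate[of b c y p c a] by simp
  have sw: "area2 b p y = - area2 p b y" "area2 c p y = - area2 p c y" "area2 a p y = - area2 p a y"
    by (rule area2_swap)+
  have q: "area2 p a b > 0" "area2 p b c > 0" "area2 p c a > 0" "area2 b c a > 0" "area2 c a b > 0"
    using p pos area2_rot by metis+
  have "inside (a, b, c) y" if "inside (p, a, b) y"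
  proof -
    have h: "area2 p a y > 0" "area2 a b y > 0" "area2 b p y > 0" using that by auto
    then have "area2 b c y * area2 p a b > 0" "area2 c a y * area2 p a b > 0"
      unfolding i1 i2 by (intro add_pos_pos mult_pos_pos p q h)+
    then show ?thesis using \<open>area2 a b y > 0\<close> q zero_less_mult_pos2 by auto
  qed
  moreover have "inside (a, b, c) y" if "inside (p, b, c) y"
  proof -
    have h: "area2 p b y > 0" "area2 b c y > 0" "area2 c p y > 0" using that by auto
    then have "area2 c a y * area2 p b c > 0" "area2 a b y * area2 p b c > 0"
      unfolding j1 j2 by (intro add_pos_pos mult_pos_pos p q pos h)+
    then show ?thesis using \<open>area2 b c y > 0\<close> q zero_less_mult_pos2 by auto
  qed
  moreover have "inside (a, b, c) y" if "inside (p, c, a) y"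
  proof -
    have h: "area2 p c y > 0" "area2 c a y > 0" "area2 a p y > 0" using that by auto
    then have "area2 a b y * area2 p c a > 0" "area2 b c y * area2 p c a > 0"
      unfolding k1 k2 by (intro add_pos_pos mult_pos_pos p q pos h)+
    then show ?thesis using \<open>area2 c a y > 0\<close> q zero_less_mult_pos2 by auto
  qed
  moreover have ab: "inside (p, a, b) y \<Longrightarrow> 0 < area2 p a y \<and> \<not> 0 < area2 p b y"
    and bc: "inside (p, b, c) y \<Longrightarrow> 0 < area2 p b y \<and> \<not> 0 < area2 p c y"
    and ca: "inside (p, c, a) y \<Longrightarrow> 0 < area2 p c y \<and> \<not> 0 < area2 p a y"
    unfolding inside.simps sw by auto
  moreover have "inside (p, a, b) y \<or> inside (p, b, c) y \<or> inside (p, c, a) y" if "inside (a, b, c) y"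
  proof -
    have "0 < area2 a b y" "0 < area2 b c y" "0 < area2 c a y" using that by auto
    moreover have "(0 < area2 p a y \<and> area2 p b y < 0) \<or> (0 < area2 p b y \<and> area2 p c y < 0) \<or> (0 < area2 p c y \<and> area2 p a y < 0)"
      using nps nng y by linarith
    ultimately show ?thesis unfolding inside.simps sw by auto
  qed
  moreover have "\<not> (inside (p, a, b) y \<and> inside (p, b, c) y)" "\<not> (inside (p, a, b) y \<and> inside (p, c, a) y)"
    "\<not> (inside (p, b, c) y \<and> inside (p, c, a) y)"
    using ab bc ca by blast+
  ultimately show ?thesis
    by (cases "inside (p, a, b) y"; cases "inside (p, b, c) y"; cases "inside (p, c, a) y")
      (auto simp del: inside.simps)
qed

lemma inside_split:
  assumes p: "p = a + s *\<^sub>R (b - a)" and s: "0 < s" "s < 1" and y: "area2 c p y \<noteq> 0"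
  shows "(of_bool (inside (a, b, c) y) :: nat) =
    of_bool (inside (a, p, c) y) + of_bool (inside (p, b, c) y)"
proof -
  have 1: "area2 a p y = s * area2 a b y" "area2 p b y = (1 - s) * area2 a b y"
    unfolding p area2_def by (simp_all add: algebra_simps)
  have 2: "area2 c p y = (1 - s) * area2 c a y - s * area2 b c y"
    unfolding p area2_def by (simp add: algebra_simps)
  have 3: "area2 p c y = - area2 c p y" by (rule area2_swap)
  have pos: "area2 a p y > 0 \<longleftrightarrow> area2 a b y > 0" "area2 p b y > 0 \<longleftrightarrow> area2 a b y > 0"
    unfolding 1 using s by (simp_all add: zero_less_mult_iff)
  have A: "area2 b c y > 0" if "area2 c a y > 0" "area2 c p y < 0"
  proof -
    have "s * area2 b c y > (1 - s) * area2 c a y" using that 2 by simp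
    moreover have "(1 - s) * area2 c a y > 0" using that s by simp
    ultimately have "s * area2 b c y > 0" by linarith
    then show ?thesis using s by (simp add: zero_less_mult_iff)
  qed
  have B: "area2 c a y > 0" if "area2 b c y > 0" "area2 c p y > 0"
  proof -
    have "(1 - s) * area2 c a y > s * area2 b c y" using that 2 by simp
    moreover have "s * area2 b c y > 0" using that s by simp
    ultimately have "(1 - s) * area2 c a y > 0" by linarith
    then show ?thesis using s by (simp add: zero_less_mult_iff)
  qed
  show ?thesis
  proof (cases "area2 c p y > 0")
    case True
    then have "area2 b c y > 0 \<Longrightarrow> area2 c a y > 0" using B by blast
    with True show ?thesis unfolding inside.simps pos 3 by auto
  next
    case False
    then have "area2 c p y < 0" using y by simp
    then have "area2 c a y > 0 \<Longrightarrow> area2 b c y > 0" using A by blast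
    with \<open>area2 c p y < 0\<close> show ?thesis unfolding inside.simps pos 3 by auto
  qed
qed

text \<open>The two diagonals, meeting at \<open>p\<close>, cut the quadrilateral into four triangles which refine both of
  its triangulations.\<close>
lemma inside_flip:
  assumes "area2 a b c > 0" "area2 b a d > 0" "area2 a d c > 0" "area2 d b c > 0"
    and y: "area2 a b y \<noteq> 0" "area2 c d y \<noteq> 0"
  shows "(of_bool (inside (a, b, c) y) :: nat) + of_bool (inside (b, a, d) y) =
    of_bool (inside (a, d, c) y) + of_bool (inside (d, b, c) y)"
proof -
  define s where "s = area2 a d c / (area2 a d c + area2 d b c)"
  define r where "r = area2 a b c / (area2 a b c + area2 b a d)"
  have s: "0 < s" "s < 1" and r: "0 < r" "r < 1"
    using assms by (auto simp: s_def r_def)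
  define p where "p = a + s *\<^sub>R (b - a)"
  have quad: "area2 a d c + area2 d b c = area2 a b c + area2 b a d" 
    unfolding area2_def by algebra
  have p2: "p = c + r *\<^sub>R (d - c)"
  proof -
    have nz: "area2 a b c + area2 b a d \<noteq> 0" using assms by simp
    have "(area2 a b c + area2 b a d) * (a$i + s * (b$i - a$i)) = (area2 a b c + area2 b a d) * (c$i + r * (d$i - c$i))" for i
    proof -
      have "(area2 a b c + area2 b a d) * s = area2 a d c" "(area2 a b c + area2 b a d) * r = area2 a b c"
        unfolding s_def r_def using nz by (simp_all add: quad)
      moreover have "(area2 a b c + area2 b a d) * a$i + area2 a d c * (b$i - a$i)
        = (area2 a b c + area2 b a d) * c$i + area2 a b c * (d$i - c$i)"
      proof -
        have "i = 1 \<or> i = 2" by (rule exhaust_2)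
        moreover have "(area2 a b c + area2 b a d) * a$1 + area2 a d c * (b$1 - a$1)
          = (area2 a b c + area2 b a d) * c$1 + area2 a b c * (d$1 - c$1)" unfolding area2_def by algebra
        moreover have "(area2 a b c + area2 b a d) * a$2 + area2 a d c * (b$2 - a$2)
          = (area2 a b c + area2 b a d) * c$2 + area2 a b c * (d$2 - c$2)" unfolding area2_def by algebra
        ultimately show ?thesis by auto
      qed
      ultimately show ?thesis by (simp only: distrib_left mult.assoc[symmetric])
    qed
    then show ?thesis using nz by (simp add: p_def vec_eq_iff)
  qed
  have pb: "p = b + (1 - s) *\<^sub>R (a - b)" and pc: "p = d + (1 - r) *\<^sub>R (c - d)"
    by (simp add: p_def algebra_simps) (simp add: p2 algebra_simps)
  have cp: "area2 c p y = r * area2 c d y" and dp': "area2 d p y = - (1 - r) * area2 c d y"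
    unfolding p2 area2_def by (simp_all add: algebra_simps)
  have ap: "area2 a p y = s * area2 a b y" and bp: "area2 b p y = - (1 - s) * area2 a b y"
    unfolding p_def area2_def by (simp_all add: algebra_simps)
  have nz: "area2 c p y \<noteq> 0" "area2 d p y \<noteq> 0" "area2 a p y \<noteq> 0" "area2 b p y \<noteq> 0"
    using r s y by (simp_all add: cp dp' ap bp)
  have "(of_bool (inside (a, b, c) y) :: nat) = of_bool (inside (a, p, c) y) + of_bool (inside (p, b, c) y)"
    by (rule inside_split[OF p_def s nz(1)])
  moreover have "(of_bool (inside (b, a, d) y) :: nat) = of_bool (inside (b, p, d) y) + of_bool (inside (p, a, d) y)"
    by (rule inside_split[OF pb _ _ nz(2)]) (use s in auto)
  moreover have "(of_bool (inside (d, c, a) y) :: nat) = of_bool (inside (d, p, a) y) + of_bool (inside (p, c, a) y)"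
    by (rule inside_split[OF pc _ _ nz(3)]) (use r in auto)
  moreover have "(of_bool (inside (c, d, b) y) :: nat) = of_bool (inside (c, p, b) y) + of_bool (inside (p, d, b) y)"
    by (rule inside_split[OF p2 r nz(4)])
  moreover have "inside (d, c, a) y = inside (a, d, c) y" "inside (c, d, b) y = inside (d, b, c) y"
    "inside (d, p, a) y = inside (p, a, d) y" "inside (p, c, a) y = inside (a, p, c) y"
    "inside (c, p, b) y = inside (p, b, c) y" "inside (p, d, b) y = inside (b, p, d) y"
    by auto
  ultimately show ?thesis by simp
qed

text \<open>Up to a factor, the difference is the in-circle determinant of the four points.\<close>
lemma potential_flip:
  "potential (a, b, c) + potential (b, a, d) =
   potential (a, d, c) + potential (d, b, c) - 4 * (apex_dot a b c * area2 b a d + apex_dot a b d * area2 a b c)"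
  unfolding potential.simps dist_coord apex_dot_coord area2_def by algebra

text \<open>Let \<open>x\<close> and \<open>y\<close> be the cotangents of the two angles at \<open>a\<close>. Multiplying
  the condition on the angles at \<open>c\<close> and \<open>d\<close> by \<open>(dist a b)\<^sup>2\<close> shows that
  a positive combination of \<open>x\<^sup>2 + 1\<close> and \<open>y\<^sup>2 + 1\<close> is less than a positive
  multiple of \<open>x + y\<close>. So \<open>x + y > 0\<close>, and the whole angle at \<open>a\<close> is less than
  a straight angle; the same_triangulation holds at \<open>b\<close>.\<close>
lemma flip_convex:
  assumes pos: "area2 a b c > 0" "area2 b a d > 0"
    and neg: "apex_dot a b c * area2 b a d + apex_dot a b d * area2 a b c < 0"
  shows "area2 a d c > 0" "area2 d b c > 0"
proof -
  define L where "L = (dist a b)\<^sup>2"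
  define X where "X = apex_dot b c a"  define Y where "Y = apex_dot b d a"
  define X' where "X' = apex_dot a c b"  define Y' where "Y' = apex_dot a d b"
  have "a \<noteq> b" using pos by auto
  then have L: "L > 0" by (simp add: L_def)
  note defs = L_def X_def Y_def X'_def Y'_def dist_coord apex_dot_coord area2_def
  let ?C = "area2 a b c" and ?D = "area2 b a d"
  have "L * (apex_dot a b c * ?D + apex_dot a b d * ?C) = (X\<^sup>2 + ?C\<^sup>2) * ?D + (Y\<^sup>2 + ?D\<^sup>2) * ?C - L * (X * ?D + Y * ?C)"
    unfolding defs by algebra
  moreover have "(X\<^sup>2 + ?C\<^sup>2) * ?D + (Y\<^sup>2 + ?D\<^sup>2) * ?C > 0"
    using pos by (intro add_pos_pos mult_pos_pos add_nonneg_pos) auto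
  ultimately have "L * (X * ?D + Y * ?C) > 0"
    using mult_pos_neg[OF L neg] by linarith
  moreover have "L * area2 a d c = X * ?D + Y * ?C"
    unfolding defs by algebra
  ultimately have "L * area2 a d c > 0" using zero_less_mult_pos[OF _ L] by metis
  then show "area2 a d c > 0" using L by (rule zero_less_mult_pos)
  have "L * (apex_dot a b c * ?D + apex_dot a b d * ?C) = (X'\<^sup>2 + ?C\<^sup>2) * ?D + (Y'\<^sup>2 + ?D\<^sup>2) * ?C - L * (X' * ?D + Y' * ?C)"
    unfolding defs by algebra
  moreover have "(X'\<^sup>2 + ?C\<^sup>2) * ?D + (Y'\<^sup>2 + ?D\<^sup>2) * ?C > 0"
    using pos by (intro add_pos_pos mult_pos_pos add_nonneg_pos) auto
  ultimately have "L * (X' * ?D + Y' * ?C) > 0"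
    using mult_pos_neg[OF L neg] by linarith
  moreover have "L * area2 d b c = X' * ?D + Y' * ?C"
    unfolding defs by algebra
  ultimately have "L * area2 d b c > 0" using zero_less_mult_pos[OF _ L] by metis
  then show "area2 d b c > 0" using L by (rule zero_less_mult_pos)
qed

section \<open>Covering and adjacency\<close>

context torus
begin

lemma generic_area2: "generic y \<Longrightarrow> a \<in> int_lattice \<Longrightarrow> b \<in> int_lattice \<Longrightarrow> a \<noteq> b \<Longrightarrow> area2 a b y \<noteq> 0"
  by (auto simp: generic_def)

text \<open>A generic point near \<open>p\<close> lies in an open triangle, and only finitely many triangles come near
  \<open>p\<close>; their union is closed.\<close>
lemma covering:
  assumes F: "triangulation F"
  shows "\<exists>a b c. flag F a b c \<and> p \<in> convex hull {a, b, c}"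
proof (rule ccontr)
  assume none: "\<not> ?thesis"
  define K where "K t = {l\<in>\<Lambda>. norm (p - l) \<le> 1 + (\<Sum>v\<in>verts t. norm v)}" for t
  define U where "U = ball p 1 \<inter> (\<Inter>t\<in>set_mset F. \<Inter>l\<in>K t. - (convex hull (verts (shift l t))))"
  have prp: "proper t" if "t \<in># F" for t using F that by (auto simp: triangulation_def)
  have fv: "finite (verts t)" for t by (cases t) auto
  have "open U" unfolding U_def
    by (intro open_Int open_ball open_INT ballI open_Compl compact_imp_closed finite_imp_compact_convex_hull)
      (auto simp: K_def finite_\<Lambda>_near fv)
  moreover have "p \<in> U"
  proof -
    have "p \<notin> convex hull (verts (shift l t))" if t: "t \<in># F" and l: "l \<in> \<Lambda>" for t l
    proof -
      obtain a b c where s: "shift l t = (a, b, c)" by (cases "shift l t")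
      have "orbit_equiv (shift l t) t" using l by (auto simp: orbit_equiv_def)
      then have "flag F a b c" using t s by (auto simp: flag_def)
      then show ?thesis using none s by auto
    qed
    then show ?thesis by (auto simp: U_def K_def)
  qed
  ultimately obtain x where x: "x \<in> U" "generic x" using generic_dense by blast
  then have "(\<Sum>t\<in>#F. coverage t x) = 1" using F by (auto simp: triangulation_def)
  moreover have "(\<Sum>t\<in>#F. coverage t x) = 0" if "\<forall>t\<in>#F. coverage t x = 0"
    using that by (induction F) auto
  ultimately have "\<not> (\<forall>t\<in>#F. coverage t x = 0)" by force
  then obtain t where t: "t \<in># F" "coverage t x \<noteq> 0" by blast
  then obtain l where l: "l \<in> \<Lambda>" "inside t (x - l)"
    unfolding coverage_def by (metis (mono_tags, lifting) card.empty empty_Collect_eq)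
  have "norm (p - l) \<le> norm (p - x) + norm (x - l)" using norm_triangle_ineq[of "p - x" "x - l"] by simp
  also have "norm (p - x) \<le> 1" using x by (simp add: U_def dist_norm)
  also have "norm (x - l) \<le> (\<Sum>v\<in>verts t. norm v)"
    using inside_norm_bound l prp[OF t(1)] by (auto simp: proper_def)
  finally have "l \<in> K t" using l by (simp add: K_def)
  then have "x \<notin> convex hull (verts (shift l t))" using x t by (auto simp: U_def)
  moreover have "inside (shift l t) x" using l by (simp add: inside_shift)
  moreover have "tri_area2 (shift l t) > 0" using prp[OF t(1)] by (simp add: proper_def tri_area2_inv)
  ultimately show False using inside_hull by blast
qed

lemma flag_unique_at:
  assumes F: "triangulation F" and x: "generic x"
    and 1: "flag F a b c" "inside (a, b, c) x" and 2: "flag F a' b' c'" "inside (a', b', c') x"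
  shows "(a', b', c') = (a, b, c) \<or> (a', b', c') = (b, c, a) \<or> (a', b', c') = (c, a, b)"
proof -
  have key: "\<exists>t\<in>#F. \<exists>l\<in>\<Lambda>. inside t (x - l) \<and>
      (s = shift l t \<or> s = rot (shift l t) \<or> s = rot (rot (shift l t)))"
    if s: "flag F p q r" "inside s x" "s = (p, q, r)" for p q r s
  proof -
    obtain t where t: "t \<in># F" "orbit_equiv s t" using s unfolding flag_def by blast
    then obtain l where l: "l \<in> \<Lambda>" "s = shift l t \<or> s = rot (shift l t) \<or> s = rot (rot (shift l t))"
      by (auto simp: orbit_equiv_def)
    then have "inside t (x - l)" using s(2) by (auto simp: inside_rot inside_shift simp del: inside.simps shift.simps rot.simps)
    then show ?thesis using t l by blast
  qed
  obtain t l where t: "t \<in># F" "l \<in> \<Lambda>" "inside t (x - l)"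
    and s: "(a, b, c) = shift l t \<or> (a, b, c) = rot (shift l t) \<or> (a, b, c) = rot (rot (shift l t))"
    using key[OF 1 refl] by blast
  obtain t' l' where t': "t' \<in># F" "l' \<in> \<Lambda>" "inside t' (x - l')"
    and s': "(a', b', c') = shift l' t' \<or> (a', b', c') = rot (shift l' t') \<or> (a', b', c') = rot (rot (shift l' t'))"
    using key[OF 2 refl] by blast
  have total: "(\<Sum>t\<in>#F. coverage t x) = 1" using F x by (auto simp: triangulation_def)
  have prp: "tri_area2 t > 0" if "t \<in># F" for t using F that by (auto simp: triangulation_def proper_def)
  have pos: "coverage t x \<ge> 1" "coverage t' x \<ge> 1"
    using t t' finite_coverage[OF prp[OF t(1)], of x] finite_coverage[OF prp[OF t'(1)], of x]
    unfolding coverage_def by (auto simp: Suc_le_eq card_gt_0_iff)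
  have tt: "t' = t"
  proof (rule ccontr)
    assume "t' \<noteq> t"
    then obtain R where "F = add_mset t (add_mset t' R)"
      using t(1) t'(1) by (metis insert_DiffM insert_noteq_member)
    then show False using total pos by simp
  qed
  have "coverage t x \<le> 1"
    using total t(1) by (metis insert_DiffM sum_mset.insert image_mset_add_mset le_add1)
  then have "card {l\<in>\<Lambda>. inside t (x - l)} \<le> 1" by (simp add: coverage_def)
  then have "l' = l"
    using t t' tt finite_coverage[OF prp[OF t(1)], of x]
    by (auto simp: card_le_Suc0_iff_eq)
  then show ?thesis using s s' tt by (cases t) auto
qed

text \<open>Two triangles on the same side of a common edge overlap, and a generic point in the overlap is covered only
  once.\<close>
lemma apex_unique:
  assumes F: "triangulation F" and c: "flag F a b c" and d: "flag F a b d"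
  shows "d = c"
proof -
  have pos: "area2 a b c > 0" "area2 a b d > 0"
    using flag_proper[OF F c] flag_proper[OF F d] by (auto simp: proper_def)
  let ?U = "{x. inside (a, b, c) x} \<inter> {x. inside (a, b, d) x}"
  have "open ?U" by (intro open_Int open_inside)
  moreover have "?U \<noteq> {}"
  proof -
    \<comment> \<open>points just beside the midpoint of the common edge\<close>
    define P where "P \<epsilon> = (1/2 - \<epsilon>) *\<^sub>R a + (1/2) *\<^sub>R b + \<epsilon> *\<^sub>R c" for \<epsilon> :: real
    have f: "area2 a b (P \<epsilon>) = \<epsilon> * area2 a b c" "area2 b c (P \<epsilon>) = (1/2 - \<epsilon>) * area2 a b c" "area2 c a (P \<epsilon>) = (1/2) * area2 a b c"
      "area2 b d (P \<epsilon>) = (1/2) * area2 a b d + \<epsilon> * (area2 b d c - area2 a b d)"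
      "area2 d a (P \<epsilon>) = (1/2) * area2 a b d + \<epsilon> * area2 d a c" for \<epsilon>
      unfolding P_def area2_def by (simp_all add: field_simps)
    have l1: "\<forall>\<^sub>F \<epsilon> in at_right 0. (1/2) * area2 a b d + \<epsilon> * k > 0" for k :: real
    proof -
      have "((\<lambda>\<epsilon>. (1/2) * area2 a b d + \<epsilon> * k) \<longlongrightarrow> (1/2) * area2 a b d + 0 * k) (at_right 0)"
        by (intro tendsto_intros)
      then show ?thesis by (rule order_tendstoD(1)) (use pos in simp)
    qed
    have "\<forall>\<^sub>F \<epsilon> in at_right (0::real). 0 < \<epsilon> \<and> \<epsilon> < 1/2"
      by (auto simp: eventually_at_right_field intro!: exI[of _ "1/2"])
    with l1[of "area2 b d c - area2 a b d"] l1[of "area2 d a c"]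
    have "\<forall>\<^sub>F \<epsilon> in at_right (0::real). P \<epsilon> \<in> ?U"
      by eventually_elim (use pos in \<open>auto simp: f\<close>)
    then show ?thesis
      using eventually_happens trivial_limit_at_right_real by blast
  qed
  ultimately obtain x where "generic x" "inside (a, b, c) x" "inside (a, b, d) x"
    using generic_dense by blast
  with flag_unique_at[OF F _ c _ d] show ?thesis using pos by auto
qed

text \<open>Apply the edge condition to the indicator cochain of the edge \<open>a b\<close>: without a triangle along the
  reversed edge its boundary sums would be nonnegative and one of them positive.\<close>
lemma mate_exists:
  assumes F: "triangulation F" and c: "flag F a b c"
  shows "\<exists>d. flag F b a d"
proof (rule ccontr)
  assume none: "\<not> ?thesis"
  define E where "E x y \<longleftrightarrow> (\<exists>l\<in>\<Lambda>. x = a + l \<and> y = b + l)" for x y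
  define w where "w x y = (of_bool (E x y) - of_bool (E y x) :: real)" for x y
  have ab: "a \<noteq> b" using flag_proper[OF F c] by (auto simp: proper_def)
  have "E (x + l) (y + l) = E x y" if "l \<in> \<Lambda>" for x y l
  proof
    assume "E (x + l) (y + l)"
    then obtain m where "m \<in> \<Lambda>" "x + l = a + m" "y + l = b + m" by (auto simp: E_def)
    then have "x = a + (m - l)" "y = b + (m - l)" "m - l \<in> \<Lambda>" using that
      by (simp_all add: \<Lambda>_diff) (metis add_diff_cancel_right' add_diff_eq)+
    then show "E x y" by (auto simp: E_def)
  next
    assume "E x y"
    then obtain m where "m \<in> \<Lambda>" "x = a + m" "y = b + m" by (auto simp: E_def)
    then have "x + l = a + (m + l)" "y + l = b + (m + l)" "m + l \<in> \<Lambda>" using that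
      by (simp_all add: \<Lambda>_add add.assoc)
    then show "E (x + l) (y + l)" unfolding E_def by blast
  qed
  then have "cochain w" by (auto simp: cochain_def w_def)
  then have total: "(\<Sum>t\<in>#F. boundary_sum w t) = 0" using F by (auto simp: triangulation_def)
  have noE: "\<not> E y x" if "flag F x y z" for x y z
  proof
    assume "E y x"
    then obtain l where l: "l \<in> \<Lambda>" "y = a + l" "x = b + l" by (auto simp: E_def)
    then have "flag F (b + l) (a + l) ((z - l) + l)" using that by simp
    then show False using none flag_shift[OF l(1)] by blast
  qed
  then have nn: "w x y \<ge> 0" if "flag F x y z" for x y z using that by (auto simp: w_def)
  have boundary_sum_nn: "boundary_sum w t \<ge> 0" if "t \<in># F" for t
  proof -
    obtain x y z where t: "t = (x, y, z)" by (cases t)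
    then have "flag F x y z" using that flag_member by blast
    then show ?thesis using nn flag_rot unfolding t boundary_sum.simps by (smt (verit))
  qed
  obtain t where t: "t \<in># F" "orbit_equiv (a, b, c) t" using c by (auto simp: flag_def)
  have "boundary_sum w (a, b, c) = boundary_sum w t" by (rule orbit_equiv_bd[OF t(2) \<open>cochain w\<close>])
  moreover have "boundary_sum w (a, b, c) > 0"
  proof -
    have "E a b" unfolding E_def by (rule bexI[OF _ \<Lambda>_0]) simp
    then have "w a b > 0" using noE[OF c] by (simp add: w_def)
    moreover have "w b c \<ge> 0" "w c a \<ge> 0" using nn flag_rot c by blast+
    ultimately show ?thesis by simp
  qed
  ultimately have "boundary_sum w t > 0" by simp
  moreover have "(\<Sum>t\<in>#F. boundary_sum w t) = boundary_sum w t + (\<Sum>t\<in>#F - {#t#}. boundary_sum w t)"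
    using t(1) by (metis insert_DiffM sum_mset.insert image_mset_add_mset)
  moreover have "(\<Sum>t\<in>#F - {#t#}. boundary_sum w t) \<ge> 0"
    by (rule sum_mset_nonneg_real) (use boundary_sum_nn in \<open>auto dest: in_diffD\<close>)
  ultimately show False using total by simp
qed

section \<open>Delaunay triangulations with prescribed vertices\<close>

lemma vertices_eq: "vertices F = {v + l | v l. v \<in> (\<Union>t\<in>set_mset F. verts t) \<and> l \<in> \<Lambda>}"
  unfolding vertices_def by blast

lemma flip:
  assumes F: "triangulation F" and c: "flag F a b c" and d: "flag F b a d"
    and neg: "apex_dot a b c * area2 b a d + apex_dot a b d * area2 a b c < 0"
  shows "\<exists>F'. triangulation F' \<and> size F' = size F \<and> vertices F' = vertices F \<and>
    (\<Sum>t\<in>#F'. potential t) < (\<Sum>t\<in>#F. potential t)"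
proof -
  obtain R where R: "same_triangulation F (R + {#(a, b, c), (b, a, d)#})" using normalize2[OF F c d] .
  have pr: "area2 a b c > 0" "area2 b a d > 0" "{a, b, c, d} \<subseteq> int_lattice"
    using flag_proper[OF F c] flag_proper[OF F d] by (auto simp: proper_def)
  note cv = flip_convex[OF pr(1,2) neg]
  let ?G = "{#(a, b, c), (b, a, d)#}" and ?H = "{#(a, d, c), (d, b, c)#}"
  have ne: "a \<noteq> b" "c \<noteq> d" using pr(1) cv(1) by auto
  have "triangulation (R + ?H)"
  proof (rule exchange)
    show "triangulation (R + ?G)" using R by (simp add: same_triangulation_def)
    show "\<forall>t\<in>#?H. proper t" using cv pr by (auto simp: proper_def)
    fix w assume "cochain w"
    then have "w b a = - w a b" "w c d = - w d c" unfolding cochain_def by blast+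
    then show "(\<Sum>t\<in>#?G. boundary_sum w t) = (\<Sum>t\<in>#?H. boundary_sum w t)" by simp
  next
    fix y assume y: "generic y"
    have "area2 a b y \<noteq> 0" "area2 c d y \<noteq> 0" using generic_area2[OF y] pr(3) ne by auto
    with inside_flip[OF pr(1,2) cv]
    show "(\<Sum>t\<in>#?G. of_bool (inside t y) :: nat) = (\<Sum>t\<in>#?H. of_bool (inside t y))"
      by simp
  next
    show "(\<Sum>t\<in>#?G. tri_area2 t) = (\<Sum>t\<in>#?H. tri_area2 t)" by (simp add: area2_def algebra_simps)
  qed
  moreover have "size (R + ?H) = size F" using R by (auto simp: same_triangulation_def)
  moreover have "vertices (R + ?H) = vertices F"
  proof -
    have "(\<Union>t\<in>set_mset (R + ?H). verts t) = (\<Union>t\<in>set_mset (R + ?G). verts t)" by auto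
    then show ?thesis using R unfolding same_triangulation_def vertices_eq by metis
  qed
  moreover have "(\<Sum>t\<in>#R + ?H. potential t) < (\<Sum>t\<in>#F. potential t)"
  proof -
    have "(\<Sum>t\<in>#F. potential t) = (\<Sum>t\<in>#R. potential t) + (potential (a, b, c) + potential (b, a, d))"
      using R by (auto simp: same_triangulation_def simp del: potential.simps)
    then show ?thesis using neg by (simp add: potential_flip del: potential.simps)
  qed
  ultimately show ?thesis by blast
qed

lemma pot_Ints: assumes "proper t" shows "potential t \<in> \<int>" "potential t \<ge> 0"
proof -
  obtain a b c where t: "t = (a, b, c)" by (cases t)
  have i: "a$1 \<in> \<int>" "a$2 \<in> \<int>" "b$1 \<in> \<int>" "b$2 \<in> \<int>" "c$1 \<in> \<int>" "c$2 \<in> \<int>" and p: "area2 a b c > 0"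
    using assms by (auto simp: proper_def t int_lattice_coord)
  show "potential t \<in> \<int>" unfolding t potential.simps dist_coord area2_def
    by (intro Ints_mult Ints_add Ints_diff Ints_power i)
  show "potential t \<ge> 0" using p by (simp add: t)
qed

text \<open>A non-Delaunay edge can be flipped, and this decreases the total potential, a natural number.\<close>
lemma delaunay_exists:
  assumes "triangulation F"
  shows "\<exists>F'. triangulation F' \<and> size F' = size F \<and> vertices F' = vertices F \<and>
    (\<forall>a b c d. flag F' a b c \<longrightarrow> flag F' b a d \<longrightarrow> apex_dot a b c * area2 b a d + apex_dot a b d * area2 a b c \<ge> 0)"
  using assms
proof (induction "nat \<lfloor>\<Sum>t\<in>#F. potential t\<rfloor>" arbitrary: F rule: less_induct)
  case less
  show ?case
  proof (cases "\<forall>a b c d. flag F a b c \<longrightarrow> flag F b a d \<longrightarrow> apex_dot a b c * area2 b a d + apex_dot a b d * area2 a b c \<ge> 0")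
    case True
    then show ?thesis using less.prems by blast
  next
    case False
    then obtain F' where F': "triangulation F'" "size F' = size F" "vertices F' = vertices F"
      and lt: "(\<Sum>t\<in>#F'. potential t) < (\<Sum>t\<in>#F. potential t)"
      using flip[OF less.prems] by (metis linorder_not_le)
    have ints: "(\<Sum>t\<in>#G. potential t) \<in> \<int> \<and> (\<Sum>t\<in>#G. potential t) \<ge> 0" if "\<forall>t\<in>#G. proper t" for G
      using that by (induction G) (auto simp del: potential.simps intro!: Ints_add pot_Ints add_nonneg_nonneg)
    obtain i j where i: "(\<Sum>t\<in>#F'. potential t) = of_int i" and j: "(\<Sum>t\<in>#F. potential t) = of_int j"
      using ints[of F] ints[of F'] F'(1) less.prems unfolding triangulation_def by (metis Ints_cases)
    have "(\<Sum>t\<in>#F'. potential t) \<ge> 0" using ints[of F'] F'(1) unfolding triangulation_def by blast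
    then have "nat \<lfloor>\<Sum>t\<in>#F'. potential t\<rfloor> < nat \<lfloor>\<Sum>t\<in>#F. potential t\<rfloor>" using lt by (simp add: i j)
    from less.hyps[OF this F'(1)] F'(2,3) show ?thesis by auto
  qed
qed

lemma insert_inside:
  assumes F: "triangulation F" and c: "flag F a b c" and p: "p \<in> int_lattice"
    and pos: "area2 a b p > 0" "area2 b c p > 0" "area2 c a p > 0"
  shows "\<exists>F'. triangulation F' \<and> size F' = size F + 2 \<and> vertices F' = vertices F \<union> {p + l | l. l \<in> \<Lambda>}"
proof -
  obtain R where R: "same_triangulation F (add_mset (a, b, c) R)" using normalize1[OF F c] .
  have pr: "area2 a b c > 0" "{a, b, c} \<subseteq> int_lattice"
    using flag_proper[OF F c] by (auto simp: proper_def)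
  have ne: "p \<noteq> a" "p \<noteq> b" "p \<noteq> c" using pos by auto
  let ?G = "{#(a, b, c)#}" and ?H = "{#(p, a, b), (p, b, c), (p, c, a)#}"
  have "triangulation (R + ?H)"
  proof (rule exchange)
    show "triangulation (R + ?G)" using R by (simp add: same_triangulation_def)
    have "area2 p a b = area2 a b p" "area2 p b c = area2 b c p" "area2 p c a = area2 c a p"
      by (rule area2_rot[symmetric])+
    then show "\<forall>t\<in>#?H. proper t" using pos pr p by (auto simp: proper_def)
    fix w assume "cochain w"
    then have "w b p = - w p b" "w c p = - w p c" "w a p = - w p a" unfolding cochain_def by blast+
    then show "(\<Sum>t\<in>#?G. boundary_sum w t) = (\<Sum>t\<in>#?H. boundary_sum w t)" by simp
  next
    fix y assume y: "generic y"
    have "area2 p a y \<noteq> 0" "area2 p b y \<noteq> 0" "area2 p c y \<noteq> 0" using generic_area2[OF y] pr(2) p ne by auto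
    with inside_subdivide[OF pr(1) pos]
    show "(\<Sum>t\<in>#?G. of_bool (inside t y) :: nat) = (\<Sum>t\<in>#?H. of_bool (inside t y))"
      by (simp del: inside.simps)
  next
    show "(\<Sum>t\<in>#?G. tri_area2 t) = (\<Sum>t\<in>#?H. tri_area2 t)" by (simp add: area2_def algebra_simps)
  qed
  moreover have "size (R + ?H) = size F + 2" using R by (auto simp: same_triangulation_def)
  moreover have "vertices (R + ?H) = vertices F \<union> {p + l | l. l \<in> \<Lambda>}"
  proof -
    have "(\<Union>t\<in>set_mset (R + ?H). verts t) = insert p (\<Union>t\<in>set_mset (add_mset (a, b, c) R). verts t)" by auto
    moreover have "vertices F = vertices (add_mset (a, b, c) R)" using R by (simp add: same_triangulation_def)
    ultimately show ?thesis unfolding vertices_eq by auto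
  qed
  ultimately show ?thesis by blast
qed

text \<open>A new vertex in the interior of an edge splits both adjacent triangles.\<close>
lemma insert_edge:
  assumes F: "triangulation F" and c: "flag F a b c" and p: "p \<in> int_lattice"
    and pos: "area2 a b p = 0" "area2 b c p \<ge> 0" "area2 c a p \<ge> 0" and new: "p \<notin> vertices F"
  shows "\<exists>F'. triangulation F' \<and> size F' = size F + 2 \<and> vertices F' = vertices F \<union> {p + l | l. l \<in> \<Lambda>}"
proof -
  obtain d where d: "flag F b a d" using mate_exists[OF F c] by blast
  obtain R where R: "same_triangulation F (R + {#(a, b, c), (b, a, d)#})" using normalize2[OF F c d] .
  have pr: "area2 a b c > 0" "area2 b a d > 0" "{a, b, c, d} \<subseteq> int_lattice"
    using flag_proper[OF F c] flag_proper[OF F d] by (auto simp: proper_def)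
  have "a \<in> vertices F" "b \<in> vertices F" "c \<in> vertices F" "d \<in> vertices F"
    using flag_vertices flag_rot c d by blast+
  then have ne: "p \<noteq> a" "p \<noteq> b" "p \<noteq> c" "p \<noteq> d" using new by auto
  define s where "s = area2 c a p / area2 a b c"
  have nz: "area2 a b c \<noteq> 0" using pr by simp
  have s1: "area2 b c p / area2 a b c = 1 - s" using barycentric(2)[OF nz, of p] pos(1) by (simp add: s_def)
  have ps: "p = a + s *\<^sub>R (b - a)"
    using barycentric(1)[OF nz, of p] unfolding s1 s_def[symmetric] using pos(1) by (simp add: algebra_simps)
  have "0 \<le> s" "0 \<le> 1 - s" using pos pr(1) s1[symmetric] by (simp_all add: s_def)
  moreover have "s \<noteq> 0" "s \<noteq> 1" using ps ne by auto
  ultimately have s: "0 < s" "s < 1" by auto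
  have ps': "p = b + (1 - s) *\<^sub>R (a - b)" using ps by (simp add: algebra_simps)
  have dts: "area2 a p c = s * area2 a b c" "area2 p b c = (1 - s) * area2 a b c"
     "area2 b p d = (1 - s) * area2 b a d" "area2 p a d = s * area2 b a d"
    unfolding ps area2_def by (simp_all add: algebra_simps)
  let ?G = "{#(a, b, c), (b, a, d)#}" and ?H = "{#(a, p, c), (p, b, c), (b, p, d), (p, a, d)#}"
  have "triangulation (R + ?H)"
  proof (rule exchange)
    show "triangulation (R + ?G)" using R by (simp add: same_triangulation_def)
    show "\<forall>t\<in>#?H. proper t" using pr p s by (auto simp: proper_def dts)
    fix w assume "cochain w"
    then have "w b a = - w a b" "w p a = - w a p" "w p b = - w b p" "w p c = - w c p" "w p d = - w d p"
      unfolding cochain_def by blast+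
    then show "(\<Sum>t\<in>#?G. boundary_sum w t) = (\<Sum>t\<in>#?H. boundary_sum w t)" by simp
  next
    fix y assume y: "generic y"
    have "area2 c p y \<noteq> 0" "area2 d p y \<noteq> 0" using generic_area2[OF y] pr(3) p ne by auto
    with inside_split[OF ps s] inside_split[OF ps'] s
    show "(\<Sum>t\<in>#?G. of_bool (inside t y) :: nat) = (\<Sum>t\<in>#?H. of_bool (inside t y))"
      by (simp del: inside.simps)
  next
    show "(\<Sum>t\<in>#?G. tri_area2 t) = (\<Sum>t\<in>#?H. tri_area2 t)" by (simp add: dts algebra_simps)
  qed
  moreover have "size (R + ?H) = size F + 2" using R by (auto simp: same_triangulation_def)
  moreover have "vertices (R + ?H) = vertices F \<union> {p + l | l. l \<in> \<Lambda>}"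
  proof -
    have "(\<Union>t\<in>set_mset (R + ?H). verts t) = insert p (\<Union>t\<in>set_mset (R + ?G). verts t)" by auto
    moreover have "vertices F = vertices (R + ?G)" using R by (simp add: same_triangulation_def)
    ultimately show ?thesis unfolding vertices_eq by auto
  qed
  ultimately show ?thesis by blast
qed

lemma insert_vertex:
  assumes F: "triangulation F" and p: "p \<in> int_lattice" and new: "p \<notin> vertices F"
  shows "\<exists>F'. triangulation F' \<and> size F' = size F + 2 \<and> vertices F' = vertices F \<union> {p + l | l. l \<in> \<Lambda>}"
proof -
  obtain a b c where c: "flag F a b c" and hull: "p \<in> convex hull {a, b, c}"
    using covering[OF F] by blast
  have "area2 a b c > 0" using flag_proper[OF F c] by (simp add: proper_def)
  then have nn: "area2 a b p \<ge> 0" "area2 b c p \<ge> 0" "area2 c a p \<ge> 0"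
    using hull by (auto simp: triangle_hull_iff)
  have c': "flag F b c a" "flag F c a b" using flag_rot c by blast+
  consider "area2 a b p = 0" | "area2 b c p = 0" | "area2 c a p = 0" | "area2 a b p > 0" "area2 b c p > 0" "area2 c a p > 0"
    using nn by linarith
  then show ?thesis
  proof cases
    case 1 then show ?thesis using insert_edge[OF F c p] nn new by blast
  next
    case 2 then show ?thesis using insert_edge[OF F c'(1) p] nn new by blast
  next
    case 3 then show ?thesis using insert_edge[OF F c'(2) p] nn new by blast
  next
    case 4 then show ?thesis using insert_inside[OF F c p] by blast
  qed
qed

text \<open>The coordinates of \<open>x - p\<close> in the basis have integral parts giving \<open>m\<close>; the sum of
  the fractional parts decides on which side of the diagonal \<open>x\<close> lies.\<close>
lemma tile:
  assumes p: "p \<in> int_lattice" and x: "generic x"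
  obtains m where "m \<in> \<Lambda>"
    "inside (p, p + e, p + f) (x - m) \<noteq> inside (p + f, p + e, p + e + f) (x - m)"
    "\<And>l. l \<in> \<Lambda> \<Longrightarrow> inside (p, p + e, p + f) (x - l) \<or> inside (p + f, p + e, p + e + f) (x - l) \<Longrightarrow> l = m"
proof -
  define \<delta> where "\<delta> = area2 0 e f"
  have \<delta>: "\<delta> > 0" using pos by (simp add: \<delta>_def)
  define s where "s = area2 (p + f) p x / \<delta>"
  define r where "r = area2 p (p + e) x / \<delta>"
  have s\<delta>: "area2 (p + f) p x = \<delta> * s" and r\<delta>: "area2 p (p + e) x = \<delta> * r"
    using \<delta> by (simp_all add: s_def r_def)
  let ?l = "\<lambda>i j. of_int i *\<^sub>R e + of_int j *\<^sub>R f"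
  have v: "area2 p (p + e) (x - ?l i j) = \<delta> * (r - of_int j)"
    "area2 (p + f) p (x - ?l i j) = \<delta> * (s - of_int i)"
    "area2 (p + e) (p + f) (x - ?l i j) = \<delta> * (1 - (s - of_int i) - (r - of_int j))"
    "area2 (p + f) (p + e) (x - ?l i j) = \<delta> * ((s - of_int i) + (r - of_int j) - 1)"
    "area2 (p + e) (p + e + f) (x - ?l i j) = \<delta> * (1 - (s - of_int i))"
    "area2 (p + e + f) (p + f) (x - ?l i j) = \<delta> * (1 - (r - of_int j))" for i j
    unfolding right_diff_distrib distrib_left s\<delta>[symmetric] r\<delta>[symmetric]
    unfolding area2_def \<delta>_def by (simp_all add: algebra_simps)
  have up: "inside (p, p + e, p + f) (x - ?l i j) \<longleftrightarrow>
      r > of_int j \<and> s > of_int i \<and> (s - of_int i) + (r - of_int j) < 1" for i j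
    unfolding inside.simps v using \<delta> by (auto simp: zero_less_mult_iff)
  have down: "inside (p + f, p + e, p + e + f) (x - ?l i j) \<longleftrightarrow>
      (s - of_int i) + (r - of_int j) > 1 \<and> s < of_int i + 1 \<and> r < of_int j + 1" for i j
    unfolding inside.simps v using \<delta> by (auto simp: zero_less_mult_iff)
  define i where "i = \<lfloor>s\<rfloor>"  define j where "j = \<lfloor>r\<rfloor>"
  have uniq: "i' = i \<and> j' = j"
    if "inside (p, p + e, p + f) (x - ?l i' j') \<or> inside (p + f, p + e, p + e + f) (x - ?l i' j')" for i' j'
  proof -
    have "of_int i' \<le> s" "s < of_int i' + 1" "of_int j' \<le> r" "r < of_int j' + 1"
      using that unfolding up down by auto
    then show ?thesis unfolding i_def j_def by (metis floor_unique)
  qed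
  have "generic (x - ?l i j)"
    by (intro generic_shift x int_lattice_add int_lattice_scale e f)
  note g = generic_area2[OF this]
  have enz: "e \<noteq> 0" "f \<noteq> 0" "e \<noteq> f" using pos by auto
  have "area2 p (p + e) (x - ?l i j) \<noteq> 0" by (rule g) (use p e f enz int_lattice_add in auto)
  moreover have "area2 (p + f) p (x - ?l i j) \<noteq> 0" by (rule g) (use p e f enz int_lattice_add in auto)
  moreover have "area2 (p + f) (p + e) (x - ?l i j) \<noteq> 0" by (rule g) (use p e f enz int_lattice_add in auto)
  ultimately have nz: "r \<noteq> of_int j" "s \<noteq> of_int i" "(s - of_int i) + (r - of_int j) \<noteq> 1"
    unfolding v using \<delta> by auto
  have fl: "of_int i \<le> s" "s < of_int i + 1" "of_int j \<le> r" "r < of_int j + 1"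
    unfolding i_def j_def by linarith+
  show thesis
  proof (rule that)
    show "?l i j \<in> \<Lambda>" by (rule mem_\<Lambda>)
    show "inside (p, p + e, p + f) (x - ?l i j) \<noteq> inside (p + f, p + e, p + e + f) (x - ?l i j)"
      unfolding up down using nz fl by auto
    fix l assume "l \<in> \<Lambda>" and l: "inside (p, p + e, p + f) (x - l) \<or> inside (p + f, p + e, p + e + f) (x - l)"
    then obtain i' j' where "l = ?l i' j'" by (auto simp: sublattice_gen_def)
    then show "l = ?l i j" using uniq l by auto
  qed
qed

lemma triangulation_initial:
  assumes p: "p \<in> int_lattice"
  shows "triangulation {#(p, p + e, p + f), (p + f, p + e, p + e + f)#}" (is "triangulation ?F")
    and "vertices {#(p, p + e, p + f), (p + f, p + e, p + e + f)#} = {p + l | l. l \<in> \<Lambda>}"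
proof -
  have d: "area2 p (p + e) (p + f) = area2 0 e f" "area2 (p + f) (p + e) (p + e + f) = area2 0 e f"
    by (simp_all add: area2_def algebra_simps)
  show "triangulation ?F"
    unfolding triangulation_def
  proof (intro conjI allI impI ballI)
    fix t assume "t \<in># ?F" then show "proper t" using p e f pos by (auto simp: proper_def d int_lattice_add)
  next
    fix w assume w: "cochain w"
    have as: "w b a = - w a b" for a b using w unfolding cochain_def by blast
    have sh: "w (a + l) (b + l) = w a b" if "l \<in> \<Lambda>" for a b l using w that unfolding cochain_def by blast
    have "w (p + e) (p + e + f) = w p (p + f)"
      using sh[OF \<Lambda>_gens(1), of p "p + f"] by (simp add: add_ac)
    moreover have "w (p + e + f) (p + f) = w (p + e) p"
      using sh[OF \<Lambda>_gens(2), of "p + e" p] by simp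
    ultimately show "(\<Sum>t\<in>#?F. boundary_sum w t) = 0"
      using as[of p "p + f"] as[of p "p + e"] as[of "p + e" "p + f"] by simp
  next
    fix x assume x: "generic x"
    obtain m where m: "m \<in> \<Lambda>"
      "inside (p, p + e, p + f) (x - m) \<noteq> inside (p + f, p + e, p + e + f) (x - m)"
      "\<And>l. l \<in> \<Lambda> \<Longrightarrow> inside (p, p + e, p + f) (x - l) \<or> inside (p + f, p + e, p + e + f) (x - l) \<Longrightarrow> l = m"
      using tile[OF p x] by blast
    have "coverage t x = of_bool (inside t (x - m))" if "t \<in># ?F" for t
    proof -
      have "l = m" if "l \<in> \<Lambda>" "inside t (x - l)" for l
        using m(3)[OF that(1)] that(2) \<open>t \<in># ?F\<close> by (auto simp del: inside.simps)
      then have "{l\<in>\<Lambda>. inside t (x - l)} = {l. l = m \<and> inside t (x - m)}"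
        using m(1) by blast
      then show ?thesis by (simp add: coverage_def)
    qed
    then show "(\<Sum>t\<in>#?F. coverage t x) = 1" using m(2) by (auto simp del: inside.simps)
  next
    show "(\<Sum>t\<in>#?F. tri_area2 t) = 2 * area2 0 e f" by (simp add: d)
  qed
  have "p + e + l \<in> {p + l | l. l \<in> \<Lambda>}" "p + f + l \<in> {p + l | l. l \<in> \<Lambda>}" "p + e + f + l \<in> {p + l | l. l \<in> \<Lambda>}"
    if "l \<in> \<Lambda>" for l
    using \<Lambda>_add[OF \<Lambda>_gens(1) that] \<Lambda>_add[OF \<Lambda>_gens(2) that] \<Lambda>_add[OF \<Lambda>_gens(1) \<Lambda>_add[OF \<Lambda>_gens(2) that]]
    by (auto simp: add.assoc)
  then show "vertices ?F = {p + l | l. l \<in> \<Lambda>}"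
    unfolding vertices_eq by auto
qed

text \<open>Insert the orbits one after the other; every insertion adds two triangles.\<close>
lemma triangulation_exists:
  assumes "finite V" "V \<noteq> {}" "V \<subseteq> int_lattice" "\<forall>x\<in>V. \<forall>y\<in>V. x \<noteq> y \<longrightarrow> x - y \<notin> \<Lambda>"
  shows "\<exists>F. triangulation F \<and> size F = 2 * card V \<and> vertices F = {v + l | v l. v \<in> V \<and> l \<in> \<Lambda>}"
  using assms
proof (induction V rule: finite_ne_induct)
  case (singleton p)
  then have "p \<in> int_lattice" by simp
  then show ?case
    using triangulation_initial[of p] by (intro exI[of _ "{#(p, p + e, p + f), (p + f, p + e, p + e + f)#}"]) auto
next
  case (insert p V)
  then obtain F where F: "triangulation F" "size F = 2 * card V" "vertices F = {v + l | v l. v \<in> V \<and> l \<in> \<Lambda>}"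
    by auto
  have "p \<notin> vertices F"
  proof
    assume "p \<in> vertices F"
    then obtain v l where "v \<in> V" "l \<in> \<Lambda>" "p = v + l" using F by auto
    moreover have "v \<noteq> p" using insert \<open>v \<in> V\<close> by auto
    ultimately show False using insert.prems by auto
  qed
  with insert_vertex[OF F(1), of p] insert.prems obtain F' where
    "triangulation F'" "size F' = size F + 2" "vertices F' = vertices F \<union> {p + l | l. l \<in> \<Lambda>}" by auto
  then show ?case using F insert by (intro exI[of _ F']) auto
qed

end

section \<open>Redistribution of area\<close>

text \<open>The heart of the area estimate. With \<open>s = y + z\<close> the relation between the cotangents of the angles
  of a triangle gives \<open>x = (1 - y * z) / s \<ge> 1 / s - s / 4\<close>, and \<open>1 / s + s / 4 \<ge> 1\<close>
  by the inequality of the means.\<close>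
lemma cot_ineq:
  fixes x y z :: real
  assumes r: "x * y + y * z + z * x = 1" and yz: "y \<ge> 0" "z \<ge> 0"
  shows "x + (y + z) / 2 \<ge> 1" and "x < 0 \<Longrightarrow> x + (y + z) / 2 > 1"
proof -
  define s where "s = y + z"
  have "s \<noteq> 0" using r yz by (auto simp: s_def add_nonneg_eq_0_iff)
  then have s: "s > 0" using yz by (simp add: s_def)
  have "4 * (y * z) \<le> s\<^sup>2" unfolding s_def
    using zero_le_power2[of "y - z"] by (simp add: power2_eq_square algebra_simps)
  moreover have xs: "x * s = 1 - y * z" using r by (simp add: s_def algebra_simps)
  ultimately have "(x + s / 2) * s \<ge> 1 + s\<^sup>2 / 4" by (simp add: power2_eq_square algebra_simps)
  moreover have complete_square: "1 + s\<^sup>2 / 4 = s + (1 - s / 2)\<^sup>2" by (simp add: power2_eq_square algebra_simps)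
  ultimately have ge: "(x + s / 2) * s \<ge> s + (1 - s / 2)\<^sup>2" by simp
  then have "1 * s \<le> (x + s / 2) * s" using zero_le_power2[of "1 - s / 2"] by linarith
  then show "x + (y + z) / 2 \<ge> 1" using s by (simp add: s_def)
  assume "x < 0"
  then have "x * s < 0" using s by (simp add: mult_neg_pos)
  then have "4 < s\<^sup>2" using xs \<open>4 * (y * z) \<le> s\<^sup>2\<close> by linarith
  then have "s \<noteq> 2" by auto
  then have "(1 - s / 2)\<^sup>2 > 0" by simp
  then have "1 * s < (x + s / 2) * s" using ge by linarith
  then show "x + (y + z) / 2 > 1" using s by (simp add: s_def)
qed

lemma discharge_one:
  fixes x y z P Q R K :: real
  assumes r: "x * y + y * z + z * x = 1" and K: "K > 0"
    and P: "P \<ge> K * x" and yz: "y \<ge> 0" "z \<ge> 0"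
    and Q: "Q \<ge> K * y \<or> Q \<ge> K * y / 2" and R: "R \<ge> K * z \<or> R \<ge> K * z / 2"
  shows "P + Q + R \<ge> K" "x < 0 \<Longrightarrow> P + Q + R > K"
proof -
  have "K * y \<ge> 0" "K * z \<ge> 0" using K yz by simp_all
  then have "Q \<ge> K * y / 2" "R \<ge> K * z / 2" using Q R by auto
  moreover have "K * (x + (y + z) / 2) = K * x + K * y / 2 + K * z / 2" by (simp add: field_simps)
  ultimately have "P + Q + R \<ge> K * (x + (y + z) / 2)" using P by linarith
  moreover have "K * 1 \<le> K * (x + (y + z) / 2)" using cot_ineq(1)[OF r yz] K by simp
  moreover have "x < 0 \<Longrightarrow> K * 1 < K * (x + (y + z) / 2)" using cot_ineq(2)[OF r yz] K by simp
  ultimately show "P + Q + R \<ge> K" "x < 0 \<Longrightarrow> P + Q + R > K" by linarith+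
qed

text \<open>\<open>P\<close>, \<open>Q\<close>, \<open>R\<close> are the shares of the three edges after redistribution. An
  edge through which area has passed keeps \<open>K\<close> times its cotangent, any other edge half of that. A
  negative cotangent always belongs to an edge of the first kind.\<close>
lemma discharge:
  fixes x y z P Q R K :: real
  assumes r: "x * y + y * z + z * x = 1" and K: "K > 0"
    and pairs: "x + y > 0" "y + z > 0" "z + x > 0"
    and P: "P \<ge> K * x \<or> x \<ge> 0 \<and> P \<ge> K * x / 2"
    and Q: "Q \<ge> K * y \<or> y \<ge> 0 \<and> Q \<ge> K * y / 2"
    and R: "R \<ge> K * z \<or> z \<ge> 0 \<and> R \<ge> K * z / 2"
    and some: "P \<ge> K * x \<or> Q \<ge> K * y \<or> R \<ge> K * z"
  shows "P + Q + R \<ge> K" "x < 0 \<or> y < 0 \<or> z < 0 \<Longrightarrow> P + Q + R > K"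
proof -
  have r2: "y * z + z * x + x * y = 1" and r3: "z * x + x * y + y * z = 1" using r by simp_all
  note d1 = discharge_one[OF r K, of P Q R]
  note d2 = discharge_one[OF r2 K, of Q R P]
  note d3 = discharge_one[OF r3 K, of R P Q]
  consider "x < 0" "y \<ge> 0" "z \<ge> 0" | "y < 0" "x \<ge> 0" "z \<ge> 0" | "z < 0" "x \<ge> 0" "y \<ge> 0"
    | "x \<ge> 0" "y \<ge> 0" "z \<ge> 0" using pairs by linarith
  then have "P + Q + R \<ge> K \<and> (x < 0 \<or> y < 0 \<or> z < 0 \<longrightarrow> P + Q + R > K)"
  proof cases
    case 1 then show ?thesis using d1 P Q R by force
  next
    case 2 then show ?thesis using d2 P Q R by force
  next
    case 3 then show ?thesis using d3 P Q R by force
  next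
    case 4 then show ?thesis using d1 d2 d3 P Q R some by force
  qed
  then show "P + Q + R \<ge> K" "x < 0 \<or> y < 0 \<or> z < 0 \<Longrightarrow> P + Q + R > K" by auto
qed

definition apex_cot :: "real^2 \<Rightarrow> real^2 \<Rightarrow> real^2 \<Rightarrow> real" where
  "apex_cot a b c = apex_dot a b c / area2 a b c"

lemma apex_cot_relation:
  assumes "area2 a b c > 0"
  shows "apex_cot a b c * apex_cot b c a + apex_cot b c a * apex_cot c a b + apex_cot c a b * apex_cot a b c = 1"
proof -
  have "apex_dot a b c * apex_dot b c a + apex_dot b c a * apex_dot c a b + apex_dot c a b * apex_dot a b c = area2 a b c * area2 a b c"
    unfolding apex_dot_coord area2_def by algebra
  moreover have "area2 b c a = area2 a b c" "area2 c a b = area2 a b c" using area2_rot by metis+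
  ultimately show ?thesis using assms
    unfolding apex_cot_def by (simp add: divide_simps)
qed

lemma apex_cot_pair:
  assumes "area2 a b c > 0"
  shows "apex_cot b c a + apex_cot c a b = (dist a b)\<^sup>2 / area2 a b c"
proof -
  have "apex_dot b c a + apex_dot c a b = (dist a b)\<^sup>2" unfolding apex_dot_coord dist_coord by algebra
  moreover have "area2 b c a = area2 a b c" "area2 c a b = area2 a b c" using area2_rot by metis+
  ultimately show ?thesis unfolding apex_cot_def by (simp add: add_divide_distrib[symmetric])
qed

text \<open>The circumcentre cuts the triangle into three isosceles ones, with a sign.\<close>
lemma apex_cot_area:
  assumes "area2 a b c > 0"
  shows "area2 a b c = (dist a b)\<^sup>2 / 2 * apex_cot a b c + (dist b c)\<^sup>2 / 2 * apex_cot b c a + (dist c a)\<^sup>2 / 2 * apex_cot c a b"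
proof -
  have "2 * (area2 a b c * area2 a b c) =
      (dist a b)\<^sup>2 * apex_dot a b c + (dist b c)\<^sup>2 * apex_dot b c a + (dist c a)\<^sup>2 * apex_dot c a b"
    unfolding apex_dot_coord area2_def dist_coord by algebra
  moreover have "area2 b c a = area2 a b c" "area2 c a b = area2 a b c" using area2_rot by metis+
  ultimately show ?thesis using assms
    unfolding apex_cot_def by (simp add: divide_simps)
qed

text \<open>The triangles that compete in the definition of \<open>S\<close>, positively oriented and without the condition
  on the origin.\<close>
definition nonobtuse :: "real \<Rightarrow> real^2 \<Rightarrow> real^2 \<Rightarrow> real^2 \<Rightarrow> bool" where
  "nonobtuse D a b c \<longleftrightarrow> {a, b, c} \<subseteq> int_lattice \<and> area2 a b c > 0 \<and>
     D \<le> dist a b \<and> D \<le> dist b c \<and> D \<le> dist c a \<and> apex_dot a b c \<ge> 0 \<and> apex_dot b c a \<ge> 0 \<and> apex_dot c a b \<ge> 0"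

text \<open>The last assumption is the local Delaunay property: the cotangents of the two angles opposite to a common edge
  have a nonnegative sum, that is, the angles add up to at most a straight angle.\<close>
locale delaunay = torus +
  fixes F :: "tri multiset" and D :: real
  assumes F: "triangulation F" and D: "D > 0"
    and sep: "\<And>x y. x \<in> vertices F \<Longrightarrow> y \<in> vertices F \<Longrightarrow> x \<noteq> y \<Longrightarrow> D \<le> dist x y"
    and locally: "\<And>a b c d. flag F a b c \<Longrightarrow> flag F b a d \<Longrightarrow> apex_dot a b c * area2 b a d + apex_dot a b d * area2 a b c \<ge> 0"
begin

text \<open>What a triangle passes across the edge \<open>a b\<close> if its angle at \<open>c\<close> is obtuse. It raises
  the negative contribution \<open>(dist a b)\<^sup>2 / 2\<close> times the cotangent to \<open>D\<^sup>2\<close>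
  times the cotangent.\<close>
definition gift :: "real^2 \<Rightarrow> real^2 \<Rightarrow> real^2 \<Rightarrow> real" where
  "gift a b c = max 0 (- apex_cot a b c) * ((dist a b)\<^sup>2 / 2 - D\<^sup>2)"

text \<open>The supremum is over a singleton, because an edge determines the triangle on its left.\<close>
definition give :: "real^2 \<Rightarrow> real^2 \<Rightarrow> real" where
  "give a b = Sup {gift a b c | c. flag F a b c}"

definition flow :: "real^2 \<Rightarrow> real^2 \<Rightarrow> real" where
  "flow a b = give a b - give b a"

lemma give_eq: "flag F a b c \<Longrightarrow> give a b = gift a b c"
proof -
  assume c: "flag F a b c"
  then have "{gift a b c | c. flag F a b c} = {gift a b c}" using apex_unique[OF F c] by blast
  then show ?thesis by (simp add: give_def)
qed

text \<open>Being a cochain, the flow does not change the total area.\<close>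
lemma flow_cochain: "cochain flow"
proof -
  have "give (a + l) (b + l) = give a b" if l: "l \<in> \<Lambda>" for a b l
  proof -
    have gi: "gift (a + l) (b + l) (c + l) = gift a b c" for c
      by (simp add: gift_def apex_cot_def area2_shift apex_dot_def dist_norm)
    have "{gift (a + l) (b + l) c | c. flag F (a + l) (b + l) c} = {gift a b c | c. flag F a b c}"
    proof (intro equalityI subsetI)
      fix r assume "r \<in> {gift (a + l) (b + l) c | c. flag F (a + l) (b + l) c}"
      then obtain c where c: "r = gift (a + l) (b + l) c" "flag F (a + l) (b + l) c" by auto
      then have "flag F a b (c - l)" using flag_shift[OF l, of F a b "c - l"] by simp
      moreover have "r = gift a b (c - l)" using c gi[of "c - l"] by simp
      ultimately show "r \<in> {gift a b c | c. flag F a b c}" by blast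
    next
      fix r assume "r \<in> {gift a b c | c. flag F a b c}"
      then obtain c where c: "r = gift a b c" "flag F a b c" by auto
      then have "flag F (a + l) (b + l) (c + l)" using flag_shift[OF l] by simp
      moreover have "r = gift (a + l) (b + l) (c + l)" using c gi[of c] by simp
      ultimately show "r \<in> {gift (a + l) (b + l) c | c. flag F (a + l) (b + l) c}" by blast
    qed
    then show ?thesis by (simp add: give_def)
  qed
  then show ?thesis by (auto simp: cochain_def flow_def)
qed

lemma flag_facts:
  assumes "flag F a b c"
  shows "area2 a b c > 0" "{a, b, c} \<subseteq> int_lattice" "D \<le> dist a b" "D \<le> dist b c" "D \<le> dist c a"
proof -
  show 1: "area2 a b c > 0" "{a, b, c} \<subseteq> int_lattice"
    using flag_proper[OF F assms] by (auto simp: proper_def)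
  have "a \<in> vertices F" "b \<in> vertices F" "c \<in> vertices F"
    using flag_vertices flag_rot assms by blast+
  moreover have "a \<noteq> b" "b \<noteq> c" "c \<noteq> a" using 1 by auto
  ultimately show "D \<le> dist a b" "D \<le> dist b c" "D \<le> dist c a" using sep by auto
qed

lemma obtuse_opposite_long:
  assumes "D \<le> dist b c" "D \<le> dist c a" "apex_dot a b c \<le> 0"
  shows "(dist a b)\<^sup>2 / 2 \<ge> D\<^sup>2"
proof -
  have "(dist a b)\<^sup>2 = (dist b c)\<^sup>2 + (dist c a)\<^sup>2 - 2 * apex_dot a b c"
    unfolding apex_dot_coord dist_coord by algebra
  moreover have "(dist b c)\<^sup>2 \<ge> D\<^sup>2" "(dist c a)\<^sup>2 \<ge> D\<^sup>2" using assms D by (simp_all add: power_mono)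
  ultimately show ?thesis using assms by simp
qed

text \<open>If the neighbour is obtuse, its edge is long, and by the Delaunay property the cotangent here dominates the
  neighbour's negative one; so after paying, \<open>D\<^sup>2\<close> times the cotangent remains.\<close>
lemma edge_share:
  assumes c: "flag F a b c"
  shows "(dist a b)\<^sup>2 / 2 * apex_cot a b c + flow a b \<ge> D\<^sup>2 * apex_cot a b c \<or>
    apex_cot a b c \<ge> 0 \<and> flow a b = 0"
proof -
  obtain d where d: "flag F b a d" using mate_exists[OF F c] by blast
  note fc = flag_facts[OF c] and fd = flag_facts[OF d]
  have fl: "flow a b = gift a b c - gift b a d" using give_eq[OF c] give_eq[OF d] by (simp add: flow_def)
  have "apex_dot a b c / area2 a b c + apex_dot a b d / area2 b a d \<ge> 0"
    using locally[OF c d] fc(1) fd(1) by (simp add: divide_simps mult_ac add_ac)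
  then have sum: "apex_cot a b c + apex_cot b a d \<ge> 0" by (simp add: apex_cot_def apex_dot_swap)
  have longd: "(dist a b)\<^sup>2 / 2 \<ge> D\<^sup>2" if "apex_cot b a d < 0"
  proof -
    have "apex_dot b a d \<le> 0" using that fd(1) by (simp add: apex_cot_def divide_less_0_iff)
    then show ?thesis using obtuse_opposite_long[OF fd(4,5)] by (simp add: dist_commute)
  qed
  consider "apex_cot a b c < 0" | "apex_cot a b c \<ge> 0" "apex_cot b a d \<ge> 0" | "apex_cot a b c \<ge> 0" "apex_cot b a d < 0" by linarith
  then show ?thesis
  proof cases
    case 1
    then have "gift b a d = 0" using sum by (simp add: gift_def)
    moreover have "gift a b c = - apex_cot a b c * ((dist a b)\<^sup>2 / 2 - D\<^sup>2)" using 1 by (simp add: gift_def)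
    ultimately show ?thesis using fl by (simp add: algebra_simps)
  next
    case 2
    then show ?thesis using fl by (simp add: gift_def)
  next
    case 3
    then have "gift a b c = 0" "gift b a d = - apex_cot b a d * ((dist a b)\<^sup>2 / 2 - D\<^sup>2)"
      by (simp_all add: gift_def dist_commute)
    moreover have "apex_cot a b c * ((dist a b)\<^sup>2 / 2 - D\<^sup>2) \<ge> - apex_cot b a d * ((dist a b)\<^sup>2 / 2 - D\<^sup>2)"
      using sum longd[OF 3(2)] by (intro mult_right_mono) auto
    ultimately show ?thesis using fl by (simp add: algebra_simps)
  qed
qed

text \<open>A triangle touched by the flow keeps at least \<open>D\<^sup>2\<close>, and strictly more if it is obtuse; an
  untouched one is nonobtuse, so that the assumption on \<open>s\<close> applies to it.\<close>
lemma share: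
  assumes c: "flag F a b c" and s: "s \<le> D\<^sup>2"
    and least: "nonobtuse D a b c \<Longrightarrow> s \<le> area2 a b c"
  shows "s \<le> area2 a b c + boundary_sum flow (a, b, c)"
    and "apex_cot a b c < 0 \<Longrightarrow> s < area2 a b c + boundary_sum flow (a, b, c)"
proof -
  note fc = flag_facts[OF c]
  have c': "flag F b c a" "flag F c a b" using flag_rot c by blast+
  define x y z where "x = apex_cot a b c" and "y = apex_cot b c a" and "z = apex_cot c a b"
  have pos: "area2 b c a > 0" "area2 c a b > 0" using fc(1) area2_rot by metis+
  have r: "x * y + y * z + z * x = 1" using apex_cot_relation[OF fc(1)] by (simp add: x_def y_def z_def)
  have ne: "a \<noteq> b" "b \<noteq> c" "c \<noteq> a" using fc(1) by auto
  have pairs: "x + y > 0" "y + z > 0" "z + x > 0"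
    using apex_cot_pair[OF fc(1)] apex_cot_pair[OF pos(1)] apex_cot_pair[OF pos(2)] fc(1) pos ne
    by (simp_all add: x_def y_def z_def add_ac)
  define P Q R where "P = (dist a b)\<^sup>2 / 2 * x + flow a b" and "Q = (dist b c)\<^sup>2 / 2 * y + flow b c"
    and "R = (dist c a)\<^sup>2 / 2 * z + flow c a"
  have PQR: "area2 a b c + boundary_sum flow (a, b, c) = P + Q + R"
    using apex_cot_area[OF fc(1)] by (simp add: P_def Q_def R_def x_def y_def z_def)
  have K: "D\<^sup>2 > 0" using D by simp
  have half: "k / 2 * D\<^sup>2 \<le> l\<^sup>2 / 2 * k" if "k \<ge> 0" "D \<le> l" for k l :: real
  proof -
    have "D\<^sup>2 \<le> l\<^sup>2" using that D by (simp add: power_mono)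
    then have "k * D\<^sup>2 \<le> k * l\<^sup>2" using that by (intro mult_left_mono)
    then show ?thesis by (simp add: mult.commute)
  qed
  have e1: "P \<ge> D\<^sup>2 * x \<or> x \<ge> 0 \<and> flow a b = 0" and e2: "Q \<ge> D\<^sup>2 * y \<or> y \<ge> 0 \<and> flow b c = 0"
    and e3: "R \<ge> D\<^sup>2 * z \<or> z \<ge> 0 \<and> flow c a = 0"
    using edge_share[OF c] edge_share[OF c'(1)] edge_share[OF c'(2)]
    unfolding P_def Q_def R_def x_def y_def z_def by auto
  have P: "P \<ge> D\<^sup>2 * x \<or> x \<ge> 0 \<and> P \<ge> D\<^sup>2 * x / 2"
    using e1 half[of x, OF _ fc(3)] by (auto simp: P_def mult_ac)
  have Q: "Q \<ge> D\<^sup>2 * y \<or> y \<ge> 0 \<and> Q \<ge> D\<^sup>2 * y / 2"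
    using e2 half[of y, OF _ fc(4)] by (auto simp: Q_def mult_ac)
  have R: "R \<ge> D\<^sup>2 * z \<or> z \<ge> 0 \<and> R \<ge> D\<^sup>2 * z / 2"
    using e3 half[of z, OF _ fc(5)] by (auto simp: R_def mult_ac)
  show "s \<le> area2 a b c + boundary_sum flow (a, b, c)"
  proof (cases "P \<ge> D\<^sup>2 * x \<or> Q \<ge> D\<^sup>2 * y \<or> R \<ge> D\<^sup>2 * z")
    case True
    show ?thesis using discharge(1)[OF r K pairs P Q R True] s unfolding PQR by simp
  next
    case False
    then have nn: "x \<ge> 0" "y \<ge> 0" "z \<ge> 0" and z: "flow a b = 0" "flow b c = 0" "flow c a = 0"
      using e1 e2 e3 by auto
    have "nonobtuse D a b c"
      using nn fc pos by (auto simp: nonobtuse_def x_def y_def z_def apex_cot_def zero_le_divide_iff)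
    then show ?thesis using least z by simp
  qed
  assume neg: "apex_cot a b c < 0"
  then have "P \<ge> D\<^sup>2 * x" using e1 by (auto simp: x_def)
  then show "s < area2 a b c + boundary_sum flow (a, b, c)"
    using discharge(2)[OF r K pairs P Q R] neg s unfolding PQR by (auto simp: x_def)
qed

lemma sum_shares: "(\<Sum>t\<in>#F. tri_area2 t + boundary_sum flow t) = 2 * area2 0 e f"
  using F flow_cochain by (auto simp: triangulation_def sum_mset.distrib)

text \<open>If the bound is attained then no triangle is obtuse, so nothing flows and each doubled area is \<open>s\<close>
  itself.\<close>
lemma area_bound:
  assumes s: "s \<le> D\<^sup>2" and least: "\<And>a b c. nonobtuse D a b c \<Longrightarrow> s \<le> area2 a b c"
  shows "real (size F) * s \<le> 2 * area2 0 e f"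
    and "real (size F) * s = 2 * area2 0 e f \<Longrightarrow> flag F a b c \<Longrightarrow> nonobtuse D a b c \<and> area2 a b c = s"
proof -
  have share_t: "s \<le> tri_area2 t + boundary_sum flow t" if "t \<in># F" for t
    using share(1)[OF flag_member s least] that by (cases t) auto
  have "(\<Sum>t\<in>#F. s) \<le> (\<Sum>t\<in>#F. tri_area2 t + boundary_sum flow t)"
    by (rule sum_mset_mono) (rule share_t)
  then show "real (size F) * s \<le> 2 * area2 0 e f" using sum_shares by (simp add: sum_mset_constant)
  assume eq: "real (size F) * s = 2 * area2 0 e f"
  have tight: "tri_area2 t + boundary_sum flow t = s" if t: "t \<in># F" for t
  proof -
    obtain R where R: "F = add_mset t R" using t by (metis insert_DiffM)
    have "(\<Sum>u\<in>#R. s) \<le> (\<Sum>u\<in>#R. tri_area2 u + boundary_sum flow u)"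
      by (rule sum_mset_mono) (use share_t R in auto)
    then show ?thesis using sum_shares eq share_t[OF t] by (simp add: R algebra_simps)
  qed
  have tight_flag: "area2 a b c + boundary_sum flow (a, b, c) = s" if fl: "flag F a b c" for a b c
  proof -
    obtain t where t: "t \<in># F" "orbit_equiv (a, b, c) t" using fl by (auto simp: flag_def)
    then show ?thesis using tight[OF t(1)] orbit_equiv_ar[OF t(2)] orbit_equiv_bd[OF t(2) flow_cochain] by simp
  qed
  have nn: "apex_cot a b c \<ge> 0" if fl: "flag F a b c" for a b c
    using share(2)[OF fl s least] tight_flag[OF fl] by force
  have zero: "flow a b = 0" if fl: "flag F a b c" for a b c
  proof -
    obtain d where d: "flag F b a d" using mate_exists[OF F fl] by blast
    show ?thesis using nn[OF fl] nn[OF d] give_eq[OF fl] give_eq[OF d] by (simp add: flow_def gift_def)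
  qed
  assume fl: "flag F a b c"
  have fl': "flag F b c a" "flag F c a b" using flag_rot fl by blast+
  note ff = flag_facts[OF fl]
  have pos: "area2 b c a > 0" "area2 c a b > 0" using ff(1) area2_rot by metis+
  have "nonobtuse D a b c" using ff pos nn[OF fl] nn[OF fl'(1)] nn[OF fl'(2)]
    by (auto simp: nonobtuse_def apex_cot_def zero_le_divide_iff)
  moreover have "area2 a b c = s"
    using tight_flag[OF fl] zero[OF fl] zero[OF fl'(1)] zero[OF fl'(2)] by simp
  ultimately show "nonobtuse D a b c \<and> area2 a b c = s" by simp
qed

end

text \<open>The triangulation has two triangles for each vertex of the torus.\<close>
lemma (in torus) packing_bound:
  fixes s :: real
  assumes V: "finite V" "V \<noteq> {}" "V \<subseteq> int_lattice" and D: "D > 0"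
    and inj: "\<forall>x\<in>V. \<forall>y\<in>V. x \<noteq> y \<longrightarrow> x - y \<notin> \<Lambda>"
    and \<phi>: "\<phi> = {v + l | v l. v \<in> V \<and> l \<in> \<Lambda>}"
    and sep: "\<And>x y. x \<in> \<phi> \<Longrightarrow> y \<in> \<phi> \<Longrightarrow> x \<noteq> y \<Longrightarrow> D \<le> dist x y"
    and s: "s \<le> D\<^sup>2" and least: "\<And>a b c. nonobtuse D a b c \<Longrightarrow> s \<le> area2 a b c"
  shows "card V * s \<le> area2 0 e f"
    and "card V * s = area2 0 e f \<Longrightarrow>
      \<exists>F. triangulation F \<and> vertices F = \<phi> \<and> (\<forall>a b c. flag F a b c \<longrightarrow> nonobtuse D a b c \<and> area2 a b c = s)"
proof -
  obtain F0 where F0: "triangulation F0" "size F0 = 2 * card V" "vertices F0 = \<phi>"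
    using triangulation_exists[OF V inj] \<phi> by auto
  obtain F where F: "triangulation F" "size F = 2 * card V" "vertices F = \<phi>"
    and loc: "\<And>a b c d. flag F a b c \<Longrightarrow> flag F b a d \<Longrightarrow> apex_dot a b c * area2 b a d + apex_dot a b d * area2 a b c \<ge> 0"
    using delaunay_exists[OF F0(1)] F0(2,3) by auto
  interpret dl: delaunay e f F D
    by unfold_locales (use F D sep loc in auto)
  show "card V * s \<le> area2 0 e f" using dl.area_bound(1)[OF s least] F(2) by simp
  assume "card V * s = area2 0 e f"
  then have "real (size F) * s = 2 * area2 0 e f" using F(2) by simp
  from dl.area_bound(2)[OF s least this] F
  show "\<exists>F. triangulation F \<and> vertices F = \<phi> \<and> (\<forall>a b c. flag F a b c \<longrightarrow> nonobtuse D a b c \<and> area2 a b c = s)"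
    by blast
qed

section \<open>Minimal triangles\<close>

lemma area_area2: "area {a, b, c} = \<bar>area2 a b c\<bar> / 2"
proof -
  have "convex hull {a, b, c} \<in> sets lborel"
    by (simp add: borel_compact finite_imp_compact_convex_hull)
  then have "area {a, b, c} = measure lborel (convex hull {a, b, c})"
    by (simp add: area_def measure_completion)
  also have "\<dots> = \<bar>area2 a b c\<bar> / 2"
    unfolding content_triangle area2_def by (simp add: abs_minus_commute mult.commute)
  finally show ?thesis .
qed

lemma area2_zero_scale:
  assumes "area2 0 v u = 0" "v \<noteq> 0" shows "\<exists>k. u = k *\<^sub>R v"
proof (cases "v$1 = 0")
  case True
  then have "v$2 \<noteq> 0" using assms by (auto simp: vec2_eq_iff)
  then have "u = (u$2 / v$2) *\<^sub>R v" using assms True by (auto simp: vec2_eq_iff area2_def)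
  then show ?thesis by blast
next
  case False
  then have "u = (u$1 / v$1) *\<^sub>R v" using assms by (auto simp: vec2_eq_iff area2_def field_simps)
  then show ?thesis by blast
qed

lemma collinear_area2: "collinear {a, b, c} \<longleftrightarrow> area2 a b c = 0"
proof
  assume "collinear {a, b, c}"
  then obtain u where "\<exists>s. b - a = s *\<^sub>R u" "\<exists>s. c - a = s *\<^sub>R u" by (auto simp: collinear_def)
  then obtain s t where s: "b - a = s *\<^sub>R u" and t: "c - a = t *\<^sub>R u" by blast
  have "area2 a b c = (b - a)$1 * (c - a)$2 - (b - a)$2 * (c - a)$1" by (simp add: area2_def)
  also have "\<dots> = 0" unfolding s t by simp
  finally show "area2 a b c = 0" .
next
  assume z: "area2 a b c = 0"
  show "collinear {a, b, c}"
  proof (cases "a = b")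
    case True then show ?thesis by (simp add: collinear_2)
  next
    case False
    have "area2 0 (b - a) (c - a) = 0" using z by (simp add: area2_def)
    then obtain k where "c - a = k *\<^sub>R (b - a)" using area2_zero_scale False by (metis eq_iff_diff_eq_0)
    then have c: "c = a + k *\<^sub>R (b - a)" by (simp add: algebra_simps)
    have "collinear {0, b - a, c - a}" by (simp add: collinear_lemma c)
    then show ?thesis using collinear_3[of b a c] by (simp add: insert_commute)
  qed
qed

lemma angle_le:
  assumes "b \<noteq> a" "c \<noteq> a"
  shows "vertex_angle a b c \<le> pi / 2 \<longleftrightarrow> apex_dot b c a \<ge> 0"
proof -
  define z where "z = ((b - a) \<bullet> (c - a)) / (norm (b - a) * norm (c - a))"
  have pos: "norm (b - a) * norm (c - a) > 0" using assms by simp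
  have "\<bar>(b - a) \<bullet> (c - a)\<bar> \<le> norm (b - a) * norm (c - a)" by (rule Cauchy_Schwarz_ineq2)
  then have "\<bar>z\<bar> \<le> 1" using pos unfolding z_def abs_divide by (simp add: divide_le_eq)
  then have "arccos z \<le> arccos 0 \<longleftrightarrow> 0 \<le> z" by (intro arccos_le_mono) auto
  moreover have "0 \<le> z \<longleftrightarrow> apex_dot b c a \<ge> 0" using pos unfolding z_def apex_dot_def by (simp add: zero_le_divide_iff)
  ultimately show ?thesis by (simp add: vertex_angle_def z_def)
qed

lemma nonobtuse_shift:
  assumes "nonobtuse D a b c" "z \<in> int_lattice" shows "nonobtuse D (a - z) (b - z) (c - z)"
  using assms by (auto simp: nonobtuse_def area2_shift_minus apex_dot_shift dist_norm int_lattice_diff)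

lemma feasible_nonobtuse:
  assumes g: "nonobtuse D a b c" and z: "0 \<in> {a, b, c}"
  shows "feasible_triangle D {a, b, c}"
proof -
  have pos: "area2 a b c > 0" and lat: "{a, b, c} \<subseteq> int_lattice" using g by (auto simp: nonobtuse_def)
  then have ne: "a \<noteq> b" "b \<noteq> c" "c \<noteq> a" by auto
  have angles: "vertex_angle a b c \<le> pi / 2" "vertex_angle a c b \<le> pi / 2" "vertex_angle b a c \<le> pi / 2"
     "vertex_angle b c a \<le> pi / 2" "vertex_angle c a b \<le> pi / 2" "vertex_angle c b a \<le> pi / 2"
  proof -
    have "apex_dot a b c \<ge> 0" "apex_dot b c a \<ge> 0" "apex_dot c a b \<ge> 0" using g by (auto simp: nonobtuse_def)
    moreover from this have "apex_dot b a c \<ge> 0" "apex_dot c b a \<ge> 0" "apex_dot a c b \<ge> 0" by (simp_all only: apex_dot_swap[of b a] apex_dot_swap[of c b] apex_dot_swap[of a c])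
    ultimately show "vertex_angle a b c \<le> pi / 2" "vertex_angle a c b \<le> pi / 2" "vertex_angle b a c \<le> pi / 2"
     "vertex_angle b c a \<le> pi / 2" "vertex_angle c a b \<le> pi / 2" "vertex_angle c b a \<le> pi / 2"
      using ne by (simp_all only: angle_le not_sym[OF ne(1)] not_sym[OF ne(2)] not_sym[OF ne(3)] not_False_eq_True)
  qed
  have "lattice_triangle {a, b, c}"
    using lat ne pos by (auto simp: lattice_triangle_def collinear_area2)
  moreover have "\<forall>x\<in>{a, b, c}. \<forall>y\<in>{a, b, c} - {x}. dist x y \<ge> D"
    using g by (auto simp: nonobtuse_def dist_commute)
  moreover have "\<forall>x\<in>{a, b, c}. \<forall>y\<in>{a, b, c} - {x}. \<forall>w\<in>{a, b, c} - {x, y}. vertex_angle x y w \<le> pi / 2"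
    using angles by auto
  ultimately show ?thesis using z unfolding feasible_triangle_def by blast
qed

lemma feasible_obtain:
  assumes "feasible_triangle D T"
  obtains a b c where "T = {a, b, c}" "nonobtuse D a b c"
proof -
  obtain a b c where T: "T = {a, b, c}" and ne: "a \<noteq> b" "b \<noteq> c" "c \<noteq> a"
    using assms by (auto simp: feasible_triangle_def lattice_triangle_def card_3_iff)
  have d: "\<And>x y. x \<in> T \<Longrightarrow> y \<in> T \<Longrightarrow> x \<noteq> y \<Longrightarrow> D \<le> dist x y"
    and an: "\<And>x y w. x \<in> T \<Longrightarrow> y \<in> T \<Longrightarrow> w \<in> T \<Longrightarrow> y \<noteq> x \<Longrightarrow> w \<noteq> x \<Longrightarrow> w \<noteq> y \<Longrightarrow> vertex_angle x y w \<le> pi / 2"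
    and lat: "T \<subseteq> int_lattice" and nc: "\<not> collinear T"
    using assms by (auto simp: feasible_triangle_def lattice_triangle_def)
  have nz: "area2 a b c \<noteq> 0" using nc T by (simp add: collinear_area2)
  have "apex_dot a b c \<ge> 0" "apex_dot b c a \<ge> 0" "apex_dot c a b \<ge> 0"
    using an[of c a b] an[of a b c] an[of b c a] ne angle_le[of a c b] angle_le[of b a c] angle_le[of c b a]
    unfolding T by blast+
  moreover have "D \<le> dist a b" "D \<le> dist b c" "D \<le> dist c a" using d ne by (auto simp: T)
  ultimately have g: "nonobtuse D a b c \<or> nonobtuse D b a c"
    using nz lat area2_swap[of a b c] by (auto simp: T nonobtuse_def apex_dot_swap dist_commute)
  then show thesis using that T by (metis insert_commute)
qed

lemma nonobtuse_area2_nat: "nonobtuse D a b c \<Longrightarrow> \<exists>n::nat. area2 a b c = real n"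
proof -
  assume g: "nonobtuse D a b c"
  then have "area2 a b c \<in> \<int>" unfolding nonobtuse_def area2_def
    by (intro Ints_diff Ints_mult) (auto simp: int_lattice_coord)
  moreover have "area2 a b c > 0" using g by (simp add: nonobtuse_def)
  ultimately show ?thesis by (metis Ints_cases of_int_0_less_iff of_nat_nat order_less_imp_le of_int_of_nat_eq)
qed

text \<open>Attainability provides half of a square of side \<open>D\<close>. This is what makes the value
  \<open>D\<^sup>2\<close> kept by the triangles of the discharging argument sufficient.\<close>
lemma attainable_square:
  assumes "attainable D"
  obtains a b c where "nonobtuse D a b c" "area2 a b c = D\<^sup>2"
proof -
  obtain m n :: int where D: "D > 0" "D\<^sup>2 = of_int (m\<^sup>2 + n\<^sup>2)" using assms by (auto simp: attainable_def)
  define b :: "real^2" where "b = vector [of_int m, of_int n]"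
  define c :: "real^2" where "c = vector [- of_int n, of_int m]"
  have co: "b$1 = of_int m" "b$2 = of_int n" "c$1 = - of_int n" "c$2 = of_int m"
    by (simp_all add: b_def c_def)
  have area2: "area2 0 b c = D\<^sup>2" unfolding D(2) by (simp add: area2_def co power2_eq_square)
  have "(dist 0 b)\<^sup>2 = D\<^sup>2" "(dist c 0)\<^sup>2 = D\<^sup>2" "(dist b c)\<^sup>2 = 2 * D\<^sup>2"
    unfolding dist_coord D(2) by (simp_all add: co power2_eq_square algebra_simps)
  then have "D\<^sup>2 \<le> (dist 0 b)\<^sup>2" "D\<^sup>2 \<le> (dist c 0)\<^sup>2" "D\<^sup>2 \<le> (dist b c)\<^sup>2" by simp_all
  then have "D \<le> dist 0 b" "D \<le> dist c 0" "D \<le> dist b c" by (auto intro: power2_le_imp_le)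
  moreover have "apex_dot 0 b c = D\<^sup>2" "apex_dot b c 0 = 0" "apex_dot c 0 b = D\<^sup>2"
    unfolding apex_dot_coord D(2) by (simp_all add: co power2_eq_square algebra_simps)
  moreover have "{0, b, c} \<subseteq> int_lattice" by (auto simp: int_lattice_coord co)
  ultimately have "nonobtuse D 0 b c" using D(1) area2 by (auto simp: nonobtuse_def)
  then show thesis using that area2 by blast
qed

text \<open>Doubled areas of lattice triangles are natural numbers, so the minimum is attained.\<close>
lemma S_min:
  assumes "attainable D"
  shows "\<exists>a b c. nonobtuse D a b c \<and> area2 a b c = S D" and "nonobtuse D a b c \<Longrightarrow> S D \<le> area2 a b c"
proof -
  define P where "P n \<longleftrightarrow> (\<exists>a b c. nonobtuse D a b c \<and> area2 a b c = real n)" for n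
  obtain a0 b0 c0 where "nonobtuse D a0 b0 c0" using attainable_square[OF assms] by metis
  then have ex: "\<exists>n. P n" using nonobtuse_area2_nat unfolding P_def by metis
  define m where "m = (LEAST n. P n)"
  have "P m" unfolding m_def using ex by (rule LeastI_ex)
  then obtain a1 b1 c1 where m1: "nonobtuse D a1 b1 c1" "area2 a1 b1 c1 = real m" by (auto simp: P_def)
  have min: "real m \<le> area2 a b c" if "nonobtuse D a b c" for a b c
  proof -
    obtain n where n: "area2 a b c = real n" using nonobtuse_area2_nat \<open>nonobtuse D a b c\<close> by blast
    then have "P n" using that by (auto simp: P_def)
    then show ?thesis using n by (simp add: m_def Least_le)
  qed
  have "(LEAST s. \<exists>T. feasible_triangle D T \<and> area T = s) = real m / 2"
  proof (rule Least_equality)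
    have "a1 \<in> int_lattice" using m1 by (simp add: nonobtuse_def)
    then have "nonobtuse D (a1 - a1) (b1 - a1) (c1 - a1)" using nonobtuse_shift m1 by blast
    moreover have "area {a1 - a1, b1 - a1, c1 - a1} = real m / 2" using m1 by (simp only: area_area2 area2_shift_minus)
    ultimately show "\<exists>T. feasible_triangle D T \<and> area T = real m / 2"
      using feasible_nonobtuse by (metis diff_self insertI1)
  next
    fix s assume "\<exists>T. feasible_triangle D T \<and> area T = s"
    then obtain T where "feasible_triangle D T" and s: "area T = s" by blast
    then obtain a b c where "T = {a, b, c}" "nonobtuse D a b c" using feasible_obtain by metis
    then show "real m / 2 \<le> s" using min[of a b c] s by (simp add: area_area2)
  qed
  then have "S D = real m" by (simp add: S_def)
  then show "\<exists>a b c. nonobtuse D a b c \<and> area2 a b c = S D" and "nonobtuse D a b c \<Longrightarrow> S D \<le> area2 a b c"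
    using m1 min by auto
qed

lemma S_le: "attainable D \<Longrightarrow> S D \<le> D\<^sup>2"
  using attainable_square S_min(2) by metis

lemma M_triangle_nonobtuse:
  assumes D: "attainable D" and g: "nonobtuse D a b c" "area2 a b c = S D" and z: "z \<in> {a, b, c}"
  shows "M_triangle D {a - z, b - z, c - z}"
  unfolding M_triangle_def is_arg_min_def
proof (intro conjI notI)
  have "z \<in> int_lattice" using g z by (auto simp: nonobtuse_def)
  then have g': "nonobtuse D (a - z) (b - z) (c - z)" using nonobtuse_shift g by blast
  then show "feasible_triangle D {a - z, b - z, c - z}" using z by (intro feasible_nonobtuse) auto
  assume "\<exists>T. feasible_triangle D T \<and> area T < area {a - z, b - z, c - z}"
  then obtain T where T: "feasible_triangle D T" "area T < area {a - z, b - z, c - z}" by blast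
  then obtain a' b' c' where "T = {a', b', c'}" "nonobtuse D a' b' c'" using feasible_obtain by metis
  then show False using T S_min(2)[OF D, of a' b' c'] g by (auto simp: area_area2 area2_shift_minus nonobtuse_def)
qed

section \<open>Max-dense sub-lattices\<close>

text \<open>In Selling's form the squared length is a sum of three integral squares with nonnegative weights. At least two
  of the squares are nonzero, and the sum of any two weights is the square of a side.\<close>
lemma sublattice_norm:
  assumes g: "nonobtuse D a b c" and ij: "i \<noteq> 0 \<or> j \<noteq> 0"
  shows "D \<le> norm (of_int i *\<^sub>R (b - a) + of_int j *\<^sub>R (c - a))"
proof -
  define X Y Z where "X = apex_dot b c a" and "Y = apex_dot c a b" and "Z = apex_dot a b c"
  have nn: "X \<ge> 0" "Y \<ge> 0" "Z \<ge> 0" using g by (auto simp: nonobtuse_def X_def Y_def Z_def)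
  let ?w = "of_int i *\<^sub>R (b - a) + of_int j *\<^sub>R (c - a)"
  define I J where "I = (of_int i :: real)" and "J = (of_int j :: real)"
  have Q: "(norm ?w)\<^sup>2 = X * (I + J)\<^sup>2 + Y * I\<^sup>2 + Z * J\<^sup>2"
  proof -
    have "(norm ?w)\<^sup>2 = (?w$1)\<^sup>2 + (?w$2)\<^sup>2"
      unfolding power2_norm_eq_inner by (simp add: inner_vec_def sum_2 power2_eq_square)
    also have "\<dots> = (I * (b$1 - a$1) + J * (c$1 - a$1))\<^sup>2 + (I * (b$2 - a$2) + J * (c$2 - a$2))\<^sup>2"
      by (simp add: I_def J_def)
    also have "\<dots> = X * (I + J)\<^sup>2 + Y * I\<^sup>2 + Z * J\<^sup>2"
      unfolding X_def Y_def Z_def apex_dot_coord by algebra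
    finally show ?thesis .
  qed
  have sides: "X + Y = (dist a b)\<^sup>2" "Y + Z = (dist b c)\<^sup>2" "Z + X = (dist c a)\<^sup>2"
    unfolding X_def Y_def Z_def apex_dot_coord dist_coord by algebra+
  show ?thesis
  proof (cases "D \<le> 0")
    case True then show ?thesis using norm_ge_zero order_trans by blast
  next
    case False
    then have D: "X + Y \<ge> D\<^sup>2" "Y + Z \<ge> D\<^sup>2" "Z + X \<ge> D\<^sup>2"
      unfolding sides using g by (auto simp: nonobtuse_def intro!: power_mono)
    have ge_one: "1 \<le> (of_int k :: real)\<^sup>2" if "k \<noteq> 0" for k :: int
    proof -
      have "1 \<le> \<bar>of_int k :: real\<bar>" using that by linarith
      then show ?thesis by (simp add: abs_le_square_iff[symmetric, of 1, simplified])
    qed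
    have m: "0 \<le> X * (I + J)\<^sup>2" "0 \<le> Y * I\<^sup>2" "0 \<le> Z * J\<^sup>2" using nn by simp_all
    have x: "i + j \<noteq> 0 \<Longrightarrow> X \<le> X * (I + J)\<^sup>2"
      using ge_one[of "i + j"] mult_left_mono[OF _ nn(1), of 1 "(I + J)\<^sup>2"] by (simp add: I_def J_def)
    have y: "i \<noteq> 0 \<Longrightarrow> Y \<le> Y * I\<^sup>2"
      using ge_one[of i] mult_left_mono[OF _ nn(2), of 1 "I\<^sup>2"] by (simp add: I_def)
    have z: "j \<noteq> 0 \<Longrightarrow> Z \<le> Z * J\<^sup>2"
      using ge_one[of j] mult_left_mono[OF _ nn(3), of 1 "J\<^sup>2"] by (simp add: J_def)
    have "i \<noteq> 0 \<and> j \<noteq> 0 \<or> i \<noteq> 0 \<and> i + j \<noteq> 0 \<or> j \<noteq> 0 \<and> i + j \<noteq> 0" using ij by auto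
    then have "D\<^sup>2 \<le> (norm ?w)\<^sup>2" unfolding Q using x y z m D by linarith
    then show ?thesis by (rule power2_le_imp_le) simp
  qed
qed

lemma sublattice_diff:
  assumes "x \<in> sublattice_gen u v" "y \<in> sublattice_gen u v"
  obtains i j where "x - y = of_int i *\<^sub>R u + of_int j *\<^sub>R v"
proof -
  obtain i j i' j' where "x = of_int i *\<^sub>R u + of_int j *\<^sub>R v" "y = of_int i' *\<^sub>R u + of_int j' *\<^sub>R v"
    using assms by (auto simp: sublattice_gen_def)
  then have "x - y = of_int (i - i') *\<^sub>R u + of_int (j - j') *\<^sub>R v" by (simp add: algebra_simps)
  then show thesis using that by blast
qed

lemma sublattice_admissible:
  assumes g: "nonobtuse D a b c"
  shows "admissible D (sublattice_gen (b - a) (c - a))"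
proof -
  have "sublattice_gen (b - a) (c - a) \<subseteq> int_lattice"
    using g by (auto simp: sublattice_gen_def nonobtuse_def intro!: int_lattice_add int_lattice_scale int_lattice_diff)
  moreover have "D \<le> dist x y" if x: "x \<in> sublattice_gen (b - a) (c - a)" "y \<in> sublattice_gen (b - a) (c - a)" "x \<noteq> y" for x y
  proof -
    obtain i j where w: "x - y = of_int i *\<^sub>R (b - a) + of_int j *\<^sub>R (c - a)"
      using sublattice_diff x by metis
    have "i \<noteq> 0 \<or> j \<noteq> 0" using w x(3) by auto
    from sublattice_norm[OF g this] show ?thesis by (simp add: dist_norm w)
  qed
  ultimately show ?thesis by (auto simp: admissible_def)
qed

lemma independent_area2: "u \<noteq> v \<Longrightarrow> independent {u, v} \<longleftrightarrow> area2 0 u v \<noteq> 0"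
proof -
  assume ne: "u \<noteq> v"
  have "u \<in> span {v} \<longleftrightarrow> (\<exists>k. u = k *\<^sub>R v)" by (auto simp: span_singleton)
  then have ind: "independent {u, v} \<longleftrightarrow> v \<noteq> 0 \<and> \<not> (\<exists>k. u = k *\<^sub>R v)"
    using ne by (simp add: independent_insert)
  have "area2 0 v u = - area2 0 u v" by (simp add: area2_def)
  then show ?thesis unfolding ind using area2_zero_scale[of v u] by (cases "v = 0") (auto simp: area2_def mult.commute)
qed

lemma parallelogram_measure:
  "fundamental_parallelogram u v \<in> lmeasurable"
  "measure lebesgue (fundamental_parallelogram u v) = \<bar>area2 0 u v\<bar>"
proof -
  define h :: "real^2 \<Rightarrow> real^2" where "h x = x$1 *\<^sub>R u + x$2 *\<^sub>R v" for x
  have lin: "linear h" by (rule linearI) (simp_all add: h_def algebra_simps)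
  have "fundamental_parallelogram u v = h ` cbox 0 1"
  proof (intro equalityI subsetI)
    fix x assume "x \<in> fundamental_parallelogram u v"
    then obtain s t where st: "s \<in> {0..1}" "t \<in> {0..1}" "x = s *\<^sub>R u + t *\<^sub>R v"
      by (auto simp: fundamental_parallelogram_def)
    then have "x = h (vector [s, t])" "vector [s, t] \<in> cbox (0 :: real^2) 1"
      by (simp_all add: h_def mem_box_cart forall_2)
    then show "x \<in> h ` cbox 0 1" by blast
  next
    fix x assume "x \<in> h ` cbox 0 1"
    then show "x \<in> fundamental_parallelogram u v"
      unfolding fundamental_parallelogram_def h_def by (auto simp: mem_box_cart) blast
  qed
  moreover have "measure lebesgue (h ` cbox 0 1) = \<bar>det (matrix h)\<bar> * measure lebesgue (cbox 0 (1 :: real^2))"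
    by (rule measure_linear_image[OF lin]) simp
  moreover have "h ` cbox 0 1 \<in> lmeasurable"
    by (rule measurable_linear_image[OF lin]) simp
  moreover have "det (matrix h) = area2 0 u v"
    by (simp add: det_2 matrix_def h_def area2_def axis_def)
  moreover have "measure lebesgue (cbox 0 (1 :: real^2)) = 1"
    by (simp add: content_cbox_if_cart interval_eq_empty_cart)
  ultimately show "fundamental_parallelogram u v \<in> lmeasurable"
    "measure lebesgue (fundamental_parallelogram u v) = \<bar>area2 0 u v\<bar>" by simp_all
qed

lemma max_dense:
  assumes D: "attainable D" and g: "nonobtuse D a b c" "area2 a b c = S D"
  shows "max_dense_sublattice D (sublattice_gen (b - a) (c - a))"
proof -
  have d: "area2 0 (b - a) (c - a) = area2 a b c" by (simp add: area2_def)
  have pos: "area2 a b c > 0" using g by (simp add: nonobtuse_def)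
  then have ne: "b - a \<noteq> c - a" by auto
  have "{a, b, c} \<subseteq> int_lattice" using g by (simp add: nonobtuse_def)
  then have "b - a \<in> int_lattice" "c - a \<in> int_lattice" by (simp_all add: int_lattice_diff)
  moreover have "independent {b - a, c - a}" using independent_area2[OF ne] d pos by simp
  moreover have "measure lebesgue (fundamental_parallelogram (b - a) (c - a)) = S D"
    using parallelogram_measure(2) d pos g by simp
  ultimately show ?thesis
    unfolding max_dense_sublattice_def using ne sublattice_admissible[OF g(1)] by blast
qed

section \<open>Periodic configurations\<close>

definition square_cell :: "real \<Rightarrow> (real^2) set" where
  "square_cell K = {x. 0 \<le> x$1 \<and> x$1 < K \<and> 0 \<le> x$2 \<and> x$2 < K}"

abbreviation square_lattice :: "nat \<Rightarrow> (real^2) set" where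
  "square_lattice n \<equiv> sublattice_gen (vector [real n, 0]) (vector [0, real n])"

lemma mem_square_lattice:
  "l \<in> square_lattice n \<longleftrightarrow> (\<exists>i j :: int. l = vector [of_int i * real n, of_int j * real n])"
  by (simp add: sublattice_gen_def vec2_eq_iff)

lemma torus_square: "n > 0 \<Longrightarrow> torus (vector [real n, 0]) (vector [0, real n])"
  by unfold_locales (auto simp: int_lattice_coord area2_def)

lemma finite_square_cell: "\<phi> \<subseteq> int_lattice \<Longrightarrow> finite (\<phi> \<inter> square_cell K)"
proof (rule finite_int_lattice_bounded)
  have "square_cell K \<subseteq> cbox (vector [0, 0]) (vector [K, K])"
    by (auto simp: square_cell_def mem_box_cart forall_2)
  then show "bounded (\<phi> \<inter> square_cell K)" by (meson bounded_cbox bounded_subset inf.cobounded2)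
qed auto

definition translation_invariant :: "(real^2) set \<Rightarrow> (real^2) set \<Rightarrow> bool" where
  "translation_invariant \<Lambda> \<phi> \<longleftrightarrow> (\<forall>l\<in>\<Lambda>. \<forall>x\<in>\<phi>. x + l \<in> \<phi>)"

text \<open>Reduction of both coordinates modulo \<open>n\<close>.\<close>
lemma cell_decomposition:
  assumes n: "n > 0" and inv: "translation_invariant (square_lattice n) \<phi>"
  shows "\<phi> = {v + l | v l. v \<in> \<phi> \<inter> square_cell (real n) \<and> l \<in> square_lattice n}"
proof (intro equalityI subsetI)
  fix x assume x: "x \<in> \<phi>"
  define i j where "i = \<lfloor>x$1 / real n\<rfloor>" and "j = \<lfloor>x$2 / real n\<rfloor>"
  have np: "real n > 0" using n by simp
  have "of_int i \<le> x$1 / real n" "x$1 / real n < of_int i + 1"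
     "of_int j \<le> x$2 / real n" "x$2 / real n < of_int j + 1"
    unfolding i_def j_def by linarith+
  then have b: "of_int i * real n \<le> x$1" "x$1 < of_int i * real n + real n"
     "of_int j * real n \<le> x$2" "x$2 < of_int j * real n + real n"
    using np by (simp_all add: field_simps)
  let ?v = "x + vector [of_int (- i) * real n, of_int (- j) * real n]"
  have "vector [of_int (- i) * real n, of_int (- j) * real n] \<in> square_lattice n"
    unfolding mem_square_lattice by blast
  then have "?v \<in> \<phi>" using inv x unfolding translation_invariant_def by blast
  moreover have "?v \<in> square_cell (real n)" using b by (simp add: square_cell_def)
  moreover have "x = ?v + vector [of_int i * real n, of_int j * real n]" by (simp add: vec2_eq_iff)
  ultimately show "x \<in> {v + l | v l. v \<in> \<phi> \<inter> square_cell (real n) \<and> l \<in> square_lattice n}"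
    unfolding mem_square_lattice by blast
next
  fix x assume "x \<in> {v + l | v l. v \<in> \<phi> \<inter> square_cell (real n) \<and> l \<in> square_lattice n}"
  then show "x \<in> \<phi>" using inv unfolding translation_invariant_def by blast
qed

lemma cell_inequivalent:
  assumes "x \<in> square_cell (real n)" "y \<in> square_cell (real n)" "x - y \<in> square_lattice n"
  shows "x = y"
proof -
  obtain i j where ij: "x - y = vector [of_int i * real n, of_int j * real n]"
    using assms(3) by (auto simp: mem_square_lattice)
  have c: "x$1 - y$1 = of_int i * real n" "x$2 - y$2 = of_int j * real n"
    using arg_cong[OF ij, of "\<lambda>v. v$1"] arg_cong[OF ij, of "\<lambda>v. v$2"] by simp_all
  have z: "k = 0" if "\<bar>of_int k * real n\<bar> < real n" for k :: int
  proof (rule ccontr)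
    assume "k \<noteq> 0"
    then have "1 \<le> \<bar>of_int k :: real\<bar>" by linarith
    then have "1 * real n \<le> \<bar>of_int k\<bar> * real n" by (intro mult_right_mono) auto
    then show False using that by (simp add: abs_mult)
  qed
  have "\<bar>x$1 - y$1\<bar> < real n" "\<bar>x$2 - y$2\<bar> < real n" using assms(1,2) by (auto simp: square_cell_def)
  then have "i = 0" "j = 0" using z unfolding c by auto
  then show ?thesis using c by (simp add: vec2_eq_iff)
qed

lemma card_large_square:
  assumes n: "n > 0" and inv: "translation_invariant (square_lattice n) \<phi>" and \<phi>: "\<phi> \<subseteq> int_lattice"
  shows "card (\<phi> \<inter> square_cell (real (k * n))) \<le> k\<^sup>2 * card (\<phi> \<inter> square_cell (real n))"
proof -
  let ?V = "\<phi> \<inter> square_cell (real n)"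
  let ?A = "?V \<times> {0..<int k} \<times> {0..<int k}"
  let ?g = "\<lambda>(v, i, j). v + vector [of_int i * real n, of_int j * real n] :: real^2"
  have "\<phi> \<inter> square_cell (real (k * n)) \<subseteq> ?g ` ?A"
  proof
    fix x assume x: "x \<in> \<phi> \<inter> square_cell (real (k * n))"
    then obtain v i j where v: "v \<in> ?V" and xv: "x = v + vector [of_int i * real n, of_int j * real n]"
      using cell_decomposition[OF n inv] unfolding mem_square_lattice by blast
    have rng: "m \<in> {0..<int k}"
      if m: "0 \<le> c + of_int m * real n" "c + of_int m * real n < real (k * n)" "0 \<le> c" "c < real n" for m c
    proof -
      have np: "real n > 0" using n by simp
      have "0 < (of_int m + 1) * real n" using m by (simp add: algebra_simps)
      then have "(0::real) < of_int m + 1" using np by (simp add: zero_less_mult_iff)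
      moreover have "of_int m * real n < real k * real n" using m unfolding of_nat_mult by linarith
      then have "of_int m < real k" using np by (simp only: mult_less_cancel_right_pos)
      ultimately show ?thesis by auto
    qed
    have "i \<in> {0..<int k}" "j \<in> {0..<int k}"
      using x v rng[of "v$1" i] rng[of "v$2" j] by (auto simp: square_cell_def xv)
    then show "x \<in> ?g ` ?A" using v xv by (intro image_eqI[of _ _ "(v, i, j)"]) auto
  qed
  then have "card (\<phi> \<inter> square_cell (real (k * n))) \<le> card (?g ` ?A)"
    by (intro card_mono finite_imageI finite_cartesian_product finite_square_cell \<phi>) auto
  also have "\<dots> \<le> card ?A"
    by (intro card_image_le finite_cartesian_product finite_square_cell \<phi>) auto
  also have "\<dots> = k\<^sup>2 * card ?V" by (simp add: card_cartesian_product power2_eq_square)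
  finally show ?thesis .
qed

text \<open>For \<open>d\<close> the determinant of the two periods, Cramer's rule writes \<open>d\<close> times any
  lattice vector as an integral combination of them.\<close>
lemma periodic_square:
  assumes per: "periodic \<phi>" and \<phi>: "\<phi> \<subseteq> int_lattice"
  obtains n where "n > 0" "translation_invariant (square_lattice n) \<phi>"
proof -
  obtain e1 e2 where e: "e1 \<in> int_lattice" "e2 \<in> int_lattice" "e1 \<noteq> e2" "independent {e1, e2}"
    and p1: "\<And>x. x \<in> int_lattice \<Longrightarrow> x \<in> \<phi> \<longleftrightarrow> x + e1 \<in> \<phi>"
    and p2: "\<And>x. x \<in> int_lattice \<Longrightarrow> x \<in> \<phi> \<longleftrightarrow> x + e2 \<in> \<phi>"
    using per unfolding periodic_def by blast
  have mult: "x + of_int i *\<^sub>R w \<in> \<phi>"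
    if x: "x \<in> \<phi>" and w: "w \<in> int_lattice" "\<And>x. x \<in> int_lattice \<Longrightarrow> x \<in> \<phi> \<longleftrightarrow> x + w \<in> \<phi>" for x w i
  proof (induction i rule: int_induct[where k = 0])
    case base then show ?case using x by simp
  next
    case (step1 i)
    then have "x + of_int i *\<^sub>R w + w \<in> \<phi>" using w(2) \<phi> by blast
    then show ?case by (simp add: algebra_simps)
  next
    case (step2 i)
    have "x + of_int (i - 1) *\<^sub>R w + w = x + of_int i *\<^sub>R w" by (simp add: algebra_simps)
    moreover have "x + of_int (i - 1) *\<^sub>R w \<in> int_lattice"
      by (intro int_lattice_add int_lattice_scale w(1)) (use x \<phi> in auto)
    ultimately show ?case using w(2) step2 by metis
  qed
  have comb: "x + (of_int i *\<^sub>R e1 + of_int j *\<^sub>R e2) \<in> \<phi>" if "x \<in> \<phi>" for x i j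
    using mult[OF mult[OF that e(1) p1] e(2) p2] by (simp add: add.assoc)
  have "area2 0 e1 e2 \<in> \<int>" unfolding area2_def
    by (intro Ints_diff Ints_mult) (use e in \<open>auto simp: int_lattice_coord\<close>)
  then obtain d where d: "area2 0 e1 e2 = of_int d" by (auto elim: Ints_cases)
  have "d \<noteq> 0" using independent_area2[OF e(3)] e(4) d by auto
  obtain x1 y1 x2 y2 where c: "e1$1 = of_int x1" "e1$2 = of_int y1" "e2$1 = of_int x2" "e2$2 = of_int y2"
    using e(1,2) unfolding int_lattice_coord by (metis Ints_cases)
  have d': "d = x1 * y2 - y1 * x2"
  proof -
    have "real_of_int d = of_int (x1 * y2 - y1 * x2)" using d by (simp add: area2_def c)
    then show ?thesis by (simp only: of_int_eq_iff)
  qed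
  define s where "s = sgn d"
  have sd: "s * d = int (nat \<bar>d\<bar>)" by (simp add: s_def sgn_if)
  have "translation_invariant (square_lattice (nat \<bar>d\<bar>)) \<phi>"
    unfolding translation_invariant_def
  proof (intro ballI)
    fix l x assume l: "l \<in> square_lattice (nat \<bar>d\<bar>)" and x: "x \<in> \<phi>"
    obtain i j where l: "l = vector [of_int i * real (nat \<bar>d\<bar>), of_int j * real (nat \<bar>d\<bar>)]"
      using l mem_square_lattice by blast
    have r: "real (nat \<bar>d\<bar>) = of_int s * of_int d" using sd by (metis of_int_mult of_int_of_nat_eq)
    have "l = of_int (i * s * y2 - j * s * x2) *\<^sub>R e1 + of_int (j * s * x1 - i * s * y1) *\<^sub>R e2"
      unfolding l r unfolding d' by (simp add: vec2_eq_iff c algebra_simps)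
    then show "x + l \<in> \<phi>" using comb[OF x] by metis
  qed
  then show thesis using that[of "nat \<bar>d\<bar>"] \<open>d \<noteq> 0\<close> by simp
qed

section \<open>Density of ground states\<close>

text \<open>Each point of the smaller square lies in the translate of the fundamental parallelogram at a lattice point of
  the larger one. The two sides of the boundary where coordinates reach their maximum form a null set.\<close>
lemma sublattice_count:
  fixes u v :: "real^2"
  assumes d: "area2 0 u v > 0" and uv: "u \<in> int_lattice" "v \<in> int_lattice"
    and r: "0 \<le> r" and K: "2 * (r + norm u + norm v) \<le> K"
  shows "(K - 2 * (r + norm u + norm v))\<^sup>2 \<le>
    card (sublattice_gen u v \<inter> {x. r \<le> x$1 \<and> x$1 < K - r \<and> r \<le> x$2 \<and> x$2 < K - r}) * area2 0 u v"
    (is "_ \<le> real (card ?G) * _")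
proof -
  define M where "M = r + norm u + norm v"
  have Lat: "sublattice_gen u v \<subseteq> int_lattice"
    using uv by (auto simp: sublattice_gen_def intro!: int_lattice_add int_lattice_scale)
  have "?G \<subseteq> sublattice_gen u v \<inter> square_cell K" using r by (auto simp: square_cell_def)
  then have finG: "finite ?G" using finite_square_cell[OF Lat] finite_subset by blast
  let ?P = "fundamental_parallelogram u v"
  let ?B = "cbox (vector [M, M]) (vector [K - M, K - M]) :: (real^2) set"
  have cover: "\<exists>p\<in>?G. x - p \<in> ?P" if x: "x \<in> ?B - {y. y$1 = K - M \<or> y$2 = K - M}" for x
  proof -
    define s t where "s = area2 0 x v / area2 0 u v" and "t = area2 0 u x / area2 0 u v"
    have xst: "x = s *\<^sub>R u + t *\<^sub>R v"
    proof -
      have "area2 0 u v * x$1 = area2 0 x v * u$1 + area2 0 u x * v$1" "area2 0 u v * x$2 = area2 0 x v * u$2 + area2 0 u x * v$2"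
        unfolding area2_def zero_index by algebra+
      then show ?thesis using d by (simp add: vec2_eq_iff s_def t_def field_simps)
    qed
    define p where "p = of_int \<lfloor>s\<rfloor> *\<^sub>R u + of_int \<lfloor>t\<rfloor> *\<^sub>R v"
    have diff: "x - p = frac s *\<^sub>R u + frac t *\<^sub>R v"
      by (simp add: xst p_def frac_def algebra_simps)
    have fr: "0 \<le> frac s" "frac s \<le> 1" "0 \<le> frac t" "frac t \<le> 1"
      using frac_lt_1[of s] frac_lt_1[of t] by (auto intro: less_imp_le)
    have "\<exists>s t. x - p = s *\<^sub>R u + t *\<^sub>R v \<and> s \<in> {0..1} \<and> t \<in> {0..1}"
      using diff fr by (intro exI[of _ "frac s"] exI[of _ "frac t"]) auto
    then have inP: "x - p \<in> ?P" unfolding fundamental_parallelogram_def by blast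
    have "norm (x - p) \<le> norm u + norm v"
    proof -
      have "norm (x - p) \<le> frac s * norm u + frac t * norm v"
        unfolding diff using norm_triangle_ineq[of "frac s *\<^sub>R u" "frac t *\<^sub>R v"] fr by simp
      also have "\<dots> \<le> 1 * norm u + 1 * norm v" using fr by (intro add_mono mult_right_mono) auto
      finally show ?thesis by simp
    qed
    then have "\<bar>x$1 - p$1\<bar> \<le> norm u + norm v" "\<bar>x$2 - p$2\<bar> \<le> norm u + norm v"
      using component_le_norm_cart[of "x - p" 1] component_le_norm_cart[of "x - p" 2] by simp_all
    moreover have "M \<le> x$1" "x$1 < K - M" "M \<le> x$2" "x$2 < K - M"
      using x by (auto simp: mem_box_cart forall_2)
    ultimately have "p \<in> ?G" by (auto simp: M_def p_def sublattice_gen_def abs_le_iff)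
    with inP show ?thesis by blast
  qed
  let ?C = "\<Union>p\<in>?G. (\<lambda>y. p + y) ` ?P"
  let ?N = "{y :: real^2. y$1 = K - M \<or> y$2 = K - M}"
  have mC: "(\<lambda>y. p + y) ` ?P \<in> lmeasurable" for p
    using parallelogram_measure(1) by (rule measurable_translation)
  then have mU: "?C \<in> lmeasurable" by (intro fmeasurable.finite_UN finG) auto
  have neg: "negligible ?N"
  proof -
    have "?N = {y. axis 1 1 \<bullet> y = K - M} \<union> {y. axis 2 1 \<bullet> y = K - M}"
      by (auto simp: inner_axis')
    then show ?thesis by (auto intro!: negligible_Un negligible_hyperplane)
  qed
  have "?B \<subseteq> ?C \<union> ?N" using cover by force
  then have "measure lebesgue ?B \<le> measure lebesgue (?C \<union> ?N)"
    by (intro measure_mono_fmeasurable) (use mU neg in \<open>auto intro: fmeasurable.Un negligible_imp_measurable\<close>)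
  also have "\<dots> \<le> measure lebesgue ?C + measure lebesgue ?N"
    by (intro measure_Un_le) (use mU neg in \<open>auto intro: negligible_imp_sets fmeasurableD\<close>)
  also have "measure lebesgue ?N = 0" using neg by (rule negligible_imp_measure0)
  also have "measure lebesgue ?C \<le> (\<Sum>p\<in>?G. measure lebesgue ((\<lambda>y. p + y) ` ?P))"
    by (intro measure_UNION_le finG) (use mC in \<open>auto intro: fmeasurableD\<close>)
  also have "\<dots> = (\<Sum>p\<in>?G. area2 0 u v)"
    using d by (simp add: measure_translation parallelogram_measure(2))
  also have "\<dots> = card ?G * area2 0 u v" by simp
  finally have le: "measure lebesgue ?B \<le> card ?G * area2 0 u v" by simp
  have "measure lebesgue ?B = (K - 2 * M)\<^sup>2"
  proof -
    have "vector [M, M] \<in> ?B" using K by (simp add: mem_box_cart forall_2 M_def)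
    then have "?B \<noteq> {}" by blast
    then show ?thesis by (simp add: content_cbox_if_cart UNIV_2 power2_eq_square)
  qed
  with le show ?thesis by (simp add: M_def)
qed

text \<open>If the density were below that of the sub-lattice spanned by a minimal triangle, then in a large square all
  sites could be replaced by points of that sub-lattice. Keeping distance \<open>D\<close> from the boundary costs a
  number of sites proportional to the side only.\<close>
lemma ground_state_density:
  assumes D: "attainable D" and gs: "ground_state D \<phi>" and n: "n > 0"
    and inv: "translation_invariant (square_lattice n) \<phi>"
  shows "(real n)\<^sup>2 \<le> card (\<phi> \<inter> square_cell (real n)) * S D"
proof (rule ccontr)
  let ?N = "card (\<phi> \<inter> square_cell (real n))"
  assume less: "\<not> (real n)\<^sup>2 \<le> ?N * S D"
  have Dpos: "D > 0" using D by (simp add: attainable_def)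
  have adm: "admissible D \<phi>" and \<phi>: "\<phi> \<subseteq> int_lattice" using gs by (auto simp: ground_state_def admissible_def)
  obtain a b c where g: "nonobtuse D a b c" and area2: "area2 a b c = S D" using S_min(1)[OF D] by blast
  define u v where "u = b - a" and "v = c - a"
  have duv: "area2 0 u v = S D" using area2 by (simp add: u_def v_def area2_def)
  have Spos: "S D > 0" using g area2 by (auto simp: nonobtuse_def)
  have uv: "u \<in> int_lattice" "v \<in> int_lattice" using g by (auto simp: u_def v_def nonobtuse_def int_lattice_diff)
  define M where "M = D + norm u + norm v"
  have Mpos: "M > 0" using Dpos by (simp add: M_def add_pos_nonneg)
  define \<delta> where "\<delta> = (real n)\<^sup>2 - ?N * S D"
  have \<delta>: "\<delta> > 0" using less by (simp add: \<delta>_def)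
  obtain k :: nat where k: "real k > max (2 * M) (4 * M * real n / \<delta>)" using reals_Archimedean2 by blast
  have k1: "real k * \<delta> > 4 * M * real n" using k \<delta> by (simp add: divide_less_eq)
  have kpos: "real k > 0" using k Mpos by simp
  define K where "K = real (k * n)"
  have "real k * 1 \<le> real k * real n" using n by (intro mult_left_mono) auto
  then have KM: "2 * M \<le> K" using k by (simp add: K_def)
  define L where "L = sublattice_gen u v"
  define G where "G = L \<inter> {x. D \<le> x$1 \<and> x$1 < K - D \<and> D \<le> x$2 \<and> x$2 < K - D}"
  define H where "H = \<phi> \<inter> square_cell K"
  have admL: "admissible D L" unfolding L_def u_def v_def by (rule sublattice_admissible[OF g])
  have GK: "G \<subseteq> square_cell K" using Dpos by (auto simp: G_def square_cell_def)
  have Llat: "L \<subseteq> int_lattice" using admL by (simp add: admissible_def)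
  have "finite (L \<inter> square_cell K)" using Llat by (rule finite_square_cell)
  moreover have "G \<subseteq> L \<inter> square_cell K" using GK by (auto simp: G_def)
  ultimately have fG: "finite G" by (rule rev_finite_subset)
  have fH: "finite H" unfolding H_def using \<phi> by (rule finite_square_cell)
  have "(K - 2 * M)\<^sup>2 \<le> card G * S D"
    using sublattice_count[of u v D K] uv duv Spos Dpos KM unfolding G_def L_def M_def by simp
  moreover have "real (card H) \<le> (real k)\<^sup>2 * ?N"
    using card_large_square[OF n inv \<phi>, of k] unfolding H_def K_def
    by (metis of_nat_le_iff of_nat_mult of_nat_power)
  then have "card H * S D \<le> (real k)\<^sup>2 * ?N * S D" using Spos by (intro mult_right_mono) auto
  moreover have "(real k)\<^sup>2 * ?N * S D < (K - 2 * M)\<^sup>2"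
  proof -
    have "real k * (real k * \<delta>) > real k * (4 * M * real n)" using k1 kpos by simp
    then have "(real k)\<^sup>2 * ?N * S D < K\<^sup>2 - 4 * M * K"
      by (simp add: \<delta>_def K_def power2_eq_square algebra_simps)
    also have "\<dots> \<le> (K - 2 * M)\<^sup>2" by (simp add: power2_eq_square algebra_simps)
    finally show ?thesis .
  qed
  ultimately have "card H * S D < card G * S D" by linarith
  then have card: "card H < card G" using Spos by simp
  have far: "D \<le> dist x y" if x: "x \<in> \<phi> - H" and y: "y \<in> G" for x y
  proof -
    have "x \<notin> square_cell K" using x by (auto simp: H_def)
    then have "D \<le> \<bar>x$1 - y$1\<bar> \<or> D \<le> \<bar>x$2 - y$2\<bar>" using y by (auto simp: square_cell_def G_def)
    then show ?thesis
      using component_le_norm_cart[of "x - y" 1] component_le_norm_cart[of "x - y" 2] by (auto simp: dist_norm)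
  qed
  have "admissible D ((\<phi> - H) \<union> G)"
    unfolding admissible_def
  proof (intro conjI ballI impI)
    show "\<phi> - H \<union> G \<subseteq> int_lattice" using \<phi> Llat by (auto simp: G_def)
    fix x y assume "x \<in> \<phi> - H \<union> G" "y \<in> \<phi> - H \<union> G" "x \<noteq> y"
    then consider "x \<in> \<phi>" "y \<in> \<phi>" | "x \<in> L" "y \<in> L" | "x \<in> \<phi> - H" "y \<in> G" | "y \<in> \<phi> - H" "x \<in> G"
      by (auto simp: G_def)
    then show "D \<le> dist x y"
    proof cases
      case 1 then show ?thesis using adm \<open>x \<noteq> y\<close> by (auto simp: admissible_def)
    next
      case 2 then show ?thesis using admL \<open>x \<noteq> y\<close> by (auto simp: admissible_def)
    next
      case 3 then show ?thesis by (rule far)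
    next
      case 4 then show ?thesis using far[of y x] by (simp add: dist_commute)
    qed
  qed
  moreover have "H \<subseteq> \<phi>" "G \<inter> (\<phi> - H) = {}" using GK by (auto simp: H_def)
  ultimately show False using gs fG fH card unfolding ground_state_def by blast
qed

section \<open>Tessellations by minimal triangles\<close>

context torus
begin

lemma flag_interior:
  assumes F: "triangulation F" and fl: "flag F a b c" and x: "generic x" "x \<in> convex hull {a, b, c}"
  shows "inside (a, b, c) x"
proof -
  have pos: "area2 a b c > 0" and lat: "a \<in> int_lattice" "b \<in> int_lattice" "c \<in> int_lattice"
    using flag_proper[OF F fl] by (auto simp: proper_def)
  then have ne: "a \<noteq> b" "b \<noteq> c" "c \<noteq> a" by auto
  show ?thesis
    using x(2) generic_area2[OF x(1)] lat ne unfolding triangle_hull_iff[OF pos] inside.simps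
    by (metis order_le_less)
qed

lemma tessellation:
  assumes D: "attainable D" and F: "triangulation F"
    and M: "\<And>a b c. flag F a b c \<Longrightarrow> nonobtuse D a b c \<and> area2 a b c = S D"
  shows "M_tessellation D {{a, b, c} | a b c. flag F a b c}"
    and "\<Union>{{a, b, c} | a b c. flag F a b c} = vertices F"
proof -
  let ?T = "{{a, b, c} | a b c. flag F a b c}"
  show "M_tessellation D ?T"
    unfolding M_tessellation_def
  proof (intro conjI ballI)
    fix T assume "T \<in> ?T"
    then obtain a b c where T: "T = {a, b, c}" and fl: "flag F a b c" by blast
    have "M_triangle D {a - a, b - a, c - a}" by (rule M_triangle_nonobtuse[OF D]) (use M[OF fl] in auto)
    moreover have "T = (\<lambda>x. x + a) ` {a - a, b - a, c - a}" by (simp add: T)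
    moreover have "a \<in> int_lattice" using M[OF fl] by (simp add: nonobtuse_def)
    ultimately show "\<exists>T\<^sub>0. \<exists>z\<in>int_lattice. M_triangle D T\<^sub>0 \<and> T = (\<lambda>x. x + z) ` T\<^sub>0" by blast
  next
    show "(\<Union>T\<in>?T. convex hull T) = UNIV"
    proof (intro equalityI subsetI UNIV_I)
      fix p :: "real^2"
      show "p \<in> (\<Union>T\<in>?T. convex hull T)" using covering[OF F, of p] by blast
    qed
  next
    show "pairwise (\<lambda>T T'. interior (convex hull T) \<inter> interior (convex hull T') = {}) ?T"
    proof (rule pairwiseI, rule ccontr)
      fix T T' assume T: "T \<in> ?T" and T': "T' \<in> ?T" and ne: "T \<noteq> T'"
        and meet: "interior (convex hull T) \<inter> interior (convex hull T') \<noteq> {}"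
      obtain x where x: "x \<in> interior (convex hull T) \<inter> interior (convex hull T')" "generic x"
        using generic_dense[OF _ meet] by blast
      then have hull: "x \<in> convex hull T" "x \<in> convex hull T'" using interior_subset by blast+
      obtain a b c where a: "T = {a, b, c}" "flag F a b c" using T by blast
      obtain a' b' c' where a': "T' = {a', b', c'}" "flag F a' b' c'" using T' by blast
      have "inside (a, b, c) x" using flag_interior[OF F a(2) x(2)] hull(1) a(1) by blast
      moreover have "inside (a', b', c') x" using flag_interior[OF F a'(2) x(2)] hull(2) a'(1) by blast
      ultimately show False using flag_unique_at[OF F x(2) a(2) _ a'(2)] ne a(1) a'(1) by auto
    qed
  qed
  show "\<Union>?T = vertices F"
  proof (intro equalityI subsetI)
    fix p assume "p \<in> \<Union>?T"
    then obtain a b c where "p \<in> {a, b, c}" "flag F a b c" by blast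
    then show "p \<in> vertices F" using flag_vertices flag_rot by blast
  next
    fix p assume "p \<in> vertices F"
    then obtain v l t where t: "t \<in># F" "v \<in> verts t" "l \<in> \<Lambda>" "p = v + l" using \<open>p \<in> vertices F\<close> unfolding vertices_def by blast
    obtain a b c where abc: "t = (a, b, c)" by (cases t)
    then have "flag F (a + l) (b + l) (c + l)" using t flag_member flag_shift by blast
    moreover have "p \<in> {a + l, b + l, c + l}" using t abc by auto
    ultimately show "p \<in> \<Union>?T" by blast
  qed
qed

text \<open>The reflection of a minimal triangle in the midpoint of the edge \<open>a b\<close> is also minimal and lies on
  the same side of that edge as the neighbouring triangle; two different ones would mean sliding.\<close>
lemma reflected_mate:
  assumes D: "attainable D" and ns: "\<not> sliding D" and F: "triangulation F"
    and M: "\<And>a b c. flag F a b c \<Longrightarrow> nonobtuse D a b c \<and> area2 a b c = S D"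
    and c: "flag F a b c"
  shows "flag F b a (a + b - c)"
proof -
  obtain d where d: "flag F b a d" using mate_exists[OF F c] by blast
  define d' where "d' = a + b - c"
  have gc: "nonobtuse D a b c" "area2 a b c = S D" and gd: "nonobtuse D b a d" "area2 b a d = S D"
    using M[OF c] M[OF d] by auto
  have dts: "area2 b a d' = area2 a b c" by (simp add: d'_def area2_def algebra_simps)
  have "nonobtuse D b a d'"
  proof -
    have "dist a d' = dist b c" "dist d' b = dist c a" "dist b a = dist a b"
      by (simp_all add: d'_def dist_norm norm_minus_commute algebra_simps)
    moreover have "apex_dot b a d' = apex_dot a b c" "apex_dot a d' b = apex_dot b c a" "apex_dot d' b a = apex_dot c a b"
      unfolding d'_def apex_dot_coord by (simp_all add: algebra_simps)
    moreover have "d' \<in> int_lattice" using gc(1)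
      by (auto simp: d'_def nonobtuse_def intro!: int_lattice_add int_lattice_diff)
    ultimately show ?thesis using gc(1) dts by (auto simp: nonobtuse_def)
  qed
  then have M': "M_triangle D {b - b, a - b, d' - b}"
    using dts gc by (intro M_triangle_nonobtuse[OF D]) auto
  have Md: "M_triangle D {b - b, a - b, d - b}"
    using gd by (intro M_triangle_nonobtuse[OF D]) auto
  have "d = d'"
  proof (rule ccontr)
    assume "d \<noteq> d'"
    have "same_half_plane (b - b) (a - b) (d - b) (d' - b)"
      unfolding same_half_plane_def
    proof (intro exI conjI)
      let ?n = "vector [-((a - b)$2), (a - b)$1] :: real^2"
      have n: "?n \<bullet> (x - b) = area2 b a x" for x by (simp add: inner_vec_def sum_2 area2_def algebra_simps)
      show "?n \<bullet> (b - b) = 0" "?n \<bullet> (a - b) = 0" "0 < ?n \<bullet> (d - b)" "0 < ?n \<bullet> (d' - b)"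
        unfolding n using gd gc dts by (simp_all add: nonobtuse_def)
    qed
    moreover have "b - b \<noteq> a - b" using gc by (auto simp: nonobtuse_def)
    moreover have "d - b \<noteq> d' - b" using \<open>d \<noteq> d'\<close> by simp
    ultimately have "sliding D" unfolding sliding_def using Md M' by blast
    then show False using ns by simp
  qed
  then show ?thesis using d by (simp add: d'_def)
qed

text \<open>Repeated point reflections produce all translates by the sub-lattice of the triangle and of its point
  reflection. These already tile the plane, so no other triangles are left.\<close>
lemma vertices_sublattice:
  assumes F: "triangulation F" and mate: "\<And>a b c. flag F a b c \<Longrightarrow> flag F b a (a + b - c)"
    and fl: "flag F a b c"
  shows "vertices F = (\<lambda>x. x + a) ` sublattice_gen (b - a) (c - a)"
proof -
  define u v where "u = b - a" and "v = c - a"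
  define up where "up x \<longleftrightarrow> flag F x (x + u) (x + v)" for x
  define down where "down x \<longleftrightarrow> flag F (x + v) (x + u) (x + u + v)" for x
  have r: "flag F y z x" "flag F z x y" if "flag F x y z" for x y z
    using flag_rot that by blast+
  have up_down: "down x" if "up x" for x
    using mate[OF r(1)[OF that[unfolded up_def]]] by (simp add: down_def algebra_simps)
  have down_up: "up x" if "down x" for x
    using r(2)[OF mate[OF that[unfolded down_def]]] by (simp add: up_def algebra_simps)
  have pu: "up (x + u)" if "up x" for x
    using r(1)[OF mate[OF r(1)[OF up_down[OF that, unfolded down_def]]]]
    by (simp add: up_def algebra_simps)
  have pv: "up (x + v)" if "up x" for x
    using mate[OF r(2)[OF up_down[OF that, unfolded down_def]]]
    by (simp add: up_def algebra_simps)
  have mv: "up (x - v)" if "up x" for x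
  proof (rule down_up)
    show "down (x - v)" using r(1)[OF mate[OF that[unfolded up_def]]] by (simp add: down_def algebra_simps)
  qed
  have mu: "up (x - u)" if "up x" for x
  proof (rule down_up)
    show "down (x - u)" using r(2)[OF mate[OF r(2)[OF that[unfolded up_def]]]] by (simp add: down_def algebra_simps)
  qed
  have line: "up (x + of_int i *\<^sub>R w)"
    if x: "up x" and w: "\<And>x. up x \<Longrightarrow> up (x + w)" "\<And>x. up x \<Longrightarrow> up (x - w)" for x w i
  proof (induction i rule: int_induct[where k = 0])
    case base then show ?case using x by simp
  next
    case (step1 i) then show ?case using w(1)[of "x + of_int i *\<^sub>R w"] by (simp add: algebra_simps)
  next
    case (step2 i) then show ?case using w(2)[of "x + of_int i *\<^sub>R w"] by (simp add: algebra_simps)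
  qed
  have "up a" using fl by (simp add: up_def u_def v_def)
  then have all: "up (a + l)" if "l \<in> sublattice_gen u v" for l
  proof -
    obtain i j where "l = of_int i *\<^sub>R u + of_int j *\<^sub>R v" using \<open>l \<in> sublattice_gen u v\<close> by (auto simp: sublattice_gen_def)
    then show ?thesis using line[OF line[OF \<open>up a\<close> pu mu, of i] pv mv, of j] by (simp add: add.assoc)
  qed
  have pr: "area2 a b c > 0" "{a, b, c} \<subseteq> int_lattice" using flag_proper[OF F fl] by (auto simp: proper_def)
  have "area2 0 u v > 0" using pr by (simp add: u_def v_def area2_def)
  moreover have "u \<in> int_lattice" "v \<in> int_lattice" using pr by (auto simp: u_def v_def int_lattice_diff)
  ultimately interpret L: torus u v by unfold_locales
  have sub: "p \<in> (\<lambda>x. x + a) ` sublattice_gen u v" if p: "p \<in> vertices F" for p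
  proof -
    obtain q r' where pqr: "flag F p q r'"
    proof -
      obtain w l t where t: "t \<in># F" "w \<in> verts t" "l \<in> \<Lambda>" "p = w + l" using p unfolding vertices_def by blast
      obtain x y z where abc: "t = (x, y, z)" by (cases t)
      then have "flag F (x + l) (y + l) (z + l)" using t flag_member flag_shift by blast
      moreover have "p = x + l \<or> p = y + l \<or> p = z + l" using t abc by auto
      ultimately show thesis using that r by blast
    qed
    have "area2 p q r' > 0" using flag_proper[OF F pqr] by (simp add: proper_def)
    have "inside (p, q, r') ((1/3) *\<^sub>R (p + q + r'))"
    proof -
      have "area2 p q ((1/3) *\<^sub>R (p + q + r')) = area2 p q r' / 3" "area2 q r' ((1/3) *\<^sub>R (p + q + r')) = area2 p q r' / 3"
        "area2 r' p ((1/3) *\<^sub>R (p + q + r')) = area2 p q r' / 3"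
        unfolding area2_def by (simp_all add: field_simps)
      then show ?thesis using \<open>area2 p q r' > 0\<close> by simp
    qed
    then obtain x where x: "generic x" "inside (p, q, r') x"
      using generic_dense[OF open_inside[of "(p, q, r')"]] by blast
    have "a \<in> int_lattice" using pr by simp
    then obtain m where m: "m \<in> sublattice_gen u v"
      "inside (a, a + u, a + v) (x - m) \<noteq> inside (a + v, a + u, a + u + v) (x - m)"
      using L.tile[OF _ x(1)] by blast
    have U: "up (a + m)" and Dn: "down (a + m)" using all[OF m(1)] up_down by auto
    have L: "a + m \<in> (\<lambda>x. x + a) ` sublattice_gen u v" "a + m + u \<in> (\<lambda>x. x + a) ` sublattice_gen u v"
      "a + m + v \<in> (\<lambda>x. x + a) ` sublattice_gen u v" "a + m + u + v \<in> (\<lambda>x. x + a) ` sublattice_gen u v"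
      using m(1) L.\<Lambda>_add[OF m(1) L.\<Lambda>_gens(1)] L.\<Lambda>_add[OF m(1) L.\<Lambda>_gens(2)]
        L.\<Lambda>_add[OF L.\<Lambda>_add[OF m(1) L.\<Lambda>_gens(1)] L.\<Lambda>_gens(2)]
      by (auto simp: add_ac image_iff)
    consider "inside (a, a + u, a + v) (x - m)" | "inside (a + v, a + u, a + u + v) (x - m)"
      using m(2) by blast
    then show ?thesis
    proof cases
      case 1
      then have "inside (a + m, a + m + u, a + m + v) x"
        using inside_shift[of m "(a, a + u, a + v)" x] by (simp add: add_ac del: inside.simps)
      from flag_unique_at[OF F x(1) U[unfolded up_def] this pqr x(2)] L show ?thesis by auto
    next
      case 2
      then have "inside (a + m + v, a + m + u, a + m + u + v) x"
        using inside_shift[of m "(a + v, a + u, a + u + v)" x] by (simp add: add_ac del: inside.simps)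
      from flag_unique_at[OF F x(1) Dn[unfolded down_def] this pqr x(2)] L show ?thesis by auto
    qed
  qed
  have "l + a \<in> vertices F" if "l \<in> sublattice_gen u v" for l
    using flag_vertices all[OF that] by (auto simp: up_def add.commute)
  then show ?thesis using sub unfolding u_def[symmetric] v_def[symmetric] by auto
qed

end

section \<open>Periodic ground states\<close>

text \<open>The two density bounds meet, so the estimate of the areas is tight.\<close>
lemma PGS_triangulation:
  assumes D: "attainable D" and \<phi>: "\<phi> \<in> PGS D"
  obtains e f F where "torus e f" "torus.triangulation e f F" "torus.vertices e f F = \<phi>"
    "\<And>a b c. torus.flag e f F a b c \<Longrightarrow> nonobtuse D a b c \<and> area2 a b c = S D"
proof -
  have gs: "ground_state D \<phi>" and per: "periodic \<phi>" using \<phi> by (auto simp: PGS_def)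
  have lat: "\<phi> \<subseteq> int_lattice" and sep: "\<And>x y. x \<in> \<phi> \<Longrightarrow> y \<in> \<phi> \<Longrightarrow> x \<noteq> y \<Longrightarrow> D \<le> dist x y"
    using gs by (auto simp: ground_state_def admissible_def)
  have Dpos: "D > 0" using D by (simp add: attainable_def)
  obtain n where n: "n > 0" and inv: "translation_invariant (square_lattice n) \<phi>"
    using periodic_square[OF per lat] by blast
  let ?e = "vector [real n, 0] :: real^2" and ?f = "vector [0, real n] :: real^2"
  let ?V = "\<phi> \<inter> square_cell (real n)"
  interpret torus ?e ?f using n by (rule torus_square)
  have area: "area2 0 ?e ?f = (real n)\<^sup>2" by (simp add: area2_def power2_eq_square)
  have density: "(real n)\<^sup>2 \<le> card ?V * S D" by (rule ground_state_density[OF D gs n inv])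
  have "card ?V \<noteq> 0"
  proof
    assume "card ?V = 0"
    then show False using density n by simp
  qed
  then have Vne: "?V \<noteq> {}" by auto
  have dec: "\<phi> = {v + l | v l. v \<in> ?V \<and> l \<in> square_lattice n}" by (rule cell_decomposition[OF n inv])
  have inj: "\<forall>x\<in>?V. \<forall>y\<in>?V. x \<noteq> y \<longrightarrow> x - y \<notin> square_lattice n" using cell_inequivalent by blast
  note bound = packing_bound[OF finite_square_cell[OF lat] Vne _ Dpos inj dec sep S_le[OF D] S_min(2)[OF D]]
  have "card ?V * S D \<le> (real n)\<^sup>2" using bound(1) lat area by auto
  then have "card ?V * S D = area2 0 ?e ?f" using density area by simp
  then obtain F where "triangulation F" "vertices F = \<phi>" "\<forall>a b c. flag F a b c \<longrightarrow> nonobtuse D a b c \<and> area2 a b c = S D"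
    using bound(2) lat by auto
  then show thesis using that[OF torus_axioms] by blast
qed

lemma nonsliding_sublattice:
  assumes D: "attainable D" and ns: "\<not> sliding D" and \<phi>: "\<phi> \<in> PGS D"
  obtains a b c where "nonobtuse D a b c" "area2 a b c = S D"
    "\<phi> = (\<lambda>x. x + a) ` sublattice_gen (b - a) (c - a)"
proof -
  obtain e f F where t: "torus e f" "torus.triangulation e f F" "torus.vertices e f F = \<phi>"
    and M: "\<And>a b c. torus.flag e f F a b c \<Longrightarrow> nonobtuse D a b c \<and> area2 a b c = S D"
    by (rule PGS_triangulation[OF D \<phi>]) blast
  interpret torus e f by (rule t)
  obtain a b c where fl: "flag F a b c" using covering[OF t(2)] by blast
  have "\<phi> = (\<lambda>x. x + a) ` sublattice_gen (b - a) (c - a)"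
    using vertices_sublattice[OF t(2) reflected_mate[OF D ns t(2) M] fl] t(3) by simp
  then show thesis using that M[OF fl] by blast
qed

lemma sublattice_square_periodic:
  assumes u: "u \<in> int_lattice" "v \<in> int_lattice" and d: "area2 0 u v = real n"
  shows "translation_invariant (square_lattice n) ((\<lambda>x. x + a) ` sublattice_gen u v)"
  unfolding translation_invariant_def
proof (intro ballI)
  fix l x assume l': "l \<in> square_lattice n" and x': "x \<in> (\<lambda>x. x + a) ` sublattice_gen u v"
  obtain i j where l: "l = vector [of_int i * real n, of_int j * real n]"
    using l' mem_square_lattice by blast
  obtain i' j' where x: "x = of_int i' *\<^sub>R u + of_int j' *\<^sub>R v + a"
    using x' unfolding sublattice_gen_def by blast
  obtain u1 u2 v1 v2 where c: "u$1 = of_int u1" "u$2 = of_int u2" "v$1 = of_int v1" "v$2 = of_int v2"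
    using u unfolding int_lattice_coord by (metis Ints_cases)
  have n: "real n = of_int u1 * of_int v2 - of_int u2 * of_int v1" using d by (simp add: area2_def c)
  have "x + l = (of_int (i' + i * v2 - j * v1) *\<^sub>R u + of_int (j' + j * u1 - i * u2) *\<^sub>R v) + a"
    unfolding x l n by (simp add: vec2_eq_iff c algebra_simps)
  then show "x + l \<in> (\<lambda>x. x + a) ` sublattice_gen u v"
    unfolding sublattice_gen_def by blast
qed

text \<open>All these cosets are invariant under the same square lattice of side \<open>S D\<close>, hence determined by
  their part in one cell.\<close>
lemma finite_PGS:
  assumes D: "attainable D" and ns: "\<not> sliding D"
  shows "finite (PGS D)"
proof -
  obtain a0 b0 c0 where g0: "nonobtuse D a0 b0 c0" "area2 a0 b0 c0 = S D" using S_min(1)[OF D] by blast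
  obtain n :: nat where n: "S D = real n" using nonobtuse_area2_nat[OF g0(1)] g0(2) by auto
  have npos: "n > 0" using g0 n by (auto simp: nonobtuse_def)
  let ?ext = "\<lambda>V. {v + l | v l. v \<in> V \<and> l \<in> square_lattice n}"
  have "PGS D \<subseteq> ?ext ` Pow (int_lattice \<inter> square_cell (real n))"
  proof
    fix \<phi> assume \<phi>: "\<phi> \<in> PGS D"
    then have lat: "\<phi> \<subseteq> int_lattice" by (auto simp: PGS_def ground_state_def admissible_def)
    obtain a b c where g: "nonobtuse D a b c" "area2 a b c = S D"
      and eq: "\<phi> = (\<lambda>x. x + a) ` sublattice_gen (b - a) (c - a)"
      using nonsliding_sublattice[OF D ns \<phi>] by blast
    have "translation_invariant (square_lattice n) \<phi>" unfolding eq
      by (rule sublattice_square_periodic) (use g n in \<open>auto simp: nonobtuse_def area2_def intro: int_lattice_diff\<close>)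
    from cell_decomposition[OF npos this] lat show "\<phi> \<in> ?ext ` Pow (int_lattice \<inter> square_cell (real n))"
      by (intro image_eqI[of _ _ "\<phi> \<inter> square_cell (real n)"]) auto
  qed
  moreover have "finite (int_lattice \<inter> square_cell (real n))" by (rule finite_square_cell) simp
  ultimately show ?thesis by (meson finite_Pow_iff finite_imageI finite_subset)
qed

theorem lemmaI:
  fixes D :: real
  assumes "attainable D"
  shows "(\<forall>\<phi>\<in>PGS D. \<exists>\<T>. M_tessellation D \<T> \<and> \<Union>\<T> = \<phi>) \<and>
    (\<not> sliding D \<longrightarrow>
       (\<forall>\<phi>\<in>PGS D. \<exists>L. \<exists>g\<in>lattice_congruences. max_dense_sublattice D L \<and> \<phi> = g ` L) \<and>
       finite (PGS D))"
proof (intro conjI impI ballI)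
  fix \<phi> assume \<phi>: "\<phi> \<in> PGS D"
  obtain e f F where t: "torus e f" "torus.triangulation e f F" "torus.vertices e f F = \<phi>"
    and M: "\<And>a b c. torus.flag e f F a b c \<Longrightarrow> nonobtuse D a b c \<and> area2 a b c = S D"
    by (rule PGS_triangulation[OF assms \<phi>]) blast
  interpret torus e f by (rule t)
  show "\<exists>\<T>. M_tessellation D \<T> \<and> \<Union>\<T> = \<phi>"
    using tessellation[OF assms t(2) M] t(3) by blast
next
  fix \<phi> assume ns: "\<not> sliding D" and \<phi>: "\<phi> \<in> PGS D"
  obtain a b c where g: "nonobtuse D a b c" "area2 a b c = S D"
    and eq: "\<phi> = (\<lambda>x. x + a) ` sublattice_gen (b - a) (c - a)"
    using nonsliding_sublattice[OF assms ns \<phi>] by blast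
  have "(\<lambda>x. x + a) \<in> lattice_congruences"
    using g by (intro lattice_congruences.shift) (simp add: nonobtuse_def)
  then show "\<exists>L. \<exists>g\<in>lattice_congruences. max_dense_sublattice D L \<and> \<phi> = g ` L"
    using max_dense[OF assms g] eq by blast
next
  assume "\<not> sliding D"
  then show "finite (PGS D)" by (rule finite_PGS[OF assms])
qed

end
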